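(* TGR is NP-complete even when restricted to instances with period $\Delta=2$.
   Context: All graphs are finite. A $\Delta$-periodic labeling of an undirected graph $G=(V,E)$ is a map $\lambda:E\to\{0,1,\dots,\Delta-1\}$; edge $e$ is then active (in both directions) exactly at the times $\lambda(e)+i\Delta$, $i\in\mathbb{N}_0$. A temporal $s$-$z$-path is a sequence $(v_{i-1},v_i,t_i)_{i=1}^{\ell}$ with $v_0=s$, $v_\ell=z$, pairwise distinct vertices $v_0,\dots,v_\ell$, $\{v_{i-1},v_i\}\in E$ active at time $t_i$ for every $i$, and $t_1<t_2<\dots<t_\ell$ (strictly increasing). Its duration is $t_\ell+1-t_1$. A fastest temporal path is one of minimum duration. $\hat d(u,v)$ is the distance of $u$ and $v$ in the static graph $G$ (all edges have unit length). TGR: The input is an undirected, connected graph $G=(V,E)$, a matrix $D$ indexed by $V\times V$ with entries positive integers or $\infty$ (no restriction) such that $D_{u,v}\ge\hat d(u,v)$ for all $u,v$, and a positive integer $\Delta$. The question is whether there is a $\Delta$-periodic labeling $\lambda$ of $E$ such that, for all $u,v\in V$, the duration of a fastest temporal path from $u$ to $v$ is at most $D_{u,v}$. Diagonal entries of $D$ play no role; all conditions on $D$ are for distinct vertices. *)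

theory Defs
  imports Complex_Main "HOL-Library.Extended_Nat" "HOL-Computational_Algebra.Polynomial"
begin

section \<open>Multi-tape Turing machines\<close>

datatype direction = Left | Stay | Right

text \<open>
  States are natural numbers: the machine starts in state \<open>0\<close> and halts on entering the state
  \<open>states M\<close>. Tape symbols are the numbers below \<open>symbols M\<close>; \<open>0\<close> is the blank, and \<open>1\<close> and \<open>2\<close>
  represent the bits (see \<open>bit_symbol\<close>). In \<open>delta M q ss\<close>, the list \<open>ss\<close> holds the scanned
  symbols, one per tape.
\<close>

record tm =
  tapes :: nat
  states :: nat
  symbols :: nat
  delta :: "nat \<Rightarrow> nat list \<Rightarrow> nat \<times> (nat \<times> direction) list"

text \<open>
  Only the finitely many values of \<open>delta M\<close> constrained here are ever used by a computation, so
  that a machine is a finite object although \<open>delta M\<close> is a total function.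
\<close>

definition turing_machine :: "tm \<Rightarrow> bool" where
  "turing_machine M \<longleftrightarrow> tapes M \<ge> 1 \<and> symbols M \<ge> 3 \<and>
     (\<forall>q < states M. \<forall>ss. length ss = tapes M \<longrightarrow> set ss \<subseteq> {..<symbols M} \<longrightarrow>
        fst (delta M q ss) \<le> states M \<and>
        length (snd (delta M q ss)) = tapes M \<and>
        fst ` set (snd (delta M q ss)) \<subseteq> {..<symbols M})"

text \<open>A tape is infinite in both directions and is paired with the position of its head.\<close>

type_synonym tape = "(int \<Rightarrow> nat) \<times> int"
type_synonym config = "nat \<times> tape list"

definition scan :: "tape \<Rightarrow> nat" where
  "scan T = fst T (snd T)"

fun offset :: "direction \<Rightarrow> int" where
  "offset Left = - 1"
| "offset Stay = 0"
| "offset Right = 1"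

definition act :: "tape \<Rightarrow> nat \<times> direction \<Rightarrow> tape" where
  "act T a = ((fst T)(snd T := fst a), snd T + offset (snd a))"

definition step :: "tm \<Rightarrow> config \<Rightarrow> config" where
  "step M c = (if fst c < states M
     then (let r = delta M (fst c) (map scan (snd c)) in (fst r, map2 act (snd c) (snd r)))
     else c)"

definition bit_symbol :: "bool \<Rightarrow> nat" where
  "bit_symbol b = (if b then 2 else 1)"

definition word_tape :: "bool list \<Rightarrow> tape" where
  "word_tape w =
     ((\<lambda>i. if 0 \<le> i \<and> i < int (length w) then bit_symbol (w ! nat i) else 0), 0)"

definition initial :: "tm \<Rightarrow> bool list list \<Rightarrow> config" where
  "initial M ws =
     (0, map (\<lambda>i. word_tape (if i < length ws then ws ! i else [])) [0..<tapes M])"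

text \<open>The result of a computation starts at the head of the first tape and ends before a blank.\<close>

definition result_word :: "tape \<Rightarrow> bool list \<Rightarrow> bool" where
  "result_word T w \<longleftrightarrow>
     (\<forall>i < length w. fst T (snd T + int i) = bit_symbol (w ! i)) \<and>
     fst T (snd T + int (length w)) = 0"

definition computes_within :: "tm \<Rightarrow> nat \<Rightarrow> bool list list \<Rightarrow> bool list \<Rightarrow> bool" where
  "computes_within M n ws w \<longleftrightarrow>
     (\<exists>t \<le> n. \<exists>c. c = (step M ^^ t) (initial M ws) \<and> fst c = states M \<and> result_word (hd (snd c)) w)"


section \<open>The class NP and NP-completeness\<close>

text \<open>A function of \<open>k\<close> words receives them on the first \<open>k\<close> tapes.\<close>

definition polytime :: "nat \<Rightarrow> (bool list list \<Rightarrow> bool list) \<Rightarrow> bool" where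
  "polytime k f \<longleftrightarrow>
     (\<exists>M (p :: nat poly). turing_machine M \<and> k \<le> tapes M \<and>
        (\<forall>ws. length ws = k \<longrightarrow>
           computes_within M (poly p (sum_list (map length ws))) ws (f ws)))"

definition NP :: "bool list set set" where
  "NP = {L. \<exists>verify (p :: nat poly). polytime 2 verify \<and>
     (\<forall>x. x \<in> L \<longleftrightarrow> (\<exists>c. length c \<le> poly p (length x) \<and> verify [x, c] = [True]))}"

definition poly_reducible :: "bool list set \<Rightarrow> bool list set \<Rightarrow> bool" where
  "poly_reducible L L' \<longleftrightarrow> (\<exists>f. polytime 1 f \<and> (\<forall>x. x \<in> L \<longleftrightarrow> f [x] \<in> L'))"

definition NP_hard :: "bool list set \<Rightarrow> bool" where
  "NP_hard L \<longleftrightarrow> (\<forall>L' \<in> NP. poly_reducible L' L)"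

definition NP_complete :: "bool list set \<Rightarrow> bool" where
  "NP_complete L \<longleftrightarrow> L \<in> NP \<and> NP_hard L"


section \<open>Graphs and periodic temporal graphs\<close>

definition simple_graph :: "'a set \<Rightarrow> 'a set set \<Rightarrow> bool" where
  "simple_graph V E \<longleftrightarrow> finite V \<and> E \<subseteq> {{u, v} |u v. u \<in> V \<and> v \<in> V \<and> u \<noteq> v}"

definition static_path :: "'a set \<Rightarrow> 'a set set \<Rightarrow> 'a \<Rightarrow> 'a \<Rightarrow> 'a list \<Rightarrow> bool" where
  "static_path V E u v xs \<longleftrightarrow> xs \<noteq> [] \<and> hd xs = u \<and> last xs = v \<and> distinct xs \<and>
     set xs \<subseteq> V \<and> successively (\<lambda>x y. {x, y} \<in> E) xs"

definition connected_graph :: "'a set \<Rightarrow> 'a set set \<Rightarrow> bool" where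
  "connected_graph V E \<longleftrightarrow> V \<noteq> {} \<and> (\<forall>u \<in> V. \<forall>v \<in> V. \<exists>xs. static_path V E u v xs)"

definition static_dist :: "'a set \<Rightarrow> 'a set set \<Rightarrow> 'a \<Rightarrow> 'a \<Rightarrow> enat" where
  "static_dist V E u v = (INF xs \<in> {xs. static_path V E u v xs}. enat (length xs - 1))"

definition periodic_labeling :: "'a set set \<Rightarrow> nat \<Rightarrow> ('a set \<Rightarrow> nat) \<Rightarrow> bool" where
  "periodic_labeling E \<Delta> lab \<longleftrightarrow> (\<forall>e \<in> E. lab e < \<Delta>)"

definition active :: "nat \<Rightarrow> ('a set \<Rightarrow> nat) \<Rightarrow> 'a set \<Rightarrow> nat \<Rightarrow> bool" where
  "active \<Delta> lab e t \<longleftrightarrow> (\<exists>i. t = lab e + i * \<Delta>)"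

text \<open>
  A step \<open>(u, v, t)\<close> traverses the edge \<open>{u, v}\<close> from \<open>u\<close> to \<open>v\<close> at time \<open>t\<close>. Paths have at least
  one step, so they are meant for distinct end vertices.
\<close>

definition temporal_path ::
  "'a set set \<Rightarrow> nat \<Rightarrow> ('a set \<Rightarrow> nat) \<Rightarrow> 'a \<Rightarrow> 'a \<Rightarrow> ('a \<times> 'a \<times> nat) list \<Rightarrow> bool" where
  "temporal_path E \<Delta> lab s z P \<longleftrightarrow>
     P \<noteq> [] \<and> fst (hd P) = s \<and> fst (snd (last P)) = z \<and>
     successively (\<lambda>(u, v, t) (u', v', t'). v = u' \<and> t < t') P \<and>
     distinct (s # map (\<lambda>(u, v, t). v) P) \<and>
     (\<forall>(u, v, t) \<in> set P. {u, v} \<in> E \<and> active \<Delta> lab {u, v} t)"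

definition duration :: "('a \<times> 'a \<times> nat) list \<Rightarrow> nat" where
  "duration P = snd (snd (last P)) + 1 - snd (snd (hd P))"

text \<open>The infimum is a minimum if there is a temporal path, and \<open>\<infinity>\<close> otherwise.\<close>

definition fastest_duration ::
  "'a set set \<Rightarrow> nat \<Rightarrow> ('a set \<Rightarrow> nat) \<Rightarrow> 'a \<Rightarrow> 'a \<Rightarrow> enat" where
  "fastest_duration E \<Delta> lab u v = (INF P \<in> {P. temporal_path E \<Delta> lab u v P}. enat (duration P))"


section \<open>The problem TGR\<close>

text \<open>The vertices of an instance \<open>I\<close> are the numbers below \<open>num_vertices I\<close>.\<close>

record tgr_instance =
  num_vertices :: nat
  edges :: "nat set set"
  bound :: "nat \<Rightarrow> nat \<Rightarrow> enat"
  period :: nat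

definition valid_instance :: "tgr_instance \<Rightarrow> bool" where
  "valid_instance I \<longleftrightarrow>
     simple_graph {..<num_vertices I} (edges I) \<and> connected_graph {..<num_vertices I} (edges I) \<and>
     period I \<ge> 1 \<and>
     (\<forall>u < num_vertices I. \<forall>v < num_vertices I. u \<noteq> v \<longrightarrow>
        bound I u v \<ge> 1 \<and> bound I u v \<ge> static_dist {..<num_vertices I} (edges I) u v)"

definition tgr_solvable :: "tgr_instance \<Rightarrow> bool" where
  "tgr_solvable I \<longleftrightarrow> (\<exists>lab. periodic_labeling (edges I) (period I) lab \<and>
     (\<forall>u < num_vertices I. \<forall>v < num_vertices I. u \<noteq> v \<longrightarrow>
        fastest_duration (edges I) (period I) lab u v \<le> bound I u v))"

text \<open>
  Instances are encoded as words by self-delimiting codes: the adjacency matrix, the matrix of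
  bounds, and the period. Numbers are written in binary, least significant bit first.
\<close>

definition encode_list :: "('a \<Rightarrow> bool list) \<Rightarrow> 'a list \<Rightarrow> bool list" where
  "encode_list enc xs = concat (map (\<lambda>x. True # enc x) xs) @ [False]"

fun binary :: "nat \<Rightarrow> bool list" where
  "binary n = (if n = 0 then [] else odd n # binary (n div 2))"

declare binary.simps [simp del]

definition encode_nat :: "nat \<Rightarrow> bool list" where
  "encode_nat n = encode_list (\<lambda>b. [b]) (binary n)"

definition encode_enat :: "enat \<Rightarrow> bool list" where
  "encode_enat d = (case d of enat n \<Rightarrow> True # encode_nat n | \<infinity> \<Rightarrow> [False])"

definition encode_matrix :: "('a \<Rightarrow> bool list) \<Rightarrow> nat \<Rightarrow> (nat \<Rightarrow> nat \<Rightarrow> 'a) \<Rightarrow> bool list" where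
  "encode_matrix enc n A =
     encode_list (\<lambda>u. encode_list (\<lambda>v. enc (A u v)) [0..<n]) [0..<n]"

definition encode_instance :: "tgr_instance \<Rightarrow> bool list" where
  "encode_instance I =
     encode_matrix (\<lambda>b. [b]) (num_vertices I) (\<lambda>u v. {u, v} \<in> edges I) @
     encode_matrix encode_enat (num_vertices I) (bound I) @
     encode_nat (period I)"

definition TGR :: "bool list set" where
  "TGR = {encode_instance I |I. valid_instance I \<and> tgr_solvable I}"

definition TGR_with_period :: "nat \<Rightarrow> bool list set" where
  "TGR_with_period \<Delta> = {encode_instance I |I. valid_instance I \<and> tgr_solvable I \<and> period I = \<Delta>}"

end

(*
  Hardness. If the tape cells of a machine are addressed relative to the heads, every transition is a
  set of Horn clauses, and only the cells of the certificate are left open; hence the computations of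
  a verifier are described by a CNF formula. A CNF formula becomes a graph with a hub that is adjacent
  to the literals and to some leaves, and with an edge between a literal and each clause containing it.
  A path whose duration equals its length must alternate the two labels of a labeling of period two.
  The bound 2 between a leaf for a literal and the vertices for the opposite literal therefore forces
  different labels on their edges to the hub, so that these labels encode an assignment relative to
  the label of a distinguished leaf; and the bound 3 from that leaf to a clause holds iff some literal
  of the clause is true.

  Membership. A certificate gives a labeling and a path for every pair of vertices. For a fixed path
  the duration is least if every edge is crossed as early as possible. Since times increase strictly,
  a path of duration d has length at most d, so the condition that the bounds are at least the
  distances need not be checked.

  Polynomial time. The tapes of a machine are used as stacks, and the values of all data types are
  binary trees on a stack. The functions computed in polynomial time by stack programs are closed under
  composition, pairing, branching, and iterations all of whose intermediate values are polynomially
  bounded, so that polynomial time can be read off the syntax of a definition.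
*)

theory Submission
  imports Defs
begin

section \<open>Stack programs\<close>

text \<open>With period one every edge is active at all times, so every valid instance is solvable;
  two is the first period at which labels matter. Exchanging the two labels shifts all times by one
  and changes no duration, so a label has no absolute truth value; this is why truth is measured
  against a distinguished leaf. Paths are started at leaves because their only neighbour is the hub:
  the first edge is then prescribed, and a bound speaks about one known edge.

  \<open>TGR\<close> is a set of words, while solvability is a property of instances. Hence the code
  of an instance must determine its solvability, and a verifier must recognise codes. No parser is
  built: the certificate contains the parts of the instance, and the verifier encodes them and
  compares the result with its input.

  Periods and bounds are written in binary and may be exponentially large. Labels and times are
  therefore kept as bit lists with explicit addition and comparison, whereas vertices and loop
  counters, whose values are polynomial in the input, are unary.\<close>

datatype com =
    Skip
  | Push nat nat
  | Pop nat
  | Seq com com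
  | IfTop nat "nat set" com com
  | WhileTop nat "nat set" com

definition top_of :: "nat list \<Rightarrow> nat" where
  "top_of xs = (case xs of [] \<Rightarrow> 0 | x # _ \<Rightarrow> x)"

lemma top_of_simps [simp]: "top_of [] = 0" "top_of (x # xs) = x"
  by (simp_all add: top_of_def)

text \<open>The running time is the exact number of steps of the machine that \<open>code\<close> below produces.\<close>

inductive exec :: "com \<Rightarrow> (nat \<Rightarrow> nat list) \<Rightarrow> nat \<Rightarrow> (nat \<Rightarrow> nat list) \<Rightarrow> bool" where
  Skip: "exec Skip \<sigma> 0 \<sigma>"
| Push: "exec (Push i s) \<sigma> 2 (\<sigma>(i := s # \<sigma> i))"
| Pop: "exec (Pop i) \<sigma> 1 (\<sigma>(i := tl (\<sigma> i)))"
| Seq: "exec c \<sigma> t \<sigma>' \<Longrightarrow> exec d \<sigma>' t' \<sigma>'' \<Longrightarrow> exec (Seq c d) \<sigma> (t + t') \<sigma>''"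
| IfTrue: "top_of (\<sigma> i) \<in> S \<Longrightarrow> exec c \<sigma> t \<sigma>' \<Longrightarrow> exec (IfTop i S c d) \<sigma> (1 + t + 1) \<sigma>'"
| IfFalse: "top_of (\<sigma> i) \<notin> S \<Longrightarrow> exec d \<sigma> t \<sigma>' \<Longrightarrow> exec (IfTop i S c d) \<sigma> (1 + t) \<sigma>'"
| WhileTrue: "top_of (\<sigma> i) \<in> S \<Longrightarrow> exec c \<sigma> t \<sigma>' \<Longrightarrow> exec (WhileTop i S c) \<sigma>' t' \<sigma>'' \<Longrightarrow>
    exec (WhileTop i S c) \<sigma> (1 + t + 1 + t') \<sigma>''"
| WhileFalse: "top_of (\<sigma> i) \<notin> S \<Longrightarrow> exec (WhileTop i S c) \<sigma> 1 \<sigma>"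

section \<open>Compilation into transition tables\<close>

definition keep :: "nat list \<Rightarrow> (nat \<times> direction) list" where
  "keep ss = map (\<lambda>s. (s, Stay)) ss"

text \<open>
  The rows of the transition table of a program whose first state is \<open>b\<close>. A stack lives on a tape
  with its top under the head and grows to the left, so that words on the tapes of an initial or
  final configuration are stacks.
\<close>

primrec code :: "com \<Rightarrow> nat \<Rightarrow> (nat list \<Rightarrow> nat \<times> (nat \<times> direction) list) list" where
  "code Skip b = []"
| "code (Push i s) b =
    [\<lambda>ss. (b + 1, (keep ss)[i := (ss ! i, Left)]), \<lambda>ss. (b + 2, (keep ss)[i := (s, Stay)])]"
| "code (Pop i) b = [\<lambda>ss. (b + 1, (keep ss)[i := (0, Right)])]"
| "code (Seq c d) b = code c b @ code d (b + length (code c b))"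
| "code (IfTop i S c d) b =
    (let cs = code c (b + 1); b' = b + 2 + length cs; ds = code d b' in
     [\<lambda>ss. (if ss ! i \<in> S then b + 1 else b', keep ss)] @ cs @ [\<lambda>ss. (b' + length ds, keep ss)] @ ds)"
| "code (WhileTop i S c) b =
    (let cs = code c (b + 1) in
     [\<lambda>ss. (if ss ! i \<in> S then b + 1 else b + 2 + length cs, keep ss)] @ cs @ [\<lambda>ss. (b, keep ss)])"

primrec wf_com :: "com \<Rightarrow> bool" where
  "wf_com Skip = True"
| "wf_com (Push i s) = (i < 4 \<and> s < 3)"
| "wf_com (Pop i) = (i < 4)"
| "wf_com (Seq c d) = (wf_com c \<and> wf_com d)"
| "wf_com (IfTop i S c d) = (i < 4 \<and> wf_com c \<and> wf_com d)"
| "wf_com (WhileTop i S c) = (i < 4 \<and> wf_com c)"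

definition machine :: "com \<Rightarrow> tm" where
  "machine c = \<lparr>tapes = 4, states = length (code c 0), symbols = 3, delta = \<lambda>q. code c 0 ! q\<rparr>"

lemma keep_simps [simp]: "length (keep ss) = length ss" "fst ` set (keep ss) = set ss"
  by (auto simp: keep_def image_image)

lemma fst_set_keep_update:
  assumes "set ss \<subseteq> A" "fst a \<in> A"
  shows "fst ` set ((keep ss)[i := a]) \<subseteq> A"
proof -
  have "fst ` set ((keep ss)[i := a]) \<subseteq> fst ` insert a (set (keep ss))"
    by (intro image_mono set_update_subset_insert)
  then show ?thesis using assms by auto
qed

text \<open>The successor state may be \<open>n\<close> itself: the address behind the last row is
  the halting state of the whole program.\<close>

definition row_ok :: "nat \<Rightarrow> (nat list \<Rightarrow> nat \<times> (nat \<times> direction) list) \<Rightarrow> bool" where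
  "row_ok n r \<longleftrightarrow> (\<forall>ss. length ss = 4 \<longrightarrow> set ss \<subseteq> {..<3} \<longrightarrow>
     fst (r ss) \<le> n \<and> length (snd (r ss)) = 4 \<and> fst ` set (snd (r ss)) \<subseteq> {..<3})"

lemma row_ok_mono: "row_ok n r \<Longrightarrow> n \<le> n' \<Longrightarrow> row_ok n' r"
  unfolding row_ok_def by (meson order_trans)

lemma row_ok_keep: "(\<And>ss. q ss \<le> n) \<Longrightarrow> row_ok n (\<lambda>ss. (q ss, keep ss))"
  by (simp add: row_ok_def del: image_subset_iff)

lemma row_ok_update:
  assumes "\<And>ss. length ss = 4 \<Longrightarrow> set ss \<subseteq> {..<3} \<Longrightarrow> fst (a ss) < 3" "q \<le> n"
  shows "row_ok n (\<lambda>ss. (q, (keep ss)[i := a ss]))"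
  using assms fst_set_keep_update unfolding row_ok_def by (simp del: image_subset_iff)

text \<open>Jumps stay inside the block of their command or go to the address just behind it, so the
  bound is inherited by enclosing blocks. The base \<open>b\<close> is arbitrary because subprograms
  start behind other rows.\<close>

lemma code_row_ok: "wf_com c \<Longrightarrow> r \<in> set (code c b) \<Longrightarrow> row_ok (b + length (code c b)) r"
proof (induction c arbitrary: b)
  case (Push i s)
  then have "length ss = 4 \<Longrightarrow> set ss \<subseteq> {..<3} \<Longrightarrow> ss ! i < 3" for ss
    by (metis lessThan_iff nth_mem subsetD wf_com.simps(2))
  then show ?case using Push by (auto intro!: row_ok_update)
next
  case (Pop i)
  then show ?case by (auto intro!: row_ok_update)
next
  case (Seq c d)
  then consider "r \<in> set (code c b)" | "r \<in> set (code d (b + length (code c b)))" by auto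
  then show ?case using Seq by cases (force intro: row_ok_mono)+
next
  case (IfTop i S c d)
  let ?b = "b + 2 + length (code c (b + 1))"
  from IfTop.prems(2) have "r = (\<lambda>ss. (if ss ! i \<in> S then b + 1 else ?b, keep ss)) \<or>
      r \<in> set (code c (b + 1)) \<or> r = (\<lambda>ss. (?b + length (code d ?b), keep ss)) \<or> r \<in> set (code d ?b)"
    by (auto simp only: code.simps Let_def set_append list.set)
  moreover have "r \<in> set (code c (b + 1)) \<Longrightarrow> row_ok (b + 1 + length (code c (b + 1))) r"
    "r \<in> set (code d ?b) \<Longrightarrow> row_ok (?b + length (code d ?b)) r"
    using IfTop.IH[of "b + 1"] IfTop.IH(2)[of ?b] IfTop.prems(1) by simp_all
  ultimately show ?case
    by (elim disjE) (auto simp: Let_def intro!: row_ok_keep elim: row_ok_mono)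
next
  case (WhileTop i S c)
  from WhileTop.prems(2) have
    "r = (\<lambda>ss. (if ss ! i \<in> S then b + 1 else b + 2 + length (code c (b + 1)), keep ss)) \<or>
      r \<in> set (code c (b + 1)) \<or> r = (\<lambda>ss. (b, keep ss))"
    by (auto simp only: code.simps Let_def set_append list.set)
  moreover have "r \<in> set (code c (b + 1)) \<Longrightarrow> row_ok (b + 1 + length (code c (b + 1))) r"
    using WhileTop.IH[of "b + 1"] WhileTop.prems(1) by simp
  ultimately show ?case
    by (elim disjE) (auto simp: Let_def intro!: row_ok_keep elim: row_ok_mono)
qed auto

lemma turing_machine_machine: "wf_com c \<Longrightarrow> turing_machine (machine c)"
  unfolding turing_machine_def machine_def
  using code_row_ok[OF _ nth_mem, of c _ 0] by (simp add: row_ok_def del: image_subset_iff)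

section \<open>Simulation of stack programs on tapes\<close>

definition rep_stack :: "nat list \<Rightarrow> tape \<Rightarrow> bool" where
  "rep_stack xs T \<longleftrightarrow>
     (\<forall>j. fst T (snd T + j) = (if 0 \<le> j \<and> j < int (length xs) then xs ! nat j else 0))"

lemma scan_rep: "rep_stack xs T \<Longrightarrow> scan T = top_of xs"
  unfolding rep_stack_def scan_def by (drule spec[of _ 0]) (cases xs, auto)

lemma rep_stack_stay: "rep_stack xs T \<Longrightarrow> rep_stack xs (act T (scan T, Stay))"
  by (simp add: rep_stack_def act_def scan_def)

text \<open>A push takes two machine steps; in between, the stack has a blank on top. Since
  \<open>rep_stack\<close> demands blanks on both sides of the stack, the cell entered by the head
  is known to be blank.\<close>

lemma rep_stack_left: "rep_stack xs T \<Longrightarrow> rep_stack (0 # xs) (act T (scan T, Left))"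
  unfolding rep_stack_def
proof
  fix j assume "\<forall>j. fst T (snd T + j) = (if 0 \<le> j \<and> j < int (length xs) then xs ! nat j else 0)"
  from spec[OF this, of "j - 1"]
  show "fst (act T (scan T, Left)) (snd (act T (scan T, Left)) + j) =
    (if 0 \<le> j \<and> j < int (length (0 # xs)) then (0 # xs) ! nat j else 0)"
    by (auto simp: act_def scan_def nth_Cons' nat_diff_distrib algebra_simps)
qed

lemma rep_stack_write: "rep_stack (x # xs) T \<Longrightarrow> rep_stack (s # xs) (act T (s, Stay))"
  unfolding rep_stack_def act_def by (auto simp: nth_Cons')

lemma rep_stack_right: "rep_stack xs T \<Longrightarrow> rep_stack (tl xs) (act T (0, Right))"
  unfolding rep_stack_def
proof
  fix j assume "\<forall>j. fst T (snd T + j) = (if 0 \<le> j \<and> j < int (length xs) then xs ! nat j else 0)"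
  from spec[OF this, of "j + 1"]
  show "fst (act T (0, Right)) (snd (act T (0, Right)) + j) =
    (if 0 \<le> j \<and> j < int (length (tl xs)) then tl xs ! nat j else 0)"
    by (cases xs) (auto simp: act_def nat_add_distrib algebra_simps)
qed

definition rep :: "(nat \<Rightarrow> nat list) \<Rightarrow> tape list \<Rightarrow> bool" where
  "rep \<sigma> ts \<longleftrightarrow> length ts = 4 \<and> (\<forall>i<4. rep_stack (\<sigma> i) (ts ! i))"

lemma rep_keep: "rep \<sigma> ts \<Longrightarrow> rep \<sigma> (map2 act ts (keep (map scan ts)))"
  by (simp add: rep_def keep_def rep_stack_stay)

lemma rep_update:
  assumes "rep \<sigma> ts" "rep_stack xs (act (ts ! i) a)" "i < 4"
  shows "rep (\<sigma>(i := xs)) (map2 act ts ((keep (map scan ts))[i := a]))"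
  using assms by (auto simp: rep_def keep_def rep_stack_stay nth_list_update)

definition code_at :: "tm \<Rightarrow> nat \<Rightarrow> (nat list \<Rightarrow> nat \<times> (nat \<times> direction) list) list \<Rightarrow> bool" where
  "code_at M b cs \<longleftrightarrow> b + length cs \<le> states M \<and> (\<forall>i < length cs. delta M (b + i) = cs ! i)"

lemma code_at_Cons [simp]:
  "code_at M b (r # cs) \<longleftrightarrow> delta M b = r \<and> b < states M \<and> code_at M (Suc b) cs"
  by (auto simp: code_at_def All_less_Suc2)

lemma code_at_append [simp]:
  "code_at M b (cs @ ds) \<longleftrightarrow> code_at M b cs \<and> code_at M (b + length cs) ds"
proof (induction cs arbitrary: b)
  case Nil
  then show ?case by (auto simp: code_at_def)
qed simp

lemma step_row:
  "b < states M \<Longrightarrow> step M (b, ts) =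
    (fst (delta M b (map scan ts)), map2 act ts (snd (delta M b (map scan ts))))"
  by (simp add: step_def Let_def)

lemma funpow_trans: "(f ^^ t) x = y \<Longrightarrow> (f ^^ t') y = z \<Longrightarrow> (f ^^ (t + t')) x = z"
  by (metis add.commute comp_apply funpow_add)

text \<open>By induction on the execution, since a loop re-enters its own rows. The run ends exactly
  at the address behind the block, so that runs of consecutive blocks are joined by adding their
  times.\<close>

lemma exec_simulation:
  assumes "exec c \<sigma> t \<sigma>'" "code_at M b (code c b)" "wf_com c" "rep \<sigma> ts"
  shows "\<exists>ts'. (step M ^^ t) (b, ts) = (b + length (code c b), ts') \<and> rep \<sigma>' ts'"
  using assms
proof (induction arbitrary: b ts rule: exec.induct)
  case (Skip \<sigma>)
  then show ?case by auto
next
  case (Push i s \<sigma>)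
  let ?T = "map2 act ts ((keep (map scan ts))[i := (map scan ts ! i, Left)])"
  let ?U = "map2 act ?T ((keep (map scan ?T))[i := (s, Stay)])"
  have i: "i < 4" "length ts = 4" using Push by (auto simp: rep_def)
  have "rep_stack (0 # \<sigma> i) (act (ts ! i) (map scan ts ! i, Left))"
    using Push i by (auto simp: rep_def intro: rep_stack_left)
  from rep_update[OF Push.prems(3) this i(1)] have T: "rep (\<sigma>(i := 0 # \<sigma> i)) ?T" .
  then have "rep_stack (0 # \<sigma> i) (?T ! i)" using i unfolding rep_def by (metis fun_upd_same)
  from rep_update[OF T rep_stack_write[OF this] i(1)]
  have U: "rep (\<sigma>(i := s # \<sigma> i)) ?U" by simp
  have "step M (b, ts) = (b + 1, ?T)" using Push.prems(1) by (simp add: step_row)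
  moreover have "step M (b + 1, ?T) = (b + 2, ?U)" using Push.prems(1) by (simp add: step_row)
  ultimately have "(step M ^^ 2) (b, ts) = (b + length (code (Push i s) b), ?U)"
    by (simp add: numeral_2_eq_2 del: map_map)
  with U show ?case by blast
next
  case (Pop i \<sigma>)
  then have "rep (\<sigma>(i := tl (\<sigma> i))) (map2 act ts ((keep (map scan ts))[i := (0, Right)]))"
    by (intro rep_update) (auto simp: rep_def intro: rep_stack_right)
  moreover have "(step M ^^ 1) (b, ts) =
      (b + length (code (Pop i) b), map2 act ts ((keep (map scan ts))[i := (0, Right)]))"
    using Pop.prems by (simp add: step_row)
  ultimately show ?case by blast
next
  case (Seq c \<sigma> t \<sigma>' d t' \<sigma>'')
  from Seq.prems have 1: "code_at M b (code c b)" "wf_com c"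
    "code_at M (b + length (code c b)) (code d (b + length (code c b)))" "wf_com d"
    by auto
  from Seq.IH(1)[OF 1(1,2) Seq.prems(3)] obtain ts' where
    2: "(step M ^^ t) (b, ts) = (b + length (code c b), ts')" "rep \<sigma>' ts'" by blast
  from Seq.IH(2)[OF 1(3,4) 2(2)] obtain ts'' where
    "(step M ^^ t') (b + length (code c b), ts') =
       (b + length (code c b) + length (code d (b + length (code c b))), ts'')" "rep \<sigma>'' ts''" by blast
  with funpow_trans[OF 2(1) this(1)] show ?case by (auto simp: add.assoc)
next
  case (IfTrue \<sigma> i S c t \<sigma>' d)
  let ?ts = "map2 act ts (keep (map scan ts))"
  let ?n = "length (code c (b + 1))"
  have "map scan ts ! i \<in> S" using IfTrue by (auto simp: rep_def scan_rep)
  then have 1: "(step M ^^ 1) (b, ts) = (b + 1, ?ts)" using IfTrue.prems by (simp add: step_row Let_def)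
  from IfTrue.IH[of "b + 1" ?ts] IfTrue.prems rep_keep obtain ts' where
    2: "(step M ^^ t) (b + 1, ?ts) = (b + 1 + ?n, ts')" "rep \<sigma>' ts'" by (auto simp: Let_def)
  have 3: "(step M ^^ 1) (b + 1 + ?n, ts') =
      (b + length (code (IfTop i S c d) b), map2 act ts' (keep (map scan ts')))"
    using IfTrue.prems by (simp add: step_row Let_def)
  from funpow_trans[OF funpow_trans[OF 1 2(1)] 3] rep_keep[OF 2(2)] show ?case by blast
next
  case (IfFalse \<sigma> i S d t \<sigma>' c)
  let ?ts = "map2 act ts (keep (map scan ts))"
  let ?b = "b + 2 + length (code c (b + 1))"
  have "map scan ts ! i \<notin> S" using IfFalse by (auto simp: rep_def scan_rep)
  then have 1: "(step M ^^ 1) (b, ts) = (?b, ?ts)" using IfFalse.prems by (simp add: step_row Let_def)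
  from IfFalse.IH[of ?b ?ts] IfFalse.prems rep_keep obtain ts' where
    2: "(step M ^^ t) (?b, ?ts) = (?b + length (code d ?b), ts')" "rep \<sigma>' ts'" by (auto simp: Let_def)
  from funpow_trans[OF 1 2(1)] 2(2) show ?case by (auto simp: Let_def add_ac)
next
  case (WhileTrue \<sigma> i S c t \<sigma>' t' \<sigma>'')
  let ?ts = "map2 act ts (keep (map scan ts))"
  let ?n = "length (code c (b + 1))"
  have "map scan ts ! i \<in> S" using WhileTrue by (auto simp: rep_def scan_rep)
  then have 1: "(step M ^^ 1) (b, ts) = (b + 1, ?ts)" using WhileTrue.prems by (simp add: step_row Let_def)
  from WhileTrue.IH(1)[of "b + 1" ?ts] WhileTrue.prems rep_keep obtain ts' where
    2: "(step M ^^ t) (b + 1, ?ts) = (b + 1 + ?n, ts')" "rep \<sigma>' ts'" by (auto simp: Let_def)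
  have 3: "(step M ^^ 1) (b + 1 + ?n, ts') = (b, map2 act ts' (keep (map scan ts')))"
    using WhileTrue.prems by (simp add: step_row Let_def)
  from WhileTrue.IH(2)[OF WhileTrue.prems(1,2) rep_keep[OF 2(2)]] obtain ts'' where
    4: "(step M ^^ t') (b, map2 act ts' (keep (map scan ts'))) =
      (b + length (code (WhileTop i S c) b), ts'')" "rep \<sigma>'' ts''" by blast
  from funpow_trans[OF funpow_trans[OF funpow_trans[OF 1 2(1)] 3] 4(1)] 4(2) show ?case by blast
next
  case (WhileFalse \<sigma> i S c)
  let ?ts = "map2 act ts (keep (map scan ts))"
  have "map scan ts ! i \<notin> S" using WhileFalse by (auto simp: rep_def scan_rep)
  then have "(step M ^^ 1) (b, ts) = (b + length (code (WhileTop i S c) b), ?ts)"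
    using WhileFalse.prems by (simp add: step_row Let_def)
  then show ?case using rep_keep[OF WhileFalse.prems(3)] by auto
qed

lemma rep_stack_word_tape: "rep_stack (map bit_symbol w) (word_tape w)"
  by (auto simp: rep_stack_def word_tape_def)

lemma rep_stack_result_word:
  assumes "rep_stack (map bit_symbol w) T"
  shows "result_word T w"
  unfolding result_word_def using assms by (auto simp: rep_stack_def)

definition stacks :: "nat list \<Rightarrow> nat list \<Rightarrow> nat list \<Rightarrow> nat list \<Rightarrow> nat \<Rightarrow> nat list" where
  "stacks x y m k = (\<lambda>i. if i = 0 then x else if i = 1 then y else if i = 2 then m else if i =
      3 then k else [])"

lemma stacks_simps [simp]:
  "stacks x y m k 0 = x" "stacks x y m k (Suc 0) = y" "stacks x y m k 2 = m" "stacks x y m k 3 = k"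
  "(stacks x y m k)(0 := z) = stacks z y m k"
  "(stacks x y m k)(Suc 0 := z) = stacks x z m k"
  "(stacks x y m k)(2 := z) = stacks x y z k"
  "(stacks x y m k)(3 := z) = stacks x y m z"
  by (auto simp: stacks_def fun_eq_iff)

text \<open>A missing second word and an empty one give the same initial tape, so one statement
  serves both arities. The other stacks may end with any content, because a result is read from the
  first tape.\<close>

lemma computes_within_machine:
  assumes "exec c (stacks (map bit_symbol x) (map bit_symbol y) [] []) t (stacks (map bit_symbol w) u m k)"
    "wf_com c" "t \<le> n" "ws = [x] \<and> y = [] \<or> ws = [x, y]"
  shows "computes_within (machine c) n ws w"
proof -
  let ?M = "machine c"
  have "rep_stack [] (word_tape [])" using rep_stack_word_tape[of "[]"] by simp
  moreover have "i < 4 \<Longrightarrow> i = 0 \<or> i = 1 \<or> i = 2 \<or> i = 3" for i :: nat by arith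
  moreover have "[0..<4] = [0, 1, 2, 3::nat]" by (simp add: upt_conv_Cons)
  ultimately have "rep (stacks (map bit_symbol x) (map bit_symbol y) [] []) (snd (initial ?M ws))"
    using assms(4) rep_stack_word_tape[of x] rep_stack_word_tape[of y]
    by (force simp: rep_def initial_def machine_def)
  moreover have "code_at ?M 0 (code c 0)" by (simp add: code_at_def machine_def)
  moreover have "fst (initial ?M ws) = 0" by (simp add: initial_def)
  ultimately obtain ts where
    1: "(step ?M ^^ t) (initial ?M ws) = (length (code c 0), ts)" "rep (stacks (map bit_symbol w) u m k) ts"
    using exec_simulation[OF assms(1) _ assms(2)] by (metis add_0 prod.collapse)
  then have "rep_stack (map bit_symbol w) (hd ts)"
    unfolding rep_def by (metis hd_conv_nth length_0_conv stacks_simps(1) zero_less_numeral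
        zero_neq_numeral)
  from rep_stack_result_word[OF this] 1 show ?thesis
    unfolding computes_within_def using assms(3) by (intro exI[of _ t]) (auto simp: machine_def)
qed

declare One_nat_def [simp del] \<comment> \<open>stacks and symbols are denoted by numerals\<close>

lemma stacks_1 [simp]: "stacks x y m k 1 = y" "(stacks x y m k)(1 := z) = stacks x z m k"
  by (simp_all add: One_nat_def)

section \<open>Upper bounds for running times\<close>

definition runs :: "com \<Rightarrow> (nat \<Rightarrow> nat list) \<Rightarrow> nat \<Rightarrow> (nat \<Rightarrow> nat list) \<Rightarrow> bool" where
  "runs c \<sigma> n \<sigma>' \<longleftrightarrow> (\<exists>t \<le> n. exec c \<sigma> t \<sigma>')"

lemma runs_mono: "runs c \<sigma> n \<sigma>' \<Longrightarrow> n \<le> m \<Longrightarrow> runs c \<sigma> m \<sigma>'"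
  unfolding runs_def by (meson order_trans)

lemma runs_Skip: "runs Skip \<sigma> 0 \<sigma>"
  unfolding runs_def using exec.Skip by blast

lemma runs_Push: "runs (Push i s) \<sigma> 2 (\<sigma>(i := s # \<sigma> i))"
  unfolding runs_def using exec.Push by blast

lemma runs_Pop: "runs (Pop i) \<sigma> 1 (\<sigma>(i := tl (\<sigma> i)))"
  unfolding runs_def using exec.Pop by blast

lemma runs_Seq: "runs c \<sigma> n \<sigma>' \<Longrightarrow> runs d \<sigma>' m \<sigma>'' \<Longrightarrow> runs (Seq c d) \<sigma> (n + m) \<sigma>''"
  unfolding runs_def by (meson add_mono exec.Seq)

lemma runs_IfTrue: "top_of (\<sigma> i) \<in> S \<Longrightarrow> runs c \<sigma> n \<sigma>' \<Longrightarrow> runs (IfTop i S c d) \<sigma> (n + 2) \<sigma>'"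
  unfolding runs_def
proof (elim exE conjE)
  fix t assume "top_of (\<sigma> i) \<in> S" "exec c \<sigma> t \<sigma>'" "t \<le> n"
  then show "\<exists>t\<le>n + 2. exec (IfTop i S c d) \<sigma> t \<sigma>'"
    by (intro exI[of _ "1 + t + 1"] conjI exec.IfTrue) simp_all
qed

lemma runs_IfFalse: "top_of (\<sigma> i) \<notin> S \<Longrightarrow> runs d \<sigma> n \<sigma>' \<Longrightarrow> runs (IfTop i S c d) \<sigma> (n + 2) \<sigma>'"
  unfolding runs_def
proof (elim exE conjE)
  fix t assume "top_of (\<sigma> i) \<notin> S" "exec d \<sigma> t \<sigma>'" "t \<le> n"
  then show "\<exists>t\<le>n + 2. exec (IfTop i S c d) \<sigma> t \<sigma>'"
    by (intro exI[of _ "1 + t"] conjI exec.IfFalse) simp_all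
qed

lemma runs_WhileTrue:
  assumes "top_of (\<sigma> i) \<in> S" "runs c \<sigma> n \<sigma>'" "runs (WhileTop i S c) \<sigma>' m \<sigma>''"
  shows "runs (WhileTop i S c) \<sigma> (n + 2 + m) \<sigma>''"
proof -
  from assms(2,3) obtain t t' where "t \<le> n" "exec c \<sigma> t \<sigma>'" "t' \<le> m" "exec (WhileTop i S c) \<sigma>' t' \<sigma>''"
    unfolding runs_def by blast
  with exec.WhileTrue[of \<sigma>, OF assms(1)] show ?thesis
    unfolding runs_def by (intro exI[of _ "1 + t + 1 + t'"]) auto
qed

lemma runs_WhileTrue':
  assumes "top_of (\<sigma> i) \<in> S" "runs c \<sigma> n \<sigma>'" "runs (WhileTop i S c) \<sigma>' m \<sigma>''" "n + 2 + m \<le> l"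
  shows "runs (WhileTop i S c) \<sigma> l \<sigma>''"
  using runs_mono[OF runs_WhileTrue[of \<sigma> i S, OF assms(1-3)] assms(4)] .

lemma runs_WhileFalse: "top_of (\<sigma> i) \<notin> S \<Longrightarrow> runs (WhileTop i S c) \<sigma> 1 \<sigma>"
  unfolding runs_def using exec.WhileFalse by blast

definition move :: "nat \<Rightarrow> nat \<Rightarrow> com" where
  "move i j = WhileTop i {1, 2} (IfTop i {1} (Seq (Push j 1) (Pop i)) (Seq (Push j 2) (Pop i)))"

text \<open>Moving reverses the word. A symbol costs at most 7 steps: two tests, 2 for the push, 1
  for the pop, and the jumps that close the branch and the loop body. The final test is the summand
  1.\<close>

lemma runs_move:
  assumes "set (\<sigma> i) \<subseteq> {1, 2}" "i \<noteq> j"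
  shows "runs (move i j) \<sigma> (7 * length (\<sigma> i) + 1) (\<sigma>(i := [], j := rev (\<sigma> i) @ \<sigma> j))"
  using assms
proof (induction "\<sigma> i" arbitrary: \<sigma>)
  case Nil
  have eq: "\<sigma>(i := [], j := rev (\<sigma> i) @ \<sigma> j) = \<sigma>" using Nil by (auto simp: fun_eq_iff)
  have "runs (move i j) \<sigma> 1 \<sigma>" unfolding move_def by (rule runs_WhileFalse) (simp add: Nil(1)[symmetric])
  then show ?case unfolding eq by (rule runs_mono) simp
next
  case (Cons s xs)
  let ?\<sigma> = "\<sigma>(j := s # \<sigma> j, i := xs)"
  have s: "s = 1 \<or> s = 2" "set xs \<subseteq> {1, 2}" using Cons.prems Cons.hyps(2)[symmetric] by auto
  have "runs (Seq (Push j s) (Pop i)) \<sigma> 3 ?\<sigma>"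
    using runs_Seq[OF runs_Push[of j s \<sigma>] runs_Pop[of i]] Cons.prems Cons.hyps(2)[symmetric] by simp
  then have "runs (IfTop i {1} (Seq (Push j 1) (Pop i)) (Seq (Push j 2) (Pop i))) \<sigma> 5 ?\<sigma>"
    using s Cons.hyps(2)[symmetric] runs_IfTrue[of \<sigma> i "{1}" _ 3] runs_IfFalse[of \<sigma> i "{1}" _ 3]
        by fastforce
  moreover have "runs (move i j) ?\<sigma> (7 * length xs + 1) (?\<sigma>(i := [], j := rev xs @ ?\<sigma> j))"
    using Cons.hyps(1)[of ?\<sigma>] Cons.prems s by simp
  moreover have "?\<sigma>(i := [], j := rev xs @ ?\<sigma> j) = \<sigma>(i := [], j := rev (\<sigma> i) @ \<sigma> j)"
    using Cons.prems Cons.hyps(2)[symmetric] by (auto simp: fun_eq_iff)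
  ultimately have "runs (move i j) \<sigma> (5 + 2 + (7 * length xs + 1)) (\<sigma>(i := [], j := rev (\<sigma> i) @ \<sigma> j))"
    unfolding move_def using s Cons.hyps(2)[symmetric] by (intro runs_WhileTrue) auto
  then show ?case using Cons.hyps(2)[symmetric] by simp
qed

section \<open>Polynomial-time functions on trees\<close>

datatype tree = Lf | Nd tree tree

text \<open>Preorder notation: a code shows where it ends, so values lie directly on top of each
  other without separators. The blank does not occur in it and marks the bottom of a stack.\<close>

primrec enc :: "tree \<Rightarrow> nat list" where
  "enc Lf = [1]"
| "enc (Nd a b) = 2 # enc a @ enc b"

abbreviation size_of :: "tree \<Rightarrow> nat" where
  "size_of x \<equiv> length (enc x)"

lemma set_enc: "set (enc x) \<subseteq> {1, 2}"
  by (induction x) auto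

lemma top_enc [simp]: "top_of (enc x @ r) = (if x = Lf then 1 else 2)"
  by (cases x) auto

lemma enc_nonempty [simp]: "enc x \<noteq> []"
  by (cases x) auto

text \<open>
  The value under consideration is on top of stack 2, whose lower part is left alone; stacks 0, 1
  and 3 are auxiliary. In \<open>take_value\<close>, stack 3 counts the subtrees still to be moved.
\<close>

definition take_loop :: "nat \<Rightarrow> com" where
  "take_loop j = WhileTop 3 {1} (IfTop 2 {1} (Seq (Push j 1) (Seq (Pop 2) (Pop 3)))
     (Seq (Push j 2) (Seq (Pop 2) (Push 3 1))))"

definition take_value :: "nat \<Rightarrow> com" where
  "take_value j = Seq (Push 3 1) (take_loop j)"

text \<open>In continuation form: the loop does not stop after one tree but goes on with the trees
  still counted on stack 3. With the remaining run as a parameter, the induction hypotheses for the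
  two subtrees of a node can be chained.\<close>

lemma runs_take_loop:
  assumes "\<sigma> 2 = enc x @ r" "\<sigma> 3 = 1 # k" "j < 2"
    "runs (take_loop j) (\<sigma>(j := rev (enc x) @ \<sigma> j, 2 := r, 3 := k)) n \<sigma>'"
  shows "runs (take_loop j) \<sigma> (9 * size_of x + n) \<sigma>'"
  using assms
proof (induction x arbitrary: \<sigma> r k n)
  case Lf
  let ?\<sigma> = "\<sigma>(j := 1 # \<sigma> j, 2 := r, 3 := k)"
  have "runs (Seq (Push j 1) (Seq (Pop 2) (Pop 3))) \<sigma> (2 + (1 + 1)) ?\<sigma>"
    using runs_Seq[OF runs_Push[of j 1 \<sigma>] runs_Seq[OF runs_Pop[of 2] runs_Pop[of 3]]] Lf(1-3) by simp
  then have 1: "runs (IfTop 2 {1} (Seq (Push j 1) (Seq (Pop 2) (Pop 3)))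
     (Seq (Push j 2) (Seq (Pop 2) (Push 3 1)))) \<sigma> (2 + (1 + 1) + 2) ?\<sigma>"
    using Lf(1) by (intro runs_IfTrue) simp_all
  have "runs (take_loop j) ?\<sigma> n \<sigma>'"
    using Lf(4) by (simp only: enc.simps rev.simps append.simps)
  from runs_WhileTrue'[OF _ 1 this[unfolded take_loop_def]] Lf(2) show ?case
    unfolding take_loop_def by simp
next
  case (Nd a b)
  let ?\<sigma> = "\<sigma>(j := 2 # \<sigma> j, 2 := enc a @ enc b @ r, 3 := 1 # 1 # k)"
  have "runs (Seq (Push j 2) (Seq (Pop 2) (Push 3 1))) \<sigma> (2 + (1 + 2)) ?\<sigma>"
    using runs_Seq[OF runs_Push[of j 2 \<sigma>] runs_Seq[OF runs_Pop[of 2] runs_Push[of 3 1]]] Nd.prems(1-3)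
    by simp
  then have 1: "runs (IfTop 2 {1} (Seq (Push j 1) (Seq (Pop 2) (Pop 3)))
     (Seq (Push j 2) (Seq (Pop 2) (Push 3 1)))) \<sigma> (2 + (1 + 2) + 2) ?\<sigma>"
    using Nd.prems(1) by (intro runs_IfFalse) simp_all
  have "runs (take_loop j) (?\<sigma>(j := rev (enc a) @ ?\<sigma> j, 2 := enc b @ r, 3 := 1 # k))
     (9 * size_of b + n) \<sigma>'"
  proof (rule Nd.IH(2)[of _ r k])
    let ?\<sigma>' = "?\<sigma>(j := rev (enc a) @ ?\<sigma> j, 2 := enc b @ r, 3 := 1 # k)"
    have "?\<sigma>'(j := rev (enc b) @ ?\<sigma>' j, 2 := r, 3 := k) = \<sigma>(j := rev (enc (Nd a b)) @ \<sigma> j, 2 := r, 3 := k)"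
      using Nd.prems(3) by (auto simp: fun_eq_iff)
    then show "runs (take_loop j) (?\<sigma>'(j := rev (enc b) @ ?\<sigma>' j, 2 := r, 3 := k)) n \<sigma>'"
      using Nd.prems(4) by argo
  qed (use Nd.prems(3) in simp_all)
  then have "runs (take_loop j) ?\<sigma> (9 * size_of a + (9 * size_of b + n)) \<sigma>'"
    by (rule Nd.IH(1)[OF _ _ Nd.prems(3), rotated 2]) simp_all
  from runs_WhileTrue'[OF _ 1 this[unfolded take_loop_def]] Nd.prems(2) show ?case
    unfolding take_loop_def by simp
qed

lemma runs_take_value:
  assumes "\<sigma> 2 = enc x @ r" "\<sigma> 3 = []" "j < 2"
  shows "runs (take_value j) \<sigma> (9 * size_of x + 3) (\<sigma>(j := rev (enc x) @ \<sigma> j, 2 := r))"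
proof -
  have [simp]: "\<sigma>(3 := []) = \<sigma>" using assms(2) by (auto simp: fun_eq_iff)
  have "\<sigma>(j := rev (enc x) @ \<sigma> j, 2 := r, 3 := []) = \<sigma>(j := rev (enc x) @ \<sigma> j, 2 := r)"
    using assms(2,3) by (auto simp: fun_eq_iff)
  then have "runs (take_loop j) (\<sigma>(3 := [1])) (9 * size_of x + 1) (\<sigma>(j := rev (enc x) @ \<sigma> j, 2 := r))"
    using assms by (intro runs_take_loop[of _ x r "[]"])
      (simp_all add: take_loop_def runs_WhileFalse fun_upd_twist[of j 3] fun_upd_twist[of 2 3])
  then have "runs (take_loop j) (\<sigma>(3 := 1 # \<sigma> 3)) (9 * size_of x + 1) (\<sigma>(j := rev (enc x) @ \<sigma> j, 2 := r))"
    using assms(2) by simp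
  from runs_Seq[OF runs_Push this] show ?thesis
    unfolding take_value_def by (rule runs_mono) simp
qed

section \<open>Copying, exchanging and discarding values\<close>

abbreviation main_stack :: "nat list \<Rightarrow> nat \<Rightarrow> nat list" where
  "main_stack m \<equiv> stacks [] [] m []"

definition dup_loop :: com where
  "dup_loop = WhileTop 0 {1, 2} (IfTop 0 {1} (Seq (Push 1 1) (Seq (Push 2 1) (Pop 0)))
     (Seq (Push 1 2) (Seq (Push 2 2) (Pop 0))))"

definition dup :: com where
  "dup = Seq (take_value 0) (Seq dup_loop (Seq (move 1 0) (move 0 2)))"

lemma runs_dup_loop:
  "set xs \<subseteq> {1, 2} \<Longrightarrow> runs dup_loop (stacks xs y m []) (9 * length xs + 1)
      (stacks [] (rev xs @ y) (rev xs @ m) [])"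
proof (induction xs arbitrary: y m)
  case Nil
  then show ?case by (simp add: dup_loop_def runs_WhileFalse)
next
  case (Cons s xs)
  have s: "s = 1 \<or> s = 2" using Cons.prems by auto
  have "runs (Seq (Push 1 s) (Seq (Push 2 s) (Pop 0))) (stacks (s # xs) y m []) (2 + (2 + 1))
     (stacks xs (s # y) (s # m) [])"
    using runs_Seq[OF runs_Push[of 1 s "stacks (s # xs) y m []"]
        runs_Seq[OF runs_Push[of 2 s] runs_Pop[of 0]]]
    by simp
  then have 1: "runs (IfTop 0 {1} (Seq (Push 1 1) (Seq (Push 2 1) (Pop 0)))
     (Seq (Push 1 2) (Seq (Push 2 2) (Pop 0)))) (stacks (s # xs) y m []) (2 + (2 + 1) + 2)
     (stacks xs (s # y) (s # m) [])"
    using s runs_IfTrue[of "stacks (s # xs) y m []" 0 "{1}" _ 5]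
      runs_IfFalse[of "stacks (s # xs) y m []" 0 "{1}" _ 5] by fastforce
  have "runs dup_loop (stacks xs (s # y) (s # m) []) (9 * length xs + 1)
      (stacks [] (rev (s # xs) @ y) (rev (s # xs) @ m) [])"
    using Cons.IH[of "s # y" "s # m"] Cons.prems by simp
  from runs_WhileTrue'[OF _ 1 this[unfolded dup_loop_def]] s show ?case
    unfolding dup_loop_def by simp
qed

text \<open>Taking the value reverses it, and \<open>dup_loop\<close> reverses it again while
  writing to two stacks: one copy is then in place, and the other is brought back in the right order
  by two further moves.\<close>

lemma runs_dup: "runs dup (main_stack (enc x @ r)) (40 * size_of x) (main_stack (enc x @ enc x @ r))"
proof -
  have 1: "runs (take_value 0) (main_stack (enc x @ r)) (9 * size_of x + 3) (stacks (rev (enc x)) [] r [])"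
    using runs_take_value[of "main_stack (enc x @ r)" x r 0] by simp
  have 2: "runs dup_loop (stacks (rev (enc x)) [] r []) (9 * size_of x + 1)
      (stacks [] (enc x) (enc x @ r) [])"
    using runs_dup_loop[of "rev (enc x)" "[]" r] set_enc by simp
  have 3: "runs (move 1 0) (stacks [] (enc x) (enc x @ r) []) (7 * size_of x + 1)
      (stacks (rev (enc x)) [] (enc x @ r) [])"
    using runs_move[of "stacks [] (enc x) (enc x @ r) []" 1 0] set_enc by simp
  have 4: "runs (move 0 2) (stacks (rev (enc x)) [] (enc x @ r) []) (7 * size_of x + 1)
      (main_stack (enc x @ enc x @ r))"
    using runs_move[of "stacks (rev (enc x)) [] (enc x @ r) []" 0 2] set_enc by simp
  \<comment> \<open>A code has at least one symbol, so the additive constants of the four stages are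
    absorbed by the factor 40.\<close>
  have "0 < size_of x" by simp
  then show ?thesis unfolding dup_def
    by (intro runs_mono[OF runs_Seq[OF 1 runs_Seq[OF 2 runs_Seq[OF 3 4]]]]) linarith
qed

definition swap :: com where
  "swap = Seq (take_value 0) (Seq (take_value 1) (Seq (move 0 2) (move 1 2)))"

lemma runs_swap:
  "runs swap (main_stack (enc x @ enc y @ r)) (20 * size_of x + 20 * size_of y)
      (main_stack (enc y @ enc x @ r))"
proof -
  have 1: "runs (take_value 0) (main_stack (enc x @ enc y @ r)) (9 * size_of x + 3)
      (stacks (rev (enc x)) [] (enc y @ r) [])"
    using runs_take_value[of "main_stack (enc x @ enc y @ r)" x "enc y @ r" 0] by simp
  have 2: "runs (take_value 1) (stacks (rev (enc x)) [] (enc y @ r) []) (9 * size_of y + 3)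
      (stacks (rev (enc x)) (rev (enc y)) r [])"
    using runs_take_value[of "stacks (rev (enc x)) [] (enc y @ r) []" y r 1] by simp
  have 3: "runs (move 0 2) (stacks (rev (enc x)) (rev (enc y)) r []) (7 * size_of x + 1)
      (stacks [] (rev (enc y)) (enc x @ r) [])"
    using runs_move[of "stacks (rev (enc x)) (rev (enc y)) r []" 0 2] set_enc by simp
  have 4: "runs (move 1 2) (stacks [] (rev (enc y)) (enc x @ r) []) (7 * size_of y + 1)
      (main_stack (enc y @ enc x @ r))"
    using runs_move[of "stacks [] (rev (enc y)) (enc x @ r) []" 1 2] set_enc by simp
  have "0 < size_of x" "0 < size_of y" by simp_all
  then show ?thesis unfolding swap_def
    by (intro runs_mono[OF runs_Seq[OF 1 runs_Seq[OF 2 runs_Seq[OF 3 4]]]]) linarith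
qed

definition discard :: com where
  "discard = Seq (take_value 0) (WhileTop 0 {1, 2} (Pop 0))"

lemma runs_pop_loop:
  "set xs \<subseteq> {1, 2} \<Longrightarrow> runs (WhileTop 0 {1, 2} (Pop 0)) (stacks xs y m k) (3 * length xs + 1)
      (stacks [] y m k)"
proof (induction xs)
  case Nil
  then show ?case by (simp add: runs_WhileFalse)
next
  case (Cons s xs)
  have "runs (Pop 0) (stacks (s # xs) y m k) 1 (stacks xs y m k)"
    using runs_Pop[of 0 "stacks (s # xs) y m k"] by simp
  from runs_WhileTrue'[OF _ this Cons.IH] Cons.prems show ?case by simp
qed

lemma runs_discard: "runs discard (main_stack (enc x @ r)) (16 * size_of x) (main_stack r)"
proof -
  have 1: "runs (take_value 0) (main_stack (enc x @ r)) (9 * size_of x + 3) (stacks (rev (enc x)) [] r [])"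
    using runs_take_value[of "main_stack (enc x @ r)" x r 0] by simp
  have 2: "runs (WhileTop 0 {1, 2} (Pop 0)) (stacks (rev (enc x)) [] r []) (3 * size_of x + 1)
      (main_stack r)"
    using runs_pop_loop[of "rev (enc x)" "[]" r "[]"] set_enc by simp
  have "0 < size_of x" by simp
  then show ?thesis unfolding discard_def by (intro runs_mono[OF runs_Seq[OF 1 2]]) linarith
qed

lemma wf_basic [simp]: "wf_com (move i j) \<longleftrightarrow> i < 4 \<and> j < 4" "wf_com (take_value j) \<longleftrightarrow> j < 4"
  "wf_com dup" "wf_com swap" "wf_com discard"
  by (auto simp: move_def take_value_def take_loop_def dup_def dup_loop_def swap_def discard_def)

lemma poly_mono: "m \<le> n \<Longrightarrow> poly p m \<le> poly p n" for p :: "nat poly"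
  by (induction p) (auto intro!: add_mono mult_mono)

class encodable =
  fixes tr :: "'a \<Rightarrow> tree"
  assumes inj_tr: "tr x = tr y \<Longrightarrow> x = y"

lemma tr_eq_iff [simp]: "tr x = tr y \<longleftrightarrow> x = y"
  using inj_tr by blast

abbreviation code_of :: "'a::encodable \<Rightarrow> nat list" where
  "code_of x \<equiv> enc (tr x)"

abbreviation tsize :: "'a::encodable \<Rightarrow> nat" where
  "tsize x \<equiv> length (code_of x)"

text \<open>Composition needs a bound on the output as well as on the time; one polynomial serves
  for both. The part \<open>r\<close> below the argument is arbitrary, so that other values can wait
  there during the run.\<close>

definition computes :: "com \<Rightarrow> nat poly \<Rightarrow> ('a::encodable \<Rightarrow> 'b::encodable) \<Rightarrow> bool" where
  "computes c p f \<longleftrightarrow> wf_com c \<and> (\<forall>x r. tsize (f x) \<le> poly p (tsize x) \<and>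
     runs c (main_stack (code_of x @ r)) (poly p (tsize x)) (main_stack (code_of (f x) @ r)))"

definition poly_time :: "('a::encodable \<Rightarrow> 'b::encodable) \<Rightarrow> bool" where
  "poly_time f \<longleftrightarrow> (\<exists>c p. computes c p f)"

lemma computesD:
  assumes "computes c p f" "tsize x \<le> n"
  shows "tsize (f x) \<le> poly p n"
    "runs c (main_stack (code_of x @ r)) (poly p n) (main_stack (code_of (f x) @ r))"
  using assms poly_mono[OF assms(2)] unfolding computes_def by (meson order_trans runs_mono)+

lemma poly_timeI:
  assumes "wf_com c" "\<And>x. tsize (f x) \<le> poly q (tsize x)"
    "\<And>x r. runs c (main_stack (code_of x @ r)) (poly p (tsize x)) (main_stack (code_of (f x) @ r))"
  shows "poly_time f"
proof -
  have "computes c (p + q) f"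
    unfolding computes_def
    using assms(1) trans_le_add2[OF assms(2)] runs_mono[OF assms(3) le_add1] by simp
  then show ?thesis unfolding poly_time_def by blast
qed

lemma poly_time_size: "poly_time f \<Longrightarrow> \<exists>p. \<forall>x n. tsize x \<le> n \<longrightarrow> tsize (f x) \<le> poly p n"
  unfolding poly_time_def using computesD(1) by blast

text \<open>Programs see nothing but trees: if \<open>x\<close> and \<open>y\<close> have the same
  tree in their different types, the program for \<open>f\<close> also computes \<open>h\<close>.
  Changes of type are thus free of cost.\<close>

lemma poly_time_recode:
  assumes "poly_time f" "\<And>x. \<exists>y. tr y = tr x \<and> tr (h x) = tr (f y)"
  shows "poly_time h"
proof -
  from assms(1) obtain c p where f: "computes c p f" unfolding poly_time_def by blast
  show ?thesis
  proof (rule poly_timeI[of c _ p p])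
    show "wf_com c" using f by (simp add: computes_def)
    fix x r
    from assms(2)[of x] obtain y where y: "tr y = tr x" "tr (h x) = tr (f y)" by blast
    show "tsize (h x) \<le> poly p (tsize x)"
      using computesD(1)[OF f, of y] y by simp
    show "runs c (main_stack (code_of x @ r)) (poly p (tsize x)) (main_stack (code_of (h x) @ r))"
      using computesD(2)[OF f, of y] y by simp
  qed
qed

lemma poly_time_id: "poly_time (\<lambda>x. x)"
  by (rule poly_timeI[of Skip _ "[:0, 1:]" "0"]) (simp_all add: runs_Skip)

lemma poly_time_comp:
  assumes "poly_time f" "poly_time g"
  shows "poly_time (\<lambda>x. g (f x))"
proof -
  from assms obtain c p d q where f: "computes c p f" and g: "computes d q g"
    unfolding poly_time_def by blast
  show ?thesis
  proof (rule poly_timeI[of "Seq c d" _ "pcompose q p" "p + pcompose q p"])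
    show "wf_com (Seq c d)" using f g by (simp add: computes_def)
    fix x r
    note x = computesD[OF f order.refl, of x]
    note y = computesD[OF g x(1)]
    show "tsize (g (f x)) \<le> poly (pcompose q p) (tsize x)" using y(1) by (simp add: poly_pcompose)
    show "runs (Seq c d) (main_stack (code_of x @ r)) (poly (p + pcompose q p) (tsize x))
       (main_stack (code_of (g (f x)) @ r))"
      using runs_Seq[OF x(2) y(2)] by (simp add: poly_pcompose)
  qed
qed

primrec push_all :: "nat list \<Rightarrow> com" where
  "push_all [] = Skip"
| "push_all (s # xs) = Seq (push_all xs) (Push 2 s)"

lemma runs_push_all: "runs (push_all xs) (main_stack m) (2 * length xs) (main_stack (xs @ m))"
proof (induction xs)
  case Nil
  then show ?case by (simp add: runs_Skip)
next
  case (Cons s xs)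
  from runs_Seq[OF this runs_Push[of 2 s]] show ?case by simp
qed

lemma wf_push_all: "set xs \<subseteq> {1, 2} \<Longrightarrow> wf_com (push_all xs)"
  by (induction xs) auto

lemma poly_time_const: "poly_time (\<lambda>x. a)"
proof (rule poly_timeI[of "Seq discard (push_all (code_of a))" _ "[:tsize a:]" "[:2 * tsize a, 16:]"])
  show "wf_com (Seq discard (push_all (code_of a)))" using wf_push_all[OF set_enc] by simp
  fix x r
  show "runs (Seq discard (push_all (code_of a))) (main_stack (code_of x @ r))
     (poly [:2 * tsize a, 16:] (tsize x)) (main_stack (code_of a @ r))"
    by (rule runs_mono[OF runs_Seq[OF runs_discard runs_push_all]]) (simp add: mult.commute)
qed simp

text \<open>A copy of the argument waits below while the first component is computed, and an
  exchange brings it to the top. Once both codes are adjacent in the right order, pushing the node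
  symbol 2 makes them one tree.\<close>

lemma poly_time_node:
  assumes "poly_time f" "poly_time g" "\<And>x. tr (h x) = Nd (tr (f x)) (tr (g x))"
  shows "poly_time h"
proof -
  from assms obtain c p d q where f: "computes c p f" and g: "computes d q g"
    unfolding poly_time_def by blast
  let ?c = "Seq dup (Seq c (Seq swap (Seq d (Seq swap (Push 2 2)))))"
  let ?p = "[:2, 60:] + 41 * p + 21 * q"
  show ?thesis
  proof (rule poly_timeI[of ?c _ "p + q + 1" ?p])
    show "wf_com ?c" using f g by (simp add: computes_def)
    fix x r
    note x = computesD[OF f order.refl, of x]
    note y = computesD[OF g order.refl, of x]
    show "tsize (h x) \<le> poly (p + q + 1) (tsize x)" using x(1) y(1) assms(3) by simp
    have 1: "runs (Push 2 2) (main_stack (code_of (f x) @ code_of (g x) @ r)) 2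
        (main_stack (code_of (h x) @ r))"
      using runs_Push[of 2 2 "main_stack (code_of (f x) @ code_of (g x) @ r)"] assms(3) by simp
    show "runs ?c (main_stack (code_of x @ r)) (poly ?p (tsize x)) (main_stack (code_of (h x) @ r))"
      using x(1) y(1)
      by (intro runs_mono[OF runs_Seq[OF runs_dup runs_Seq[OF x(2) runs_Seq[OF runs_swap runs_Seq[OF y(2)
            runs_Seq[OF runs_swap 1]]]]]])
        (simp add: algebra_simps)
  qed
qed

primrec left :: "tree \<Rightarrow> tree" where
  "left Lf = Lf"
| "left (Nd a b) = a"

primrec right :: "tree \<Rightarrow> tree" where
  "right Lf = Lf"
| "right (Nd a b) = b"

lemma size_left: "size_of (left x) \<le> size_of x" and size_right: "size_of (right x) \<le> size_of x"
  by (cases x; simp)+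

lemma runs_pop_main: "runs (Pop 2) (main_stack (s # m)) 1 (main_stack m)"
  using runs_Pop[of 2 "main_stack (s # m)"] by simp

text \<open>Shared by both projections: the node symbol is popped and \<open>c\<close> selects one
  of the two subtrees. The factor 36 is the sum of the 20 of \<open>runs_swap\<close> and the 16 of
  \<open>runs_discard\<close>.\<close>

lemma poly_time_part:
  assumes "\<And>x. tr (h x) = part (tr x)" "part Lf = Lf" "wf_com c" "\<And>t. size_of (part t) \<le> size_of t"
    "\<And>a b r. runs c (main_stack (enc a @ enc b @ r)) (36 * (size_of a + size_of b))
       (main_stack (enc (part (Nd a b)) @ r))"
  shows "poly_time h"
proof (rule poly_timeI[of "IfTop 2 {2} (Seq (Pop 2) c) Skip" _ "[:0, 1:]" "[:3, 36:]"])
  show "wf_com (IfTop 2 {2} (Seq (Pop 2) c) Skip)" using assms(3) by simp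
  fix x r
  show "tsize (h x) \<le> poly [:0, 1:] (tsize x)" using assms(1,4) by simp
  show "runs (IfTop 2 {2} (Seq (Pop 2) c) Skip) (main_stack (code_of x @ r))
     (poly [:3, 36:] (tsize x)) (main_stack (code_of (h x) @ r))"
  proof (cases "tr x")
    case Lf
    show ?thesis unfolding assms(1,2) Lf
      by (rule runs_mono[OF runs_IfFalse[OF _ runs_Skip]]) simp_all
  next
    case (Nd a b)
    have "runs (Seq (Pop 2) c) (main_stack (code_of x @ r)) (1 + 36 * (size_of a + size_of b))
        (main_stack (code_of (h x) @ r))"
      unfolding assms(1) Nd using runs_Seq[OF runs_pop_main assms(5)] by simp
    from runs_mono[OF runs_IfTrue[OF _ this]] Nd show ?thesis by simp
  qed
qed

lemma poly_time_left:
  assumes "\<And>x. tr (h x) = left (tr x)"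
  shows "poly_time h"
proof (rule poly_time_part[where part = left, OF assms, of "Seq swap discard"])
  show "runs (Seq swap discard) (main_stack (enc a @ enc b @ r)) (36 * (size_of a + size_of b))
      (main_stack (enc (left (Nd a b)) @ r))" for a b r
    unfolding left.simps by (rule runs_mono[OF runs_Seq[OF runs_swap runs_discard]]) simp
qed (simp_all add: size_left)

lemma poly_time_right:
  assumes "\<And>x. tr (h x) = right (tr x)"
  shows "poly_time h"
proof (rule poly_time_part[where part = right, OF assms, of discard])
  show "runs discard (main_stack (enc a @ enc b @ r)) (36 * (size_of a + size_of b))
      (main_stack (enc (right (Nd a b)) @ r))" for a b r
    unfolding right.simps by (rule runs_mono[OF runs_discard]) simp
qed (simp_all add: size_right)

text \<open>
  In the second branch \<open>z\<close> is the pair of \<open>x\<close> and \<open>t x\<close>, but it may have a type that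
  also takes \<open>t x\<close> apart.
\<close>

lemma poly_time_branch:
  fixes t :: "'a::encodable \<Rightarrow> 'b::encodable" and f h :: "'a \<Rightarrow> 'c::encodable"
    and g :: "'d::encodable \<Rightarrow> 'c"
  assumes "poly_time t" "poly_time f" "poly_time g"
    "\<And>x. tr (t x) = Lf \<Longrightarrow> h x = f x"
    "\<And>x. tr (t x) \<noteq> Lf \<Longrightarrow> \<exists>z. tr z = Nd (tr x) (tr (t x)) \<and> h x = g z"
  shows "poly_time h"
proof -
  from assms obtain a o1 c p d q where t: "computes a o1 t" and f: "computes c p f" and g: "computes d q g"
    unfolding poly_time_def by blast
  let ?i = "IfTop 2 {2} (Seq swap (Seq (Push 2 2) d)) (Seq (Pop 2) c)"
  let ?c = "Seq dup (Seq a ?i)"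
  let ?q = "pcompose q ([:1, 1:] + o1)"
  let ?p = "[:4, 60:] + 21 * o1 + p + ?q"
  show ?thesis
  proof (rule poly_timeI[of ?c _ "p + ?q" ?p])
    show "wf_com ?c" using t f g by (simp add: computes_def)
    fix x :: 'a and r
    let ?n = "tsize x"
    note w = computesD[OF t order.refl, of x]
    note x = computesD[OF f order.refl, of x]
    have "tsize (h x) \<le> poly (p + ?q) ?n \<and>
      runs ?i (main_stack (code_of (t x) @ code_of x @ r))
          (20 * ?n + 20 * poly o1 ?n + poly p ?n + poly ?q ?n + 4)
        (main_stack (code_of (h x) @ r))"
    proof (cases "tr (t x) = Lf")
      case True
      \<comment> \<open>The code of \<open>Lf\<close> is a single symbol, so one pop removes the
        tested value.\<close>
      then have "runs (Seq (Pop 2) c) (main_stack (code_of (t x) @ code_of x @ r)) (1 + poly p ?n)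
          (main_stack (code_of (h x) @ r))"
        using runs_Seq[OF runs_pop_main x(2)] assms(4) by simp
      from runs_IfFalse[OF _ this, where i = 2 and S = "{2}"] True
      have "runs ?i (main_stack (code_of (t x) @ code_of x @ r)) (1 + poly p ?n + 2)
        (main_stack (code_of (h x) @ r))" by simp
      moreover have "1 + poly p ?n + 2 \<le> 20 * ?n + 20 * poly o1 ?n + poly p ?n + poly ?q ?n + 4" by linarith
      ultimately show ?thesis using x(1) assms(4)[OF True] by (simp add: runs_mono)
    next
      case False
      from assms(5)[OF this] obtain z where z: "tr z = Nd (tr x) (tr (t x))" "h x = g z" by blast
      have nz: "tsize z \<le> 1 + ?n + poly o1 ?n" using z(1) w(1) by simp
      note y = computesD[OF g nz, folded z(2)]
      have "runs (Push 2 2) (main_stack (code_of x @ code_of (t x) @ r)) 2 (main_stack (code_of z @ r))"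
        using runs_Push[of 2 2 "main_stack (code_of x @ code_of (t x) @ r)"] z(1) by simp
      from runs_IfTrue[OF _ runs_Seq[OF runs_swap[of "tr (t x)" "tr x"] runs_Seq[OF this y(2)]],
          where i = 2 and S = "{2}"] False
      have "runs ?i (main_stack (code_of (t x) @ code_of x @ r))
        (20 * tsize (t x) + 20 * ?n + (2 + poly q (1 + ?n + poly o1 ?n)) + 2)
            (main_stack (code_of (h x) @ r))"
        by simp
      moreover have "20 * tsize (t x) + 20 * ?n + (2 + poly q (1 + ?n + poly o1 ?n)) + 2
          \<le> 20 * ?n + 20 * poly o1 ?n + poly p ?n + poly ?q ?n + 4"
        using w(1) by (simp add: poly_pcompose)
      ultimately show ?thesis using y(1) by (simp add: runs_mono poly_pcompose)
    qed
    then have 1: "tsize (h x) \<le> poly (p + ?q) ?n"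
      "runs ?i (main_stack (code_of (t x) @ code_of x @ r))
          (20 * ?n + 20 * poly o1 ?n + poly p ?n + poly ?q ?n + 4)
        (main_stack (code_of (h x) @ r))" by blast+
    then show "tsize (h x) \<le> poly (p + ?q) ?n" by blast
    from runs_Seq[OF runs_dup runs_Seq[OF w(2) 1(2)]]
    show "runs ?c (main_stack (code_of x @ r)) (poly ?p ?n) (main_stack (code_of (h x) @ r))"
      by (rule runs_mono) (simp add: algebra_simps)
  qed
qed

text \<open>A bound on the number of rounds alone would not do, as each round may square the size of
  the state; hence \<open>p\<close> also bounds every state that occurs. The tested value is
  recomputed on top of the state in each round; a leaf ends the loop and is popped.\<close>

lemma poly_time_while_tree:
  fixes b :: "'s::encodable \<Rightarrow> 'b::encodable" and f :: "'s \<Rightarrow> 's" and a h :: "'a::encodable \<Rightarrow> 's"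
  assumes "poly_time a" "poly_time b" "poly_time f"
    "\<And>x. \<exists>k \<le> poly p (tsize x). (\<forall>i<k. tr (b ((f ^^ i) (a x))) \<noteq> Lf) \<and>
       tr (b ((f ^^ k) (a x))) = Lf \<and> (\<forall>i\<le>k. tsize ((f ^^ i) (a x)) \<le> poly p (tsize x)) \<and>
       h x = (f ^^ k) (a x)"
  shows "poly_time h"
proof -
  from assms obtain e u c q d s where a: "computes e u a" and b: "computes c q b" and f: "computes d s f"
    unfolding poly_time_def by blast
  let ?w = "WhileTop 2 {2} (Seq discard (Seq d (Seq dup c)))"
  let ?c = "Seq e (Seq dup (Seq c (Seq ?w (Pop 2))))"
  let ?q = "pcompose q p" and ?s = "pcompose s p"
  let ?p = "p * (2 + 16 * ?q + ?s + 40 * p + ?q) + 2 + u + 40 * p + ?q"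
  show ?thesis
  proof (rule poly_timeI[of ?c _ p ?p])
    show "wf_com ?c" using a b f by (simp add: computes_def)
    fix x :: 'a and r
    let ?N = "poly p (tsize x)"
    let ?T = "2 + 16 * poly q ?N + poly s ?N + 40 * ?N + poly q ?N"
    have loop: "runs ?w (main_stack (code_of (b y) @ code_of y @ r)) (k * ?T + 1)
        (main_stack (1 # code_of ((f ^^ k) y) @ r))"
      if "\<forall>i<k. tr (b ((f ^^ i) y)) \<noteq> Lf" "tr (b ((f ^^ k) y)) = Lf" "\<forall>i\<le>k. tsize ((f ^^ i) y) \<le> ?N" for k y
      using that
    proof (induction k arbitrary: y)
      case 0
      then show ?case by (simp add: runs_WhileFalse)
    next
      case (Suc k)
      have y: "tsize y \<le> ?N" "tsize (f y) \<le> ?N"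
        using Suc.prems(3)[rule_format, of 0] Suc.prems(3)[rule_format, of "Suc 0"] by simp_all
      have nLf: "tr (b y) \<noteq> Lf" using Suc.prems(1)[rule_format, of 0] by simp
      have pow: "(f ^^ i) (f y) = (f ^^ Suc i) y" for i by (simp add: funpow_swap1)
      have IH: "runs ?w (main_stack (code_of (b (f y)) @ code_of (f y) @ r)) (k * ?T + 1)
          (main_stack (1 # code_of ((f ^^ Suc k) y) @ r))"
      proof -
        have "\<forall>i<k. tr (b ((f ^^ Suc i) y)) \<noteq> Lf" "\<forall>i\<le>k. tsize ((f ^^ Suc i) y) \<le> ?N"
          using Suc.prems(1,3) Suc_less_eq Suc_le_mono by blast+
        from Suc.IH[of "f y", unfolded pow, OF this(1) Suc.prems(2) this(2)] show ?thesis .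
      qed
      have "runs (Seq discard (Seq d (Seq dup c))) (main_stack (code_of (b y) @ code_of y @ r))
          (16 * tsize (b y) + (poly s ?N + (40 * tsize (f y) + poly q ?N)))
          (main_stack (code_of (b (f y)) @ code_of (f y) @ r))"
        by (intro runs_Seq[OF runs_discard] runs_Seq[OF computesD(2)[OF f y(1)]] runs_Seq[OF runs_dup]
            computesD(2)[OF b y(2)])
      from runs_WhileTrue[OF _ this IH] nLf have
        "runs ?w (main_stack (code_of (b y) @ code_of y @ r))
          (16 * tsize (b y) + (poly s ?N + (40 * tsize (f y) + poly q ?N)) + 2 + (k * ?T + 1))
          (main_stack (1 # code_of ((f ^^ Suc k) y) @ r))" by simp
      then show ?case
        by (rule runs_mono) (use computesD(1)[OF b y(1)] y(2) in simp)
    qed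
    from assms(4)[of x] obtain k where k: "k \<le> ?N" "\<forall>i<k. tr (b ((f ^^ i) (a x))) \<noteq> Lf"
      "tr (b ((f ^^ k) (a x))) = Lf" "\<forall>i\<le>k. tsize ((f ^^ i) (a x)) \<le> ?N" "h x = (f ^^ k) (a x)" by blast
    show "tsize (h x) \<le> ?N" using k by simp
    have ax: "tsize (a x) \<le> ?N" using k(4)[rule_format, of 0] by simp
    have "runs ?c (main_stack (code_of x @ r))
        (poly u (tsize x) + (40 * tsize (a x) + (poly q ?N + (k * ?T + 1 + 1))))
        (main_stack (code_of (h x) @ r))"
      unfolding k(5)
      by (intro runs_Seq[OF computesD(2)[OF a order.refl]] runs_Seq[OF runs_dup]
          runs_Seq[OF computesD(2)[OF b ax]] runs_Seq[OF loop[OF k(2-4)]] runs_pop_main)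
    moreover have "k * ?T \<le> ?N * ?T" using k(1) by (rule mult_le_mono1)
    ultimately show "runs ?c (main_stack (code_of x @ r)) (poly ?p (tsize x))
        (main_stack (code_of (h x) @ r))"
      using ax by (elim runs_mono) (simp add: poly_pcompose)
  qed
qed

section \<open>Polynomial-time functions on lists and numbers\<close>

instantiation tree :: encodable
begin
definition tr_tree :: "tree \<Rightarrow> tree" where [simp]: "tr_tree t = t"
instance by standard simp
end

instantiation bool :: encodable
begin
definition tr_bool :: "bool \<Rightarrow> tree" where [simp]: "tr_bool b = (if b then Nd Lf Lf else Lf)"
instance by standard (simp split: if_splits)
end

text \<open>Unary, so that the size of a number is linear in its value; such numbers serve as
  indices, counters and values of bounding polynomials. The numbers of an instance are bit lists
  instead.\<close>

instantiation nat :: encodable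
begin
primrec tr_nat :: "nat \<Rightarrow> tree" where
  "tr_nat 0 = Lf"
| "tr_nat (Suc n) = Nd Lf (tr_nat n)"
instance
proof
  fix m n :: nat
  show "tr m = tr n \<Longrightarrow> m = n"
  proof (induction m arbitrary: n)
    case 0 then show ?case by (cases n) auto
  next
    case (Suc m) then show ?case by (cases n) auto
  qed
qed
end

instantiation prod :: (encodable, encodable) encodable
begin
definition tr_prod :: "'a \<times> 'b \<Rightarrow> tree" where [simp]: "tr_prod z = Nd (tr (fst z)) (tr (snd z))"
instance by standard (simp add: prod_eq_iff)
end

instantiation option :: (encodable) encodable
begin
primrec tr_option :: "'a option \<Rightarrow> tree" where
  "tr_option None = Lf"
| "tr_option (Some x) = Nd Lf (tr x)"
instance
proof
  fix x y :: "'a option"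
  show "tr x = tr y \<Longrightarrow> x = y" by (cases x; cases y) simp_all
qed
end

instantiation list :: (encodable) encodable
begin
primrec tr_list :: "'a list \<Rightarrow> tree" where
  "tr_list [] = Lf"
| "tr_list (x # xs) = Nd (tr x) (tr_list xs)"
instance
proof
  fix xs ys :: "'a list"
  show "tr xs = tr ys \<Longrightarrow> xs = ys"
  proof (induction xs arbitrary: ys)
    case Nil then show ?case by (cases ys) auto
  next
    case (Cons x xs) then show ?case by (cases ys) auto
  qed
qed
end

lemma tr_Lf_iff [simp]:
  "tr b = Lf \<longleftrightarrow> \<not> b" "tr xs = Lf \<longleftrightarrow> xs = []" "tr n = Lf \<longleftrightarrow> n = 0" "tr u = Lf \<longleftrightarrow> u = None"
  for b :: bool and xs :: "'a::encodable list" and n :: nat and u :: "'b::encodable option"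
  by (simp, cases xs, simp_all, cases n, simp_all, cases u, simp_all)

lemma tsize_nat [simp]: "tsize n = 2 * n + 1" for n :: nat
  by (induction n) auto

lemma tsize_append: "tsize (xs @ ys) + 1 = tsize xs + tsize ys"
  by (induction xs) auto

lemma length_le_tsize: "length xs \<le> tsize xs"
  by (induction xs) auto

lemma tsize_member: "x \<in> set xs \<Longrightarrow> tsize x \<le> tsize xs"
  by (induction xs) auto

text \<open>These rules are applied backwards along the syntax of a function. Under a binder, the
  context and the bound variables are passed as components of a tuple \<open>z\<close>, whence the
  projections in the premises.\<close>

named_theorems ptime

lemmas [ptime] = poly_time_id poly_time_const

lemma ptime_fst [ptime]: "poly_time f \<Longrightarrow> poly_time (\<lambda>x. fst (f x))"
  by (rule poly_time_comp[of f fst]) (simp_all add: poly_time_left)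

lemma ptime_snd [ptime]: "poly_time f \<Longrightarrow> poly_time (\<lambda>x. snd (f x))"
  by (rule poly_time_comp[of f snd]) (simp_all add: poly_time_right)

lemma ptime_Pair [ptime]: "poly_time f \<Longrightarrow> poly_time g \<Longrightarrow> poly_time (\<lambda>x. (f x, g x))"
  by (rule poly_time_node[of f g]) simp_all

lemma ptime_Cons [ptime]: "poly_time f \<Longrightarrow> poly_time g \<Longrightarrow> poly_time (\<lambda>x. f x # g x)"
  by (rule poly_time_node[of f g]) simp_all

lemma ptime_Suc [ptime]: "poly_time f \<Longrightarrow> poly_time (\<lambda>x. Suc (f x))"
  by (rule poly_time_node[of "\<lambda>x. Lf" f]) (simp_all add: poly_time_const)

lemma ptime_Some [ptime]: "poly_time f \<Longrightarrow> poly_time (\<lambda>x. Some (f x))"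
  by (rule poly_time_node[of "\<lambda>x. Lf" f]) (simp_all add: poly_time_const)

lemma tr_tl: "tr (tl xs) = right (tr xs)"
  by (cases xs) simp_all

lemma ptime_tl [ptime]: "poly_time f \<Longrightarrow> poly_time (\<lambda>x. tl (f x))"
  by (rule poly_time_comp[of f tl]) (simp_all add: poly_time_right tr_tl)

lemma ptime_pred [ptime]: "poly_time f \<Longrightarrow> poly_time (\<lambda>x. f x - (1::nat))"
proof (rule poly_time_comp[of f "\<lambda>n. n - 1"])
  have "tr (n - 1) = right (tr n)" for n :: nat by (cases n) simp_all
  then show "poly_time (\<lambda>n. n - (1::nat))" by (rule poly_time_right)
qed

lemma ptime_if [ptime]:
  assumes "poly_time b" "poly_time f" "poly_time g"
  shows "poly_time (\<lambda>x. if b x then f x else g x)"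
proof (rule poly_time_branch[of b g "\<lambda>z :: 'a \<times> bool. f (fst z)"])
  show "poly_time (\<lambda>z :: 'a \<times> bool. f (fst z))"
    by (rule poly_time_comp[OF _ assms(2)]) (intro ptime)
  show "tr (b x) \<noteq> Lf \<Longrightarrow> \<exists>z. tr z = Nd (tr x) (tr (b x)) \<and>
      (if b x then f x else g x) = f (fst (z :: 'a \<times> bool))" for x
    by (intro exI[of _ "(x, b x)"]) (simp split: if_splits)
qed (use assms in \<open>auto split: if_splits\<close>)

text \<open>A nonempty list has the same tree as the pair of its head and tail, so the second branch
  may take the triple of context, head and tail as its argument.\<close>

lemma ptime_case_list [ptime]:
  assumes "poly_time xs" "poly_time f" "poly_time (\<lambda>z. g (fst z) (fst (snd z)) (snd (snd z)))"
  shows "poly_time (\<lambda>x. case xs x of [] \<Rightarrow> f x | y # ys \<Rightarrow> g x y ys)"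
proof (rule poly_time_branch[OF assms])
  show "tr (xs x) \<noteq> Lf \<Longrightarrow> \<exists>z. tr z = Nd (tr x) (tr (xs x)) \<and>
      (case xs x of [] \<Rightarrow> f x | y # ys \<Rightarrow> g x y ys) = g (fst z) (fst (snd z)) (snd (snd z))" for x
    by (intro exI[of _ "(x, hd (xs x), tl (xs x))"]) (cases "xs x", simp_all)
qed (auto split: list.splits)

lemma ptime_case_option [ptime]:
  assumes "poly_time u" "poly_time f" "poly_time (\<lambda>z. g (fst z) (snd z))"
  shows "poly_time (\<lambda>x. case u x of None \<Rightarrow> f x | Some y \<Rightarrow> g x y)"
proof (rule poly_time_branch[OF assms(1,2)])
  show "poly_time (\<lambda>z. (\<lambda>w. g (fst w) (snd w)) (fst z, snd (snd (z :: 'a \<times> tree \<times> 'b))))"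
    by (rule poly_time_comp[OF _ assms(3)]) (intro ptime)
  show "tr (u x) \<noteq> Lf \<Longrightarrow> \<exists>z. tr z = Nd (tr x) (tr (u x)) \<and>
      (case u x of None \<Rightarrow> f x | Some y \<Rightarrow> g x y) =
      (\<lambda>w. g (fst w) (snd w)) (fst z, snd (snd (z :: 'a \<times> tree \<times> 'b)))" for x
    by (intro exI[of _ "(x, Lf, the (u x))"]) (cases "u x", simp_all)
qed (auto split: option.splits)

lemma ptime_case_tree [ptime]:
  assumes "poly_time u" "poly_time f" "poly_time (\<lambda>z. g (fst z) (fst (snd z)) (snd (snd z)))"
  shows "poly_time (\<lambda>x. case u x of Lf \<Rightarrow> f x | Nd a b \<Rightarrow> g x a b)"
proof (rule poly_time_branch[OF assms])
  show "tr (u x) \<noteq> Lf \<Longrightarrow> \<exists>z. tr z = Nd (tr x) (tr (u x)) \<and>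
      (case u x of Lf \<Rightarrow> f x | Nd a b \<Rightarrow> g x a b) = g (fst z) (fst (snd z)) (snd (snd z))" for x
    by (intro exI[of _ "(x, left (u x), right (u x))"]) (cases "u x", simp_all)
qed (auto split: tree.splits)

lemma ptime_not [ptime]: "poly_time f \<Longrightarrow> poly_time (\<lambda>x. \<not> f x)"
  by (rule back_subst[of poly_time, OF ptime_if[OF _ poly_time_const poly_time_const, of f False True]])
      auto

lemma ptime_conj [ptime]: "poly_time f \<Longrightarrow> poly_time g \<Longrightarrow> poly_time (\<lambda>x. f x \<and> g x)"
  by (rule back_subst[of poly_time, OF ptime_if[OF _ _ poly_time_const, of f g False]]) auto

lemma ptime_disj [ptime]: "poly_time f \<Longrightarrow> poly_time g \<Longrightarrow> poly_time (\<lambda>x. f x \<or> g x)"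
  by (rule back_subst[of poly_time, OF ptime_if[OF _ poly_time_const, of f g True]]) auto

lemma ptime_imp [ptime]: "poly_time f \<Longrightarrow> poly_time g \<Longrightarrow> poly_time (\<lambda>x. f x \<longrightarrow> g x)"
  unfolding imp_conv_disj by (intro ptime_disj ptime_not)

lemma poly_time_while:
  fixes b :: "'s::encodable \<Rightarrow> bool" and f :: "'s \<Rightarrow> 's" and a h :: "'a::encodable \<Rightarrow> 's"
  assumes "poly_time a" "poly_time b" "poly_time f"
    "\<And>x. \<exists>k \<le> poly p (tsize x). (\<forall>i<k. b ((f ^^ i) (a x))) \<and> \<not> b ((f ^^ k) (a x)) \<and>
       (\<forall>i\<le>k. tsize ((f ^^ i) (a x)) \<le> poly p (tsize x)) \<and> h x = (f ^^ k) (a x)"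
  shows "poly_time h"
  using poly_time_while_tree[OF assms(1-3), of p h] assms(4) by (simp del: tr_bool_def)

text \<open>A loop whose state consists of context, accumulator and remaining list. The accumulators
  that occur are the folds over prefixes, so these have to be bounded.\<close>

lemma poly_time_foldl:
  fixes f :: "'c::encodable \<Rightarrow> 'a::encodable \<Rightarrow> 'e::encodable \<Rightarrow> 'a"
  assumes "poly_time (\<lambda>z. f (fst z) (fst (snd z)) (snd (snd z)))" "poly_time a" "poly_time xs"
    "\<And>x k. tsize (foldl (f x) (a x) (take k (xs x))) \<le> poly q (tsize x)"
  shows "poly_time (\<lambda>x. foldl (f x) (a x) (xs x))"
proof -
  let ?step = "\<lambda>s. case snd (snd s) of [] \<Rightarrow> s | e # es \<Rightarrow> (fst s, f (fst s) (fst (snd s)) e, es)"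
  let ?h = "\<lambda>x. (x, foldl (f x) (a x) (xs x), [] :: 'e list)"
  from poly_time_size[OF assms(3)] obtain r where
    r: "\<And>x. tsize (xs x) \<le> poly r (tsize x)" by blast
  have iter: "(?step ^^ k) (x, a x, xs x) = (x, foldl (f x) (a x) (take k (xs x)), drop k (xs x))"
    if "k \<le> length (xs x)" for k x
    using that
  proof (induction k)
    case (Suc k)
    then have "drop k (xs x) = xs x ! k # drop (Suc k) (xs x)" by (simp add: Cons_nth_drop_Suc)
    with Suc show ?case by (simp add: take_Suc_conv_app_nth)
  qed simp
  have drop: "tsize (drop k ys) \<le> tsize ys" for k and ys :: "'e list"
    by (induction ys arbitrary: k) (auto simp: drop_Cons' intro: le_SucI trans_le_add2)
  have "poly_time ?h"
  proof (rule poly_time_while[of _ "\<lambda>s. \<not> (case snd (snd s) of [] \<Rightarrow> True | e # es \<Rightarrow> False)"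
      ?step "[:2, 1:] + q + r"])
    show "poly_time (\<lambda>x. (x, a x, xs x))" by (intro ptime assms)
    have "poly_time (\<lambda>z. f (fst (fst z)) (fst (snd (fst z))) (fst (snd z)))"
      by (rule poly_time_comp[OF _ assms(1), of "\<lambda>z. (fst (fst z), fst (snd (fst z)), fst (snd z))",
            simplified]) (intro ptime)
    then show "poly_time ?step" by (intro ptime)
    show "poly_time (\<lambda>s. \<not> (case snd (snd s) of [] \<Rightarrow> True | e # es \<Rightarrow> False))" by (intro ptime)
    fix x
    let ?k = "length (xs x)" and ?b = "poly ([:2, 1:] + q + r) (tsize x)"
    have "?k \<le> ?b" using length_le_tsize[of "xs x"] r[of x] by simp
    moreover have "tsize ((?step ^^ i) (x, a x, xs x)) \<le> ?b" if "i \<le> ?k" for i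
      using iter[OF that] assms(4)[of x i] drop[of i "xs x"] r[of x] by simp
    moreover have "drop i (xs x) = [] \<longleftrightarrow> i = ?k" if "i \<le> ?k" for i using that by auto
    ultimately show "\<exists>k\<le>?b.
        (\<forall>i<k. \<not> (case snd (snd ((?step ^^ i) (x, a x, xs x))) of [] \<Rightarrow> True | e # es \<Rightarrow> False)) \<and>
        \<not> \<not> (case snd (snd ((?step ^^ k) (x, a x, xs x))) of [] \<Rightarrow> True | e # es \<Rightarrow> False) \<and>
        (\<forall>i\<le>k. tsize ((?step ^^ i) (x, a x, xs x)) \<le> ?b) \<and>
        ?h x = (?step ^^ k) (x, a x, xs x)"
      by (intro exI[of _ ?k]) (simp add: iter split: list.split)
  qed
  from ptime_fst[OF ptime_snd[OF this]] show ?thesis by simp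
qed

text \<open>The increment may depend on the context and the element but not on the accumulator. Then
  the increments of polynomially many rounds add up to a polynomial, and all prefixes are bounded at
  once.\<close>

lemma poly_time_foldl_additive:
  fixes f :: "'c::encodable \<Rightarrow> 'a::encodable \<Rightarrow> 'e::encodable \<Rightarrow> 'a"
  assumes "poly_time (\<lambda>z. f (fst z) (fst (snd z)) (snd (snd z)))" "poly_time a" "poly_time xs"
    "\<And>c u e. tsize (f c u e) \<le> tsize u + poly q (tsize c + tsize e)"
  shows "poly_time (\<lambda>x. foldl (f x) (a x) (xs x))"
proof -
  from poly_time_size[OF assms(2)] obtain p where p: "\<And>x. tsize (a x) \<le> poly p (tsize x)" by blast
  from poly_time_size[OF assms(3)] obtain r where r: "\<And>x. tsize (xs x) \<le> poly r (tsize x)" by blast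
  have *: "tsize (foldl (f x) u ys) \<le> tsize u + length ys * poly q (tsize x + n)"
    if "\<And>e. e \<in> set ys \<Longrightarrow> tsize e \<le> n" for x u ys n
    using that
  proof (induction ys arbitrary: u)
    case (Cons e ys)
    have "poly q (tsize x + tsize e) \<le> poly q (tsize x + n)" using Cons.prems by (intro poly_mono) simp
    then have "tsize (f x u e) \<le> tsize u + poly q (tsize x + n)" using assms(4)[of x u e] by simp
    then show ?case using Cons.IH[of "f x u e"] Cons.prems by simp
  qed simp
  show ?thesis
  proof (rule poly_time_foldl[OF assms(1-3), of "p + r * pcompose q ([:0, 1:] + r)"])
    fix x k
    have "tsize (foldl (f x) (a x) (take k (xs x))) \<le>
        tsize (a x) + length (take k (xs x)) * poly q (tsize x + tsize (xs x))"
      by (intro *) (meson in_set_takeD tsize_member)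
    also have "\<dots> \<le> tsize (a x) + tsize (xs x) * poly q (tsize x + tsize (xs x))"
      using length_le_tsize[of "xs x"] by (intro add_left_mono mult_le_mono1) simp
    also have "\<dots> \<le> poly p (tsize x) + poly r (tsize x) * poly q (tsize x + poly r (tsize x))"
      using p r by (intro add_mono mult_mono poly_mono) auto
    finally show "tsize (foldl (f x) (a x) (take k (xs x))) \<le>
        poly (p + r * pcompose q ([:0, 1:] + r)) (tsize x)"
      by (simp add: poly_pcompose)
  qed
qed

section \<open>Lists, bounded iteration and arithmetic\<close>

lemma ptime_rev [ptime]:
  assumes "poly_time f"
  shows "poly_time (\<lambda>x. rev (f x))"
proof -
  have "poly_time (\<lambda>x. foldl (\<lambda>ys y. y # ys) [] (f x))"
    by (rule poly_time_foldl_additive[where q = "[:1, 1:]"]) (intro ptime assms | simp)+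
  then show ?thesis by (simp add: foldl_conv_fold rev_conv_fold)
qed

lemma ptime_append [ptime]:
  assumes "poly_time f" "poly_time g"
  shows "poly_time (\<lambda>x. f x @ g x)"
proof -
  have "poly_time (\<lambda>x. foldl (\<lambda>ys y. y # ys) (g x) (rev (f x)))"
    by (rule poly_time_foldl_additive[where q = "[:1, 1:]"]) (intro ptime assms | simp)+
  then show ?thesis by (simp add: foldl_conv_fold fold_Cons_rev)
qed

lemma ptime_map [ptime]:
  fixes f :: "'a::encodable \<Rightarrow> 'b::encodable \<Rightarrow> 'c::encodable"
  assumes "poly_time (\<lambda>z. f (fst z) (snd z))" "poly_time xs"
  shows "poly_time (\<lambda>x. map (f x) (xs x))"
proof -
  from poly_time_size[OF assms(1)] obtain q where
    q': "\<forall>z n. tsize z \<le> n \<longrightarrow> tsize (f (fst z) (snd z)) \<le> poly q n" by blast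
  have q: "tsize (f c e) \<le> poly q (1 + tsize c + tsize e)" for c e
    using q'[rule_format, of "(c, e)"] by simp
  have "poly_time (\<lambda>x. foldl (\<lambda>ys y. f x y # ys) [] (xs x))"
  proof (rule poly_time_foldl_additive[where q = "1 + pcompose q [:1, 1:]"])
    have "poly_time (\<lambda>z. f (fst z) (snd (snd z)))"
      by (rule poly_time_comp[OF _ assms(1), of "\<lambda>z. (fst z, snd (snd z))", simplified]) (intro ptime)
    then show "poly_time (\<lambda>z. f (fst z) (snd (snd z)) # fst (snd z))" by (intro ptime)
    show "tsize (f c e # u) \<le> tsize u + poly (1 + pcompose q [:1, 1:]) (tsize c + tsize e)" for c u e
      using q[of c e] by (simp add: poly_pcompose add.assoc)
  qed (intro ptime assms)+
  moreover have "foldl (\<lambda>ys y. g y # ys) a zs = rev (map g zs) @ a" for g :: "'b \<Rightarrow> 'c" and a zs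
    by (induction zs arbitrary: a) auto
  ultimately show ?thesis using ptime_rev by fastforce
qed


lemma ptime_set_all [ptime]:
  assumes "poly_time (\<lambda>z. P (fst z) (snd z))" "poly_time xs"
  shows "poly_time (\<lambda>x. \<forall>y\<in>set (xs x). P x y)"
proof -
  have "poly_time (\<lambda>x. foldl (\<lambda>b y. b \<and> P x y) True (xs x))"
  proof (rule poly_time_foldl_additive[where q = "[:3:]"])
    have "poly_time (\<lambda>z. P (fst z) (snd (snd z)))"
      by (rule poly_time_comp[OF _ assms(1), of "\<lambda>z. (fst z, snd (snd z))", simplified]) (intro ptime)
    then show "poly_time (\<lambda>z. fst (snd z) \<and> P (fst z) (snd (snd z)))" by (intro ptime)
  qed (intro ptime assms | simp)+
  moreover have "foldl (\<lambda>b y. b \<and> P x y) b ys \<longleftrightarrow> b \<and> (\<forall>y\<in>set ys. P x y)" for x b ys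
    by (induction ys arbitrary: b) auto
  ultimately show ?thesis by simp
qed

lemma ptime_set_ex [ptime]:
  assumes "poly_time (\<lambda>z. P (fst z) (snd z))" "poly_time xs"
  shows "poly_time (\<lambda>x. \<exists>y\<in>set (xs x). P x y)"
  using ptime_not[OF ptime_set_all[OF ptime_not, OF assms]] by simp

lemma ptime_concat [ptime]:
  assumes "poly_time f"
  shows "poly_time (\<lambda>x. concat (f x))"
proof -
  have "poly_time (\<lambda>x. foldl (\<lambda>ys y. ys @ y) [] (f x))"
  proof (rule poly_time_foldl_additive[where q = "[:0, 1:]"])
    show "tsize (u @ e) \<le> tsize u + poly [:0, 1:] (tsize c + tsize e)" for c :: 'a and u e :: "'b list"
      using tsize_append[of u e] by simp
  qed (intro ptime assms)+
  moreover have "foldl (\<lambda>ys y. ys @ y) a ys = a @ concat ys" for a :: "'b list" and ys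
    by (induction ys arbitrary: a) auto
  ultimately show ?thesis by simp
qed

lemma ptime_length [ptime]:
  assumes "poly_time f"
  shows "poly_time (\<lambda>x. length (f x))"
proof -
  have "poly_time (\<lambda>x. foldl (\<lambda>n y. Suc n) 0 (f x))"
    by (rule poly_time_foldl_additive[where q = "[:2:]"]) (intro ptime assms | simp)+
  moreover have "foldl (\<lambda>n y. Suc n) a ys = a + length ys" for a and ys :: "'b list"
    by (induction ys arbitrary: a) auto
  ultimately show ?thesis by simp
qed

text \<open>A list of \<open>k\<close> leaves has the same tree as the number \<open>k\<close>.
  Folding over such a list repeats a step a given number of times.\<close>

lemma ptime_replicate:
  assumes "poly_time n"
  shows "poly_time (\<lambda>x. replicate (n x) Lf)"
proof (rule poly_time_recode[OF assms])
  have "tr (replicate k Lf) = tr k" for k by (induction k) auto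
  then show "\<exists>y. tr y = tr x \<and> tr (replicate (n x) Lf) = tr (n y)" for x by blast
qed

lemma ptime_funpow:
  fixes f :: "'c::encodable \<Rightarrow> 'a::encodable \<Rightarrow> 'a"
  assumes "poly_time (\<lambda>z. f (fst z) (snd z))" "poly_time a" "poly_time n"
    "\<And>c u. tsize (f c u) \<le> tsize u + poly q (tsize c)"
  shows "poly_time (\<lambda>x. (f x ^^ n x) (a x))"
proof -
  have "poly_time (\<lambda>x. foldl (\<lambda>u y. f x u) (a x) (replicate (n x) Lf))"
  proof (rule poly_time_foldl_additive[where q = q])
    show "poly_time (\<lambda>z. f (fst z) (fst (snd z)))"
      by (rule poly_time_comp[OF _ assms(1), of "\<lambda>z. (fst z, fst (snd z))", simplified]) (intro ptime)
    show "poly_time (\<lambda>x. replicate (n x) Lf)" using assms(3) by (rule ptime_replicate)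
    show "tsize (f c u) \<le> tsize u + poly q (tsize c + tsize e)" for c u and e :: tree
      using assms(4)[of c u] poly_mono[of "tsize c" "tsize c + tsize e" q] by simp
  qed (rule assms)
  moreover have "foldl (\<lambda>u y. g u) u (replicate k Lf) = (g ^^ k) u" for g :: "'a \<Rightarrow> 'a" and u k
    by (induction k arbitrary: u) (auto simp: funpow_swap1)
  ultimately show ?thesis by simp
qed

lemma ptime_plus [ptime]:
  assumes "poly_time f" "poly_time g"
  shows "poly_time (\<lambda>x. f x + g x :: nat)"
proof -
  have "poly_time (\<lambda>x. (Suc ^^ f x) (g x))"
    by (rule ptime_funpow[where q = "[:2:]"]) (intro ptime assms | simp)+
  moreover have "(Suc ^^ m) n = m + n" for m n by (induction m) auto
  ultimately show ?thesis by simp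
qed

lemma ptime_times [ptime]:
  assumes "poly_time f" "poly_time g"
  shows "poly_time (\<lambda>x. f x * g x :: nat)"
proof -
  from poly_time_size[OF assms(2)] obtain q where "\<And>x. tsize (g x) \<le> poly q (tsize x)" by blast
  then have q: "2 * g x + 1 \<le> poly q (tsize x)" for x by simp
  then have "2 * g x \<le> poly q (tsize x)" for x using q[of x] by linarith
  then have "poly_time (\<lambda>x. ((\<lambda>n. n + g x) ^^ f x) 0)"
    by (intro ptime_funpow[where q = q] ptime assms
        poly_time_comp[OF ptime_fst[OF poly_time_id] assms(2)]) simp
  moreover have "((\<lambda>n. n + k) ^^ m) 0 = m * k" for m k :: nat by (induction m) auto
  ultimately show ?thesis by simp
qed

lemma ptime_minus [ptime]:
  assumes "poly_time f" "poly_time g"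
  shows "poly_time (\<lambda>x. f x - g x :: nat)"
proof -
  have "poly_time (\<lambda>x. ((\<lambda>n. n - 1) ^^ g x) (f x))"
    by (rule ptime_funpow[where q = 0]) (intro ptime assms | simp)+
  moreover have "((\<lambda>n. n - 1) ^^ m) n = n - m" for m n :: nat by (induction m) auto
  ultimately show ?thesis by simp
qed

lemma ptime_drop [ptime]:
  assumes "poly_time f" "poly_time g"
  shows "poly_time (\<lambda>x. drop (f x) (g x))"
proof -
  have *: "tsize (tl xs) \<le> tsize xs" for xs :: "'b list" by (cases xs) auto
  have "poly_time (\<lambda>x. (tl ^^ f x) (g x))"
    by (rule ptime_funpow[where q = 0]) (intro ptime assms | simp add: *)+
  moreover have "(tl ^^ m) xs = drop m xs" for m and xs :: "'b list"
    by (induction m arbitrary: xs) (auto simp: drop_Suc tl_drop)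
  ultimately show ?thesis by simp
qed

text \<open>The appended element is the length of the accumulator, so the increment depends on the
  accumulator and the prefixes are bounded explicitly by a quadratic estimate.\<close>

lemma ptime_upt [ptime]:
  assumes "poly_time f"
  shows "poly_time (\<lambda>x. [0..<f x])"
proof -
  have len: "length (foldl (\<lambda>ys y. ys @ [length ys]) [] zs) = length zs"
    and upt: "foldl (\<lambda>ys y. ys @ [length ys]) [] zs = [0..<length zs]" for zs :: "tree list"
    by (induction zs rule: rev_induct) auto
  have tsize_upt: "tsize [0..<k] \<le> 1 + k * (2 + 2 * k)" for k
  proof (induction k)
    case (Suc k)
    have "tsize [0..<Suc k] \<le> tsize [0..<k] + (2 + 2 * k)" using tsize_append[of "[0..<k]" "[k]"] by simp
    with Suc show ?case by simp
  qed simp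
  let ?rep = "\<lambda>x. replicate (f x) Lf"
  from poly_time_size[OF assms] obtain p where p: "\<And>x. tsize (f x) \<le> poly p (tsize x)" by blast
  have "poly_time (\<lambda>x. foldl (\<lambda>ys y. ys @ [length ys]) [] (?rep x))"
  proof (rule poly_time_foldl[where q = "1 + p * (2 + 2 * p)"])
    show "poly_time ?rep" using assms by (rule ptime_replicate)
    fix x k
    let ?k = "length (take k (?rep x))"
    have "tsize [0..<?k] \<le> 1 + ?k * (2 + 2 * ?k)" by (rule tsize_upt)
    moreover have "?k \<le> poly p (tsize x)" using p[of x] by (simp add: min_def)
    then have "?k * (2 + 2 * ?k) \<le> poly p (tsize x) * (2 + 2 * poly p (tsize x))"
      by (intro mult_mono add_mono) auto
    ultimately show "tsize (foldl (\<lambda>ys y. ys @ [length ys]) [] (take k (?rep x))) \<le>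
        poly (1 + p * (2 + 2 * p)) (tsize x)"
      unfolding upt by simp
  qed (intro ptime)+
  then show ?thesis by (simp add: upt)
qed

text \<open>Equality of trees without recursion: a worklist holds the pairs of subtrees still to be
  compared, and a mismatch empties it. Each round lowers the total size of the first components,
  which bounds the number of rounds, and the worklist never grows in size.\<close>

lemma ptime_eq [ptime]:
  assumes "poly_time f" "poly_time g"
  shows "poly_time (\<lambda>x. f x = g x)"
proof -
  define step :: "bool \<times> (tree \<times> tree) list \<Rightarrow> bool \<times> (tree \<times> tree) list" where
    "step = (\<lambda>s. case snd s of [] \<Rightarrow> s | p # ps \<Rightarrow>
    (case fst p of Lf \<Rightarrow> (case snd p of Lf \<Rightarrow> (fst s, ps) | Nd c d \<Rightarrow> (False, []))
     | Nd a b \<Rightarrow> (case snd p of Lf \<Rightarrow> (False, []) | Nd c d \<Rightarrow> (fst s, (a, c) # (b, d) # ps))))"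
  let ?run = "\<lambda>s. case snd s of [] \<Rightarrow> False | p # ps \<Rightarrow> True"
  \<comment> \<open>The summand 4 is the pair node and the at most three symbols of the truth
    value.\<close>
  have iter: "\<exists>k \<le> sum_list (map (\<lambda>p. size_of (fst p)) ps).
      (\<forall>i<k. ?run ((step ^^ i) (ok, ps))) \<and> (\<forall>i\<le>k. tsize ((step ^^ i) (ok, ps)) \<le> tsize ps + 4) \<and>
      (step ^^ k) (ok, ps) = (ok \<and> (\<forall>p\<in>set ps. fst p = snd p), [])"
          for ok :: bool and ps :: "(tree \<times> tree) list"
  proof (induction "sum_list (map (\<lambda>p. size_of (fst p)) ps)" arbitrary: ok ps rule: less_induct)
    case less
    show ?case
    proof (cases ps)
      case Nil
      then show ?thesis by (intro exI[of _ 0]) simp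
    next
      case (Cons p qs)
      obtain ok' ps' where next_state: "step (ok, ps) = (ok', ps')" by (rule prod.exhaust)
      have fewer: "sum_list (map (\<lambda>p. size_of (fst p)) ps') < sum_list (map (\<lambda>p. size_of (fst p)) ps)"
        and smaller: "tsize ps' \<le> tsize ps"
        and same: "ok' \<and> (\<forall>p\<in>set ps'. fst p = snd p) \<longleftrightarrow> ok \<and> (\<forall>p\<in>set ps. fst p = snd p)"
        using next_state Cons by (cases p; cases "fst p"; cases "snd p"; auto simp: step_def)+
      from less[OF fewer] obtain k where
        k: "k \<le> sum_list (map (\<lambda>p. size_of (fst p)) ps')" "\<forall>i<k. ?run ((step ^^ i) (ok', ps'))"
        "\<forall>i\<le>k. tsize ((step ^^ i) (ok', ps')) \<le> tsize ps' + 4"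
        "(step ^^ k) (ok', ps') = (ok' \<and> (\<forall>p\<in>set ps'. fst p = snd p), [])" by blast
      have pow: "(step ^^ Suc i) (ok, ps) = (step ^^ i) (ok', ps')" for i
        unfolding funpow_Suc_right o_apply next_state ..
      show ?thesis
      proof (intro exI[of _ "Suc k"] conjI allI impI)
        show "Suc k \<le> sum_list (map (\<lambda>p. size_of (fst p)) ps)" using k(1) fewer by simp
        show "?run ((step ^^ i) (ok, ps))" if "i < Suc k" for i
          using that k(2) pow Cons by (cases i) auto
        show "tsize ((step ^^ i) (ok, ps)) \<le> tsize ps + 4" if "i \<le> Suc k" for i
        proof (cases i)
          case (Suc j)
          with that k(3) have "tsize ((step ^^ j) (ok', ps')) \<le> tsize ps' + 4" by simp
          then show ?thesis unfolding Suc pow using smaller by simp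
        qed simp
        show "(step ^^ Suc k) (ok, ps) = (ok \<and> (\<forall>p\<in>set ps. fst p = snd p), [])"
          unfolding pow k(4) using same by simp
      qed
    qed
  qed
  from poly_time_size[OF assms(1)] obtain p where p: "\<And>x. tsize (f x) \<le> poly p (tsize x)" by blast
  from poly_time_size[OF assms(2)] obtain q where q: "\<And>x. tsize (g x) \<le> poly q (tsize x)" by blast
  have tree: "poly_time (\<lambda>x. tr (h x))" if "poly_time h" for h :: "'a \<Rightarrow> 'b"
    by (rule poly_time_recode[OF that]) auto
  have "poly_time (\<lambda>x. (f x = g x, [] :: (tree \<times> tree) list))"
  proof (rule poly_time_while[of "\<lambda>x. (True, [(tr (f x), tr (g x))])" ?run step "[:8:] + p + q"])
    fix x
    let ?s = "(True, [(tr (f x), tr (g x))])" and ?b = "poly ([:8:] + p + q) (tsize x)"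
    from iter[of "[(tr (f x), tr (g x))]" True] obtain k where
      k: "k \<le> tsize (f x)" "\<forall>i<k. ?run ((step ^^ i) ?s)"
        "\<forall>i\<le>k. tsize ((step ^^ i) ?s) \<le> tsize (f x) + tsize (g x) + 7"
        "(step ^^ k) ?s = (f x = g x, [])"
      by auto
    have "tsize (f x) + tsize (g x) + 7 \<le> ?b" using p[of x] q[of x] by simp
    with k(1,3) have "k \<le> ?b" "\<forall>i\<le>k. tsize ((step ^^ i) ?s) \<le> ?b" by (auto intro: order_trans)
    with k(2,4) show "\<exists>k\<le>?b. (\<forall>i<k. ?run ((step ^^ i) ?s)) \<and> \<not> ?run ((step ^^ k) ?s) \<and>
        (\<forall>i\<le>k. tsize ((step ^^ i) ?s) \<le> ?b) \<and> (f x = g x, []) = (step ^^ k) ?s"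
      by (intro exI[of _ k]) simp
  qed (unfold step_def | intro ptime tree assms)+
  from ptime_fst[OF this] show ?thesis by simp
qed

lemma ptime_less [ptime]:
  assumes "poly_time f" "poly_time g"
  shows "poly_time (\<lambda>x. f x < (g x :: nat))"
proof -
  have "poly_time (\<lambda>x. \<not> g x - f x = 0)" by (intro ptime assms)
  then show ?thesis by (simp add: not_le)
qed

lemma ptime_le [ptime]: "poly_time f \<Longrightarrow> poly_time g \<Longrightarrow> poly_time (\<lambda>x. f x \<le> (g x :: nat))"
  unfolding not_less[symmetric] by (intro ptime)

lemma ptime_all_less [ptime]:
  assumes "poly_time (\<lambda>z. P (fst z) (snd z))" "poly_time n"
  shows "poly_time (\<lambda>x. \<forall>i<n x. P x (i :: nat))"
proof -
  have "poly_time (\<lambda>x. \<forall>i\<in>set [0..<n x]. P x i)" by (intro ptime assms)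
  then show ?thesis by (simp add: Ball_def)
qed

lemma ptime_poly [ptime]:
  assumes "poly_time f"
  shows "poly_time (\<lambda>x. poly p (f x) :: nat)"
  by (induction p) (simp_all add: ptime assms)

section \<open>Input and output of machines\<close>

definition load_loop :: com where
  "load_loop = WhileTop 3 {1, 2} (IfTop 3 {1} (Seq (Pop 3) (Seq (Push 2 1) (Push 2 2)))
     (Seq (Pop 3) (Seq (Push 2 1) (Seq (Push 2 1) (Seq (Push 2 2) (Push 2 2))))))"

text \<open>The list is built from its last element, since a new head is put on top.
  \<open>False\<close> contributes the symbols 2, 1 and \<open>True\<close> the symbols 2, 2, 1, 1,
  where the first 2 is the list node; they are pushed in reverse.\<close>

lemma runs_load_loop:
  "runs load_loop (stacks a b (code_of v @ r) (map bit_symbol w)) (13 * length w + 1)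
      (stacks a b (code_of (rev w @ v) @ r) [])"
proof (induction w arbitrary: v)
  case Nil
  then show ?case by (simp add: load_loop_def runs_WhileFalse)
next
  case (Cons s w)
  let ?\<sigma> = "stacks a b (code_of v @ r) (map bit_symbol (s # w))"
  let ?\<sigma>' = "stacks a b (code_of (s # v) @ r) (map bit_symbol w)"
  have "runs (IfTop 3 {1} (Seq (Pop 3) (Seq (Push 2 1) (Push 2 2)))
     (Seq (Pop 3) (Seq (Push 2 1) (Seq (Push 2 1) (Seq (Push 2 2) (Push 2 2)))))) ?\<sigma> 11 ?\<sigma>'"
  proof (cases s)
    case True
    have "runs (Seq (Pop 3) (Seq (Push 2 1) (Seq (Push 2 1) (Seq (Push 2 2) (Push 2 2))))) ?\<sigma> 9 ?\<sigma>'"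
      using runs_Seq[OF runs_Pop[of 3 ?\<sigma>] runs_Seq[OF runs_Push[of 2 1] runs_Seq[OF runs_Push[of 2 1]
            runs_Seq[OF runs_Push[of 2 2] runs_Push[of 2 2]]]]] True by (simp add: bit_symbol_def)
    from runs_mono[OF runs_IfFalse[OF _ this]] True show ?thesis by (simp add: bit_symbol_def)
  next
    case False
    have "runs (Seq (Pop 3) (Seq (Push 2 1) (Push 2 2))) ?\<sigma> 5 ?\<sigma>'"
      using runs_Seq[OF runs_Pop[of 3 ?\<sigma>] runs_Seq[OF runs_Push[of 2 1] runs_Push[of 2 2]]] False
      by (simp add: bit_symbol_def)
    from runs_mono[OF runs_IfTrue[OF _ this]] False show ?thesis by (simp add: bit_symbol_def)
  qed
  moreover have "runs load_loop ?\<sigma>' (13 * length w + 1) (stacks a b (code_of (rev (s # w) @ v) @ r) [])"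
    using Cons.IH[of "s # v"] by simp
  ultimately show ?case
    unfolding load_loop_def by (rule runs_WhileTrue'[rotated]) (simp_all add: bit_symbol_def)
qed

definition load :: "nat \<Rightarrow> com" where
  "load j = Seq (move j 3) (Seq (Push 2 1) load_loop)"

lemma set_bit_symbols: "set (map bit_symbol w) \<subseteq> {1, 2}"
  by (auto simp: bit_symbol_def)

lemma runs_load:
  assumes "(j, \<sigma>, \<sigma>') \<in> {(0, stacks (map bit_symbol w) b m [], stacks [] b (code_of w @ m) []),
    (1, stacks a (map bit_symbol w) m [], stacks a [] (code_of w @ m) [])}"
  shows "runs (load j) \<sigma> (20 * length w + 4) \<sigma>'"
proof -
  have loop: "runs (Seq (Push 2 1) load_loop) (stacks c b m (rev (map bit_symbol w))) (13 * length w + 3)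
      (stacks c b (code_of w @ m) [])" for c b
  proof -
    have "runs (Push 2 1) (stacks c b m (rev (map bit_symbol w))) 2
        (stacks c b (code_of ([] :: bool list) @ m) (map bit_symbol (rev w)))"
      using runs_Push[of 2 1 "stacks c b m (rev (map bit_symbol w))"] by (simp add: rev_map)
    from runs_mono[OF runs_Seq[OF this runs_load_loop]] show ?thesis by simp
  qed
  show ?thesis
  proof (cases "j = 0")
    case True
    have "runs (move 0 3) \<sigma> (7 * length w + 1) (stacks [] b m (rev (map bit_symbol w)))"
      using runs_move[of \<sigma> 0 3] assms True set_bit_symbols by auto
    from runs_mono[OF runs_Seq[OF this loop]] assms True show ?thesis by (auto simp: load_def)
  next
    case False
    have "runs (move 1 3) \<sigma> (7 * length w + 1) (stacks a [] m (rev (map bit_symbol w)))"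
      using runs_move[of \<sigma> 1 3] assms False set_bit_symbols by auto
    from runs_mono[OF runs_Seq[OF this loop]] assms False show ?thesis by (auto simp: load_def)
  qed
qed

definition unload_loop :: com where
  "unload_loop = WhileTop 2 {2} (Seq (Pop 2) (IfTop 2 {1} (Seq (Pop 2) (Push 1 1))
     (Seq (Pop 2) (Seq (Pop 2) (Seq (Pop 2) (Push 1 2))))))"

definition unload :: com where
  "unload = Seq unload_loop (move 1 0)"

lemma runs_unload_loop:
  "runs unload_loop (stacks a b (code_of w @ r) []) (10 * length w + 1)
      (stacks a (rev (map bit_symbol w) @ b) (1 # r) [])"
proof (induction w arbitrary: b)
  case Nil
  then show ?case by (simp add: unload_loop_def runs_WhileFalse)
next
  case (Cons s w)
  let ?\<sigma> = "stacks a b (code_of s @ code_of w @ r) []"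
  let ?\<sigma>' = "stacks a (bit_symbol s # b) (code_of w @ r) []"
  have "runs (IfTop 2 {1} (Seq (Pop 2) (Push 1 1)) (Seq (Pop 2) (Seq (Pop 2) (Seq (Pop 2) (Push 1 2)))))
      ?\<sigma> 7 ?\<sigma>'"
  proof (cases s)
    case True
    have "runs (Seq (Pop 2) (Seq (Pop 2) (Seq (Pop 2) (Push 1 2)))) ?\<sigma> 5 ?\<sigma>'"
      using runs_Seq[OF runs_Pop[of 2 ?\<sigma>] runs_Seq[OF runs_Pop[of 2]
          runs_Seq[OF runs_Pop[of 2] runs_Push[of 1 2]]]]
        True by (simp add: bit_symbol_def)
    from runs_mono[OF runs_IfFalse[OF _ this]] True show ?thesis by simp
  next
    case False
    have "runs (Seq (Pop 2) (Push 1 1)) ?\<sigma> 3 ?\<sigma>'"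
      using runs_Seq[OF runs_Pop[of 2 ?\<sigma>] runs_Push[of 1 1]] False by (simp add: bit_symbol_def)
    from runs_mono[OF runs_IfTrue[OF _ this]] False show ?thesis by simp
  qed
  moreover have "runs (Pop 2) (stacks a b (code_of (s # w) @ r) []) 1 ?\<sigma>"
    using runs_Pop[of 2 "stacks a b (code_of (s # w) @ r) []"] by simp
  ultimately have "runs (Seq (Pop 2) (IfTop 2 {1} (Seq (Pop 2) (Push 1 1))
     (Seq (Pop 2) (Seq (Pop 2) (Seq (Pop 2) (Push 1 2)))))) (stacks a b (code_of (s # w) @ r) [])
         (1 + 7) ?\<sigma>'"
    using runs_Seq by blast
  from runs_WhileTrue'[OF _ this Cons.IH[of "bit_symbol s # b", unfolded unload_loop_def]] show ?case
    unfolding unload_loop_def by simp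
qed

lemma runs_unload: "runs unload (main_stack (code_of w)) (17 * length w + 2)
    (stacks (map bit_symbol w) [] [1] [])"
proof -
  have "runs (move 1 0) (stacks [] (rev (map bit_symbol w)) [1] []) (7 * length w + 1)
      (stacks (map bit_symbol w) [] [1] [])"
    using runs_move[of "stacks [] (rev (map bit_symbol w)) [1] []" 1 0] set_bit_symbols by simp
  then show ?thesis
    using runs_mono[OF runs_Seq[OF runs_unload_loop[of "[]" "[]" w "[]"]]] by (simp add: unload_def)
qed

lemma wf_io [simp]: "wf_com (load j) \<longleftrightarrow> j < 4" "wf_com unload"
  by (auto simp: load_def load_loop_def unload_def unload_loop_def)

lemma tsize_bools: "tsize w \<le> 4 * length w + 1" "length w \<le> tsize w" for w :: "bool list"
  by (induction w) auto

text \<open>\<open>h\<close> packs the input words into one value, and \<open>l\<close> does the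
  same on the stacks. The size bound allows 4 symbols for each bit, a final leaf for each of two
  lists, and a pair node.\<close>

lemma polytimeI:
  assumes "poly_time f" "wf_com l"
    "\<And>ws. length ws = k \<Longrightarrow> \<exists>x y. (ws = [x] \<and> y = [] \<or> ws = [x, y]) \<and>
       tsize (h ws) \<le> 4 * (length x + length y) + 3 \<and>
           runs l (stacks (map bit_symbol x) (map bit_symbol y) [] [])
       (20 * (length x + length y) + 10) (main_stack (code_of (h ws)))"
    "k \<le> 2"
  shows "polytime k (\<lambda>ws. f (h ws))"
proof -
  from assms(1) obtain c p where f: "computes c p f" unfolding poly_time_def by blast
  let ?c = "Seq l (Seq c unload)"
  let ?p = "[:12, 20:] + 18 * pcompose p [:3, 4:]"
  have wf: "wf_com ?c" using f assms(2) by (simp add: computes_def)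
  have "computes_within (machine ?c) (poly ?p (sum_list (map length ws))) ws (f (h ws))"
      if ws: "length ws = k" for ws
  proof -
    from assms(3)[OF ws] obtain x y where xy: "ws = [x] \<and> y = [] \<or> ws = [x, y]"
      "tsize (h ws) \<le> 4 * (length x + length y) + 3" and
      l: "runs l (stacks (map bit_symbol x) (map bit_symbol y) [] [])
       (20 * (length x + length y) + 10) (main_stack (code_of (h ws)))" by blast
    let ?n = "length x + length y"
    have n: "sum_list (map length ws) = ?n" using xy(1) by auto
    note c = computesD[OF f xy(2)]
    have "length (f (h ws)) \<le> poly p (4 * ?n + 3)" using c(1) tsize_bools(2) order_trans by blast
    moreover have "runs c (main_stack (code_of (h ws))) (poly p (4 * ?n + 3))
        (main_stack (code_of (f (h ws))))"
      using c(2)[of "[]"] by simp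
    moreover have "poly ?p ?n = 20 * ?n + 12 + 18 * poly p (4 * ?n + 3)"
      by (simp add: poly_pcompose algebra_simps)
    ultimately have "20 * ?n + 10 + (poly p (4 * ?n + 3) + (17 * length (f (h ws)) + 2)) \<le> poly ?p ?n"
      and "runs c (main_stack (code_of (h ws))) (poly p (4 * ?n + 3)) (main_stack (code_of (f (h ws))))"
      by linarith+
    then have "runs ?c (stacks (map bit_symbol x) (map bit_symbol y) [] []) (poly ?p ?n)
        (stacks (map bit_symbol (f (h ws))) [] [1] [])"
      using runs_mono[OF runs_Seq[OF l runs_Seq[OF _ runs_unload]]] by blast
    then obtain t where "t \<le> poly ?p ?n" "exec ?c (stacks (map bit_symbol x) (map bit_symbol y) [] []) t
        (stacks (map bit_symbol (f (h ws))) [] [1] [])" unfolding runs_def by blast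
    from computes_within_machine[OF this(2) wf this(1) xy(1)] n show ?thesis by simp
  qed
  then show ?thesis
    unfolding polytime_def using turing_machine_machine[OF wf] assms(4)
    by (intro exI[of _ "machine ?c"] exI[of _ ?p]) (auto simp: machine_def)
qed

lemma polytime_1:
  assumes "poly_time f"
  shows "polytime 1 (\<lambda>ws. f (ws ! 0))"
proof (rule polytimeI[OF assms, of "load 0"])
  fix ws :: "bool list list" assume "length ws = 1"
  then obtain x where ws: "ws = [x]" by (auto simp: length_Suc_conv One_nat_def)
  have "runs (load 0) (stacks (map bit_symbol x) [] [] []) (20 * length x + 4) (main_stack (code_of x))"
    by (rule runs_load[of _ _ _ x "[]" "[]"]) simp
  then show "\<exists>x y. (ws = [x] \<and> y = [] \<or> ws = [x, y]) \<and> tsize (ws ! 0) \<le> 4 * (length x + length y) + 3 \<and>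
      runs (load 0) (stacks (map bit_symbol x) (map bit_symbol y) [] [])
        (20 * (length x + length y) + 10) (main_stack (code_of (ws ! 0)))"
    unfolding ws using tsize_bools[of x] by (intro exI[of _ x] exI[of _ "[]"]) (auto elim: runs_mono)
qed simp_all

lemma polytime_2:
  assumes "poly_time f"
  shows "polytime 2 (\<lambda>ws. f (ws ! 0, ws ! 1))"
proof (rule polytimeI[OF assms, of "Seq (load 1) (Seq (load 0) (Push 2 2))"])
  fix ws :: "bool list list" assume "length ws = 2"
  then obtain x y where ws: "ws = [x, y]" by (auto simp: length_Suc_conv numeral_2_eq_2)
  let ?l = "Seq (load 1) (Seq (load 0) (Push 2 2))"
  have "runs (load 1) (stacks (map bit_symbol x) (map bit_symbol y) [] []) (20 * length y + 4)
      (stacks (map bit_symbol x) [] (code_of y) [])"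
    by (rule runs_load[of _ _ _ y _ "[]" "map bit_symbol x"]) simp
  moreover have "runs (load 0) (stacks (map bit_symbol x) [] (code_of y) []) (20 * length x + 4)
      (main_stack (code_of x @ code_of y))"
    by (rule runs_load[of _ _ _ x "[]" "code_of y"]) simp
  moreover have "runs (Push 2 2) (main_stack (code_of x @ code_of y)) 2 (main_stack (code_of (x, y)))"
    using runs_Push[of 2 2 "main_stack (code_of x @ code_of y)"] by simp
  ultimately have "runs ?l (stacks (map bit_symbol x) (map bit_symbol y) [] [])
      (20 * length y + 4 + (20 * length x + 4 + 2)) (main_stack (code_of (x, y)))"
    by (intro runs_Seq)
  then have "runs ?l (stacks (map bit_symbol x) (map bit_symbol y) [] [])
      (20 * (length x + length y) + 10) (main_stack (code_of (x, y)))"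
    by (rule runs_mono) (simp add: One_nat_def)
  then show "\<exists>x y. (ws = [x] \<and> y = [] \<or> ws = [x, y]) \<and> tsize (ws ! 0, ws ! 1) \<le>
      4 * (length x + length y) + 3 \<and>
      runs ?l (stacks (map bit_symbol x) (map bit_symbol y) [] [])
        (20 * (length x + length y) + 10) (main_stack (code_of (ws ! 0, ws ! 1)))"
    using ws tsize_bools(1)[of x] tsize_bools(1)[of y]
    by (intro exI[of _ x] exI[of _ y]) (simp add: One_nat_def)
qed simp_all

lemma poly_reducibleI:
  assumes "poly_time f" "\<And>x. x \<in> L \<longleftrightarrow> f x \<in> L'"
  shows "poly_reducible L L'"
  unfolding poly_reducible_def using polytime_1[OF assms(1)] assms(2) by auto

section \<open>Certificates\<close>

primrec spine :: "tree \<Rightarrow> tree list" where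
  "spine Lf = []"
| "spine (Nd a b) = a # spine b"

text \<open>Every tree is the tree of a list of trees, so \<open>spine\<close> leaves the code
  unchanged.\<close>

lemma ptime_spine: "poly_time spine"
proof (rule poly_time_recode[OF poly_time_id[where 'a = tree]])
  have "tr (spine t) = t" for t by (induction t) simp_all
  then show "\<exists>y :: tree. tr y = tr x \<and> tr (spine x) = tr y" for x by (intro exI[of _ x]) simp
qed

text \<open>A certificate is an arbitrary word, so decoding must be total. A left inverse of
  \<open>tr\<close> is enough: whatever value comes out for other trees is still subject to the
  relation that is checked.\<close>

definition decoder :: "(tree \<Rightarrow> 'a::encodable) \<Rightarrow> bool" where
  "decoder u \<longleftrightarrow> poly_time u \<and> (\<forall>x. u (tr x) = x)"

lemma decoder_comp:
  assumes "decoder u" "poly_time f"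
  shows "poly_time (\<lambda>x. u (f x))"
  using assms poly_time_comp unfolding decoder_def by blast

lemma decoder_bool: "decoder (\<lambda>t. t \<noteq> Lf)"
  unfolding decoder_def by (intro conjI ptime) simp

lemma decoder_nat: "decoder (\<lambda>t. length (spine t))"
  unfolding decoder_def
proof
  show "\<forall>n. length (spine (tr n)) = n"
  proof
    show "length (spine (tr n)) = n" for n by (induction n) simp_all
  qed
qed (intro ptime ptime_spine)

lemma decoder_prod:
  assumes "decoder u" "decoder v"
  shows "decoder (\<lambda>t. case t of Lf \<Rightarrow> (u Lf, v Lf) | Nd a b \<Rightarrow> (u a, v b))"
proof -
  have "poly_time (\<lambda>t. case t of Lf \<Rightarrow> (u Lf, v Lf) | Nd a b \<Rightarrow> (u a, v b))"
    by (intro ptime decoder_comp[OF assms(1)] decoder_comp[OF assms(2)])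
  then show ?thesis using assms by (simp add: decoder_def)
qed

lemma decoder_option:
  assumes "decoder u"
  shows "decoder (\<lambda>t. case t of Lf \<Rightarrow> None | Nd a b \<Rightarrow> Some (u b))"
  unfolding decoder_def
proof
  show "\<forall>x. (case tr x of Lf \<Rightarrow> None | Nd a b \<Rightarrow> Some (u b)) = x"
  proof
    show "(case tr x of Lf \<Rightarrow> None | Nd a b \<Rightarrow> Some (u b)) = x" for x
      using assms by (cases x) (simp_all add: decoder_def)
  qed
qed (intro ptime decoder_comp[OF assms])

lemma decoder_list:
  assumes "decoder u"
  shows "decoder (\<lambda>t. map u (spine t))"
  unfolding decoder_def
proof
  show "\<forall>xs. map u (spine (tr xs)) = xs"
  proof
    show "map u (spine (tr xs)) = xs" for xs
      using assms by (induction xs) (simp_all add: decoder_def)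
  qed
qed (intro ptime ptime_spine decoder_comp[OF assms])

lemma ptime_Nd [ptime]: "poly_time f \<Longrightarrow> poly_time g \<Longrightarrow> poly_time (\<lambda>x. Nd (f x) (g x))"
  by (rule poly_time_node[of f g]) simp_all

text \<open>The inverse of the prefix code of trees, read from the right so that no recursion is needed.\<close>

definition decode_bit :: "tree list \<Rightarrow> bool \<Rightarrow> tree list" where
  "decode_bit ts s = (if s then (case ts of [] \<Rightarrow> [] | a # us \<Rightarrow>
      (case us of [] \<Rightarrow> [a] | b # vs \<Rightarrow> Nd a b # vs)) else Lf # ts)"

definition decode_word :: "bool list \<Rightarrow> tree" where
  "decode_word w = (case foldl decode_bit [] (rev w) of [] \<Rightarrow> Lf | t # ts \<Rightarrow> t)"

text \<open>Reading the symbol 2 as \<open>True\<close> and 1 as \<open>False\<close> makes the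
  prefix code a word of the same length. Size bounds for values thus become length bounds for
  certificates.\<close>

lemma decode_word_surj: "\<exists>w. length w = size_of t \<and> decode_word w = t"
proof -
  have "foldl decode_bit ts (rev (map (\<lambda>s. s = 2) (enc t))) = t # ts" for ts
    by (induction t arbitrary: ts) (simp_all add: decode_bit_def)
  then show ?thesis by (intro exI[of _ "map (\<lambda>s. s = 2) (enc t)"]) (simp add: decode_word_def)
qed

lemma ptime_decode_word [ptime]:
  assumes "poly_time f"
  shows "poly_time (\<lambda>x. decode_word (f x))"
proof -
  have "poly_time (\<lambda>x. foldl decode_bit [] (rev (f x)))"
  proof (rule poly_time_foldl_additive[where q = "[:2:]"])
    show "poly_time (\<lambda>z. decode_bit (fst (snd z)) (snd (snd z)))"
      unfolding decode_bit_def by (intro ptime)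
    show "tsize (decode_bit u e) \<le> tsize u + poly [:2:] (tsize c + tsize e)" for c :: 'a and u e
      by (auto simp: decode_bit_def split: list.split)
  qed (intro ptime assms)+
  then show ?thesis unfolding decode_word_def by (intro ptime)
qed

lemma NP_I:
  fixes R :: "bool list \<Rightarrow> 'c::encodable \<Rightarrow> bool"
  assumes "decoder (u :: tree \<Rightarrow> 'c)" "poly_time (\<lambda>z. R (fst z) (snd z))" "\<And>x y. R x y \<Longrightarrow> x \<in> L"
    "\<And>x. x \<in> L \<Longrightarrow> \<exists>y. R x y \<and> tsize y \<le> poly p (length x)"
  shows "L \<in> NP"
proof -
  let ?v = "\<lambda>z. [R (fst z) (u (decode_word (snd z)))]"
  have "poly_time (\<lambda>z. R (fst z) (u (decode_word (snd z))))"
    by (rule poly_time_comp[OF _ assms(2), of "\<lambda>z. (fst z, u (decode_word (snd z)))", simplified])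
      (intro ptime decoder_comp[OF assms(1)])
  then have "poly_time ?v" by (intro ptime)
  from polytime_2[OF this] have "polytime 2 (\<lambda>ws. ?v (ws ! 0, ws ! 1))" .
  moreover have "x \<in> L \<longleftrightarrow> (\<exists>c. length c \<le> poly p (length x) \<and> ?v ([x, c] ! 0, [x, c] ! 1) = [True])" for x
  proof
    assume "x \<in> L"
    with assms(4) obtain y where y: "R x y" "tsize y \<le> poly p (length x)" by blast
    obtain c where "length c = tsize y" "decode_word c = tr y" using decode_word_surj by blast
    with y assms(1) show "\<exists>c. length c \<le> poly p (length x) \<and> ?v ([x, c] ! 0, [x, c] ! 1) = [True]"
      by (intro exI[of _ c]) (simp add: decoder_def One_nat_def)
  qed (use assms(3) in auto)
  ultimately show ?thesis unfolding NP_def by blast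
qed

declare One_nat_def [simp]

lemma ptime_case_prod [ptime]:
  assumes "poly_time f" "poly_time (\<lambda>z. g (fst z) (fst (snd z)) (snd (snd z)))"
  shows "poly_time (\<lambda>x. case f x of (a, b) \<Rightarrow> g x a b)"
  using poly_time_comp[OF ptime_Pair[OF poly_time_id assms(1)] assms(2)] by (simp add: case_prod_beta)

section \<open>The Cook--Levin theorem\<close>

definition satisfiable :: "(bool \<times> 'v) list list \<Rightarrow> bool" where
  "satisfiable F \<longleftrightarrow> (\<exists>\<alpha>. \<forall>C\<in>set F. \<exists>(b, v)\<in>set C. \<alpha> v = b)"

text \<open>
  Cells are addressed relative to the head of their tape; the state is kept on an additional tape
  \<open>tapes M\<close> that never moves.
\<close>

definition cell :: "tm \<Rightarrow> config \<Rightarrow> nat \<Rightarrow> int \<Rightarrow> nat" where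
  "cell M cf i j = (if i < tapes M then fst (snd cf ! i) (snd (snd cf ! i) + j) else if j =
      0 then fst cf else 0)"

definition scanned :: "config \<Rightarrow> nat list" where
  "scanned cf = map scan (snd cf) @ [fst cf]"

definition valid_config :: "tm \<Rightarrow> config \<Rightarrow> bool" where
  "valid_config M cf \<longleftrightarrow> fst cf \<le> states M \<and> length (snd cf) = tapes M \<and>
     (\<forall>i < tapes M. \<forall>j. fst (snd cf ! i) j < symbols M)"

text \<open>The address of a cell relative to the head changes by the negative offset; the added 1
  is the drift per step that keeps addresses natural.\<close>

primrec shift :: "direction \<Rightarrow> nat" where
  "shift Left = 2"
| "shift Stay = 1"
| "shift Right = 0"

lemma int_shift: "int (shift d) = 1 - offset d"
  by (cases d) auto

text \<open>The state is the last entry of \<open>ss\<close>. The state tape and a halted machine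
  get shift 1, which is no movement once the drift is subtracted.\<close>

definition next_cell :: "tm \<Rightarrow> nat list \<Rightarrow> nat \<Rightarrow> nat \<times> nat" where
  "next_cell M ss i = (let q = last ss; r = delta M q (butlast ss) in
     if q < states M then if i < tapes M then (fst (snd r ! i), shift (snd (snd r ! i))) else (fst r, 1)
     else (ss ! i, 1))"

lemma nth_scanned: "valid_config M cf \<Longrightarrow> i \<le> tapes M \<Longrightarrow> scanned cf ! i = cell M cf i 0"
  by (auto simp: scanned_def cell_def valid_config_def nth_append scan_def)

lemma scanned_bounds:
  assumes "valid_config M cf"
  shows "set (map scan (snd cf)) \<subseteq> {..<symbols M}" "length (map scan (snd cf)) = tapes M"
proof -
  show "length (map scan (snd cf)) = tapes M" using assms by (simp add: valid_config_def)
  then show "set (map scan (snd cf)) \<subseteq> {..<symbols M}"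
    using assms by (auto simp: valid_config_def scan_def in_set_conv_nth[of _ "snd cf"]) (metis fst_conv)
qed

lemma valid_config_step:
  assumes "turing_machine M" "valid_config M cf"
  shows "valid_config M (step M cf)"
proof (cases "fst cf < states M")
  case True
  let ?r = "delta M (fst cf) (map scan (snd cf))"
  have r: "fst ?r \<le> states M" "length (snd ?r) = tapes M" "fst ` set (snd ?r) \<subseteq> {..<symbols M}"
    using assms(1) True scanned_bounds[OF assms(2)] unfolding turing_machine_def by blast+
  have w: "fst (snd ?r ! i) < symbols M" if "i < tapes M" for i
  proof -
    have "snd ?r ! i \<in> set (snd ?r)" using r(2) that by simp
    from imageI[OF this, of fst] r(3) show ?thesis by blast
  qed
  show ?thesis
    unfolding valid_config_def
  proof (intro conjI allI impI)
    show "fst (step M cf) \<le> states M" using r(1) True by (simp add: step_def Let_def)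
    show len: "length (snd (step M cf)) = tapes M"
      using r(2) assms(2) True by (simp add: valid_config_def step_def Let_def)
    fix i j assume "i < tapes M"
    then show "fst (snd (step M cf) ! i) j < symbols M"
      using w[of i] r(2) assms(2) True by (simp add: valid_config_def step_def Let_def act_def)
  qed
qed (use assms in \<open>simp add: step_def\<close>)

text \<open>Relative to the heads a step is local: only the cell at address 0 is rewritten, and the
  whole tape is translated. Subtracting 1 removes the drift contained in \<open>e\<close>.\<close>

lemma cell_step:
  assumes "turing_machine M" "valid_config M cf" "i \<le> tapes M" "next_cell M (scanned cf) i = (w, e)"
  shows "cell M (step M cf) i (j + int e - 1) = (if j = 0 then w else cell M cf i j)"
proof (cases "fst cf < states M")
  case True
  let ?r = "delta M (fst cf) (map scan (snd cf))"
  have r: "length (snd ?r) = tapes M" "length (snd cf) = tapes M"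
    using assms(1) True scanned_bounds[OF assms(2)] unfolding turing_machine_def by auto
  show ?thesis
  proof (cases "i < tapes M")
    case i: True
    then have "w = fst (snd ?r ! i)" "e = shift (snd (snd ?r ! i))"
      using assms(4) True by (simp_all add: next_cell_def scanned_def Let_def)
    then show ?thesis using True i r
      by (simp add: cell_def step_def Let_def act_def int_shift)
  next
    case False
    then show ?thesis using assms(3,4) True
      by (auto simp: next_cell_def scanned_def Let_def cell_def step_def)
  qed
next
  case False
  then have "w = scanned cf ! i" "e = 1"
    using assms(4) by (simp_all add: next_cell_def scanned_def Let_def)
  then show ?thesis using False assms(2,3) by (simp add: step_def nth_scanned)
qed

definition conf :: "tm \<Rightarrow> bool list \<Rightarrow> bool list \<Rightarrow> nat \<Rightarrow> config" where
  "conf M x c t = (step M ^^ t) (initial M [x, c])"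

lemma valid_config_conf:
  assumes "turing_machine M"
  shows "valid_config M (conf M x c t)"
proof (induction t)
  case 0
  show ?case using assms
    by (auto simp: conf_def valid_config_def initial_def turing_machine_def word_tape_def bit_symbol_def)
next
  case (Suc t)
  then show ?case using valid_config_step[OF assms] by (simp add: conf_def)
qed

text \<open>Halted configurations are fixed by \<open>step\<close>, so one late time
  \<open>T\<close> can be inspected whatever the halting time is. Two cells recognise the output
  \<open>[True]\<close>, as bits are never blank and a blank follows the word.\<close>

lemma conf_accepting:
  assumes "turing_machine M" "computes_within M n [x, c] w" "n \<le> T"
  shows "w = [True] \<longleftrightarrow> cell M (conf M x c T) 0 0 = 2 \<and> cell M (conf M x c T) 0 1 = 0"
proof -
  from assms(2) obtain t where t: "t \<le> n" "fst (conf M x c t) = states M"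
    "result_word (hd (snd (conf M x c t))) w" unfolding computes_within_def conf_def by blast
  have "conf M x c (t + d) = conf M x c t" for d
    using t(2) by (induction d) (simp_all add: conf_def step_def)
  from this[of "T - t"] have "conf M x c T = conf M x c t" using t(1) assms(3) by simp
  moreover have "0 < tapes M" "length (snd (conf M x c t)) = tapes M"
    using assms(1) valid_config_conf[OF assms(1), of x c t]
        by (auto simp: turing_machine_def valid_config_def)
  then have "hd (snd (conf M x c t)) = snd (conf M x c t) ! 0"
      by (metis hd_conv_nth length_0_conv less_numeral_extra(3))
  ultimately have cell: "cell M (conf M x c T) 0 j =
      fst (hd (snd (conf M x c t))) (snd (hd (snd (conf M x c t))) + j)" for j
    using \<open>0 < tapes M\<close> by (simp add: cell_def)
  have sym: "\<And>i. i < length w \<Longrightarrow> cell M (conf M x c T) 0 (int i) = bit_symbol (w ! i)"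
    "cell M (conf M x c T) 0 (int (length w)) = 0"
    using t(3) unfolding cell result_word_def by auto
  show ?thesis
  proof
    assume "w = [True]"
    then show "cell M (conf M x c T) 0 0 = 2 \<and> cell M (conf M x c T) 0 1 = 0"
      using sym(1)[of 0] sym(2) by (simp add: bit_symbol_def)
  next
    assume acc: "cell M (conf M x c T) 0 0 = 2 \<and> cell M (conf M x c T) 0 1 = 0"
    then have "w \<noteq> []" using sym(2) by auto
    moreover have "\<not> 1 < length w" using acc sym(1)[of 1] by (auto simp: bit_symbol_def split: if_splits)
    ultimately obtain b where "w = [b]" by (cases w) auto
    then show "w = [True]" using acc sym(1)[of 0] by (auto simp: bit_symbol_def split: if_splits)
  qed
qed

text \<open>
  The variable \<open>(t, i, p, s)\<close> says that at time \<open>t\<close> the cell of tape \<open>i\<close> at distance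
  \<open>p - (T + 1 + t)\<close> from the head contains \<open>s\<close>. The drift by \<open>t\<close> avoids negative displacements: a cell at
  position \<open>p\<close> comes from position \<open>p\<close>, \<open>p - 1\<close> or \<open>p - 2\<close> one step earlier.
\<close>

type_synonym var = "nat \<times> nat \<times> nat \<times> nat"

text \<open>Tape symbols and states share one alphabet because the state is the content of a tape;
  the range includes the halting state.\<close>

definition alphabet :: "tm \<Rightarrow> nat list" where
  "alphabet M = [0..<symbols M + states M + 1]"

text \<open>All tuples over the alphabet are listed, also those that no configuration shows. In the
  assignment that describes a run their clauses hold because a premise is false.\<close>

definition rules :: "tm \<Rightarrow> ((nat \<times> nat) list \<times> nat \<times> nat \<times> nat \<times> nat) list" where
  "rules M = concat (map (\<lambda>ss. concat (map (\<lambda>i. map (\<lambda>s. (zip [0..<tapes M + 1] ss, i, s, next_cell M ss i))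
     (alphabet M)) [0..<tapes M + 1])) (List.n_lists (tapes M + 1) (alphabet M)))"

definition rule_clause :: "nat \<Rightarrow> nat \<Rightarrow> nat \<Rightarrow> (nat \<times> nat) list \<times> nat \<times> nat \<times> nat \<times> nat \<Rightarrow>
    (bool \<times> var) list" where
  "rule_clause T t p r = (case r of (ss, i, s, w, e) \<Rightarrow>
     map (\<lambda>(i', s'). (False, t, i', T + 1 + t, s')) ss @
     [(False, t, i, p, s), (True, Suc t, i, p + e, if p = T + 1 + t then w else s)])"

text \<open>At time \<open>T\<close> the head is at position \<open>2 * T + 1\<close>, and the
  output test also looks at its right neighbour; this determines the width of the window.\<close>

definition step_clauses :: "tm \<Rightarrow> nat \<Rightarrow> (bool \<times> var) list list" where
  "step_clauses M T = concat (map (\<lambda>t. concat (map (\<lambda>p. map (rule_clause T t p) (rules M))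
      [0..<2 * T + 3])) [0..<T])"

text \<open>Written with \<open>drop\<close> and a case distinction because these have
  \<open>ptime\<close> rules.\<close>

definition input_symbol :: "bool list \<Rightarrow> nat \<Rightarrow> nat" where
  "input_symbol x j = (case drop j x of [] \<Rightarrow> 0 | b # bs \<Rightarrow> if b then 2 else 1)"

text \<open>The head starts at position \<open>T + 1\<close>. On tape 1 the \<open>m\<close> cells
  from there on may hold bits, and the implications in the last line propagate blanks to the right,
  so that the bits form a word. Several symbols may be true in one cell; the soundness proof selects
  a certificate.\<close>

definition init_clauses :: "tm \<Rightarrow> nat \<Rightarrow> nat \<Rightarrow> bool list \<Rightarrow> (bool \<times> var) list list" where
  "init_clauses M T m x =
     map (\<lambda>p. [(True, 0, 0, p, if p < T + 1 then 0 else input_symbol x (p - (T + 1)))]) [0..<2 * T + 3] @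
     concat (map (\<lambda>i. map (\<lambda>p. [(True, 0, i, p, 0)]) [0..<2 * T + 3]) [2..<tapes M + 1]) @
     map (\<lambda>p. (True, 0, 1, p, 0) #
       (if p < T + 1 \<or> T + 1 + m \<le> p then [] else [(True, 0, 1, p, 1), (True, 0, 1, p, 2)]))
           [0..<2 * T + 3] @
     map (\<lambda>j. [(False, 0, 1, T + 1 + j, 0), (True, 0, 1, T + 2 + j, 0)]) [0..<T + 2]"

text \<open>Acceptance is stated negatively, by forbidding every other symbol in the two output
  cells. An assignment containing all facts of a rejecting run violates one of these
  clauses.\<close>

definition final_clauses :: "tm \<Rightarrow> nat \<Rightarrow> (bool \<times> var) list list" where
  "final_clauses M T = concat (map (\<lambda>s. (if s = 2 then [] else [[(False, T, 0, T + 1 + T, s)]]) @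
     (if s = 0 then [] else [[(False, T, 0, T + 1 + T + 1, s)]])) (alphabet M))"

definition formula :: "tm \<Rightarrow> nat \<Rightarrow> nat \<Rightarrow> bool list \<Rightarrow> (bool \<times> var) list list" where
  "formula M T m x = init_clauses M T m x @ step_clauses M T @ final_clauses M T"

section \<open>Satisfiability and acceptance\<close>

lemma final_clauses_iff: "C \<in> set (final_clauses M T) \<longleftrightarrow> (\<exists>s\<in>set (alphabet M).
    s \<noteq> 2 \<and> C = [(False, T, 0, T + 1 + T, s)] \<or> s \<noteq> 0 \<and> C = [(False, T, 0, T + 1 + T + 1, s)])"
  unfolding final_clauses_def set_concat set_map UN_iff image_image set_append
  by (rule bex_cong[OF refl]) simp

lemma input_symbol_eq: "input_symbol x j = (if j < length x then bit_symbol (x ! j) else 0)"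
proof (cases "j < length x")
  case True
  then have "drop j x = x ! j # drop (Suc j) x" by (simp add: Cons_nth_drop_Suc)
  then show ?thesis using True by (simp add: input_symbol_def bit_symbol_def)
qed (simp add: input_symbol_def)

lemma cell_initial:
  assumes "2 \<le> tapes M" "i \<le> tapes M"
  shows "cell M (conf M x c 0) i (int p - int n) =
    (if p < n then 0 else input_symbol (if i = 0 then x else if i = 1 then c else []) (p - n))"
proof -
  have "i = 0 \<or> i = 1 \<or> (\<exists>k. i = Suc (Suc k))" by presburger
  then show ?thesis
    using assms by (auto simp: cell_def conf_def initial_def word_tape_def input_symbol_eq nat_diff_distrib'
      of_nat_diff[symmetric] simp del: of_nat_diff)
qed

lemma rules_iff:
  "r \<in> set (rules M) \<longleftrightarrow> (\<exists>ss i s. r = (zip [0..<tapes M + 1] ss, i, s, next_cell M ss i) \<and>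
     length ss = tapes M + 1 \<and> set ss \<subseteq> set (alphabet M) \<and> i \<le> tapes M \<and> s \<in> set (alphabet M))"
  unfolding rules_def set_concat set_map set_n_lists by (fastforce simp: less_Suc_eq_le)

lemma cell_in_alphabet: "valid_config M cf \<Longrightarrow> cell M cf i j \<in> set (alphabet M)"
  by (auto simp: cell_def valid_config_def alphabet_def intro: less_le_trans le_less_trans trans_less_add1)

lemma scanned_in_alphabet:
  assumes "valid_config M cf"
  shows "length (scanned cf) = tapes M + 1" "set (scanned cf) \<subseteq> set (alphabet M)"
proof -
  show "length (scanned cf) = tapes M + 1" using assms by (simp add: scanned_def valid_config_def)
  then show "set (scanned cf) \<subseteq> set (alphabet M)"
    using nth_scanned[OF assms] cell_in_alphabet[OF assms]
        by (fastforce simp: in_set_conv_nth less_Suc_eq_le)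
qed

lemma rule_clause_in_formula:
  assumes "t < T" "p < 2 * T + 3" "r \<in> set (rules M)"
  shows "rule_clause T t p r \<in> set (formula M T m x)"
proof -
  have "rule_clause T t p r \<in> (\<Union>t\<in>{..<T}. \<Union>p\<in>{..<2 * T + 3}. rule_clause T t p ` set (rules M))"
    using assms by blast
  then show ?thesis by (simp add: formula_def step_clauses_def atLeast0LessThan)
qed

text \<open>The assignment may make more facts true than one run does. A certificate is read off
  from it, and all facts of the run on this certificate follow through the Horn clauses; the final
  clauses then exclude rejection.\<close>

lemma satisfiable_formula_sound:
  assumes M: "turing_machine M" "2 \<le> tapes M" and sat: "satisfiable (formula M T m x)"
  shows "\<exists>c. length c \<le> m \<and> cell M (conf M x c T) 0 0 = 2 \<and> cell M (conf M x c T) 0 1 = 0"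
proof -
  let ?W = "T + 1"
  from sat obtain \<alpha> where \<alpha>: "\<And>C. C \<in> set (formula M T m x) \<Longrightarrow> \<exists>(b, v)\<in>set C. \<alpha> v = b"
    unfolding satisfiable_def by blast
  \<comment> \<open>The certificate ends at its first blank, at the latest after \<open>m\<close>
    cells.\<close>
  define n where "n = (LEAST j. m \<le> j \<or> \<alpha> (0, 1, ?W + j, 0))"
  \<comment> \<open>If both bit symbols are marked in a cell, 2 is chosen; if only 1 is marked, the
    bit becomes \<open>False\<close>.\<close>
  define c where "c = map (\<lambda>j. \<alpha> (0, 1, ?W + j, 2)) [0..<n]"
  have n: "m \<le> n \<or> \<alpha> (0, 1, ?W + n, 0)" unfolding n_def by (rule LeastI[of _ m]) simp
  have least: "j < m \<and> \<not> \<alpha> (0, 1, ?W + j, 0)" if "j < n" for j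
    using not_less_Least[of j "\<lambda>j. m \<le> j \<or> \<alpha> (0, 1, ?W + j, 0)"] that unfolding n_def by linarith
  have "n \<le> m" unfolding n_def by (rule Least_le) simp
  have input: "\<alpha> (0, 0, p, if p < ?W then 0 else input_symbol x (p - ?W))" if "p < 2 * T + 3" for p
    using \<alpha>[of "[(True, 0, 0, p, if p < ?W then 0 else input_symbol x (p - ?W))]"] that
    by (auto simp: formula_def init_clauses_def image_iff simp del: upt_Suc)
  have other: "\<alpha> (0, i, p, 0)" if "2 \<le> i" "i \<le> tapes M" "p < 2 * T + 3" for i p
    using \<alpha>[of "[(True, 0, i, p, 0)]"] that by (auto simp: formula_def init_clauses_def image_iff
        simp del: upt_Suc)
  have blank: "\<alpha> (0, 1, p, 0)" if "p < ?W \<or> ?W + m \<le> p" "p < 2 * T + 3" for p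
    using \<alpha>[of "[(True, 0, 1, p, 0)]"] that by (auto simp: formula_def init_clauses_def image_iff
        simp del: upt_Suc)
  have choice: "\<alpha> (0, 1, p, 0) \<or> \<alpha> (0, 1, p, 1) \<or> \<alpha> (0, 1, p, 2)"
      if "?W \<le> p" "p < ?W + m" "p < 2 * T + 3" for p
    using \<alpha>[of "[(True, 0, 1, p, 0), (True, 0, 1, p, 1), (True, 0, 1, p, 2)]"] that
    by (auto simp: formula_def init_clauses_def image_iff simp del: upt_Suc)
  have blanks: "\<alpha> (0, 1, ?W + Suc j, 0)" if "\<alpha> (0, 1, ?W + j, 0)" "j < T + 2" for j
    using \<alpha>[of "[(False, 0, 1, ?W + j, 0), (True, 0, 1, T + 2 + j, 0)]"] that
    by (auto simp: formula_def init_clauses_def image_iff simp del: upt_Suc)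
  have blanks_from: "\<alpha> (0, 1, ?W + j, 0)" if "n \<le> j" "\<alpha> (0, 1, ?W + n, 0)" "j < T + 2" for j
    using that
  proof (induction j rule: dec_induct)
    case (step j)
    then show ?case using blanks[of j] by simp
  qed simp
  have start: "\<alpha> (0, i, p, cell M (conf M x c 0) i (int p - int ?W))" if "i \<le> tapes M" "p < 2 * T + 3"
      for i p
  proof -
    consider "i = 0" | "i = 1" | "2 \<le> i" by linarith
    then show ?thesis
    proof cases
      case 1
      then have "cell M (conf M x c 0) i (int p - int ?W) = (if p < ?W then 0 else input_symbol x (p - ?W))"
        using cell_initial[OF M(2) that(1), of x c p ?W] by (simp only: if_True simp_thms)
      then show ?thesis using input[OF that(2)] 1 by (simp only:)
    next
      case 2
      have cell: "cell M (conf M x c 0) 1 (int p - int ?W) =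
          (if p < ?W \<or> ?W + n \<le> p then 0 else bit_symbol (c ! (p - ?W)))"
        using cell_initial[OF M(2), of 1 x c p ?W] M(2) by (auto simp: input_symbol_eq c_def)
      show ?thesis
      proof (cases "p < ?W \<or> ?W + n \<le> p")
        case True
        have "\<alpha> (0, 1, p, 0)"
        proof (cases "p < ?W \<or> ?W + m \<le> p")
          case False
          with True have "n \<le> p - ?W" "\<not> m \<le> n" by auto
          moreover have "p - ?W < T + 2" using that(2) by simp
          ultimately have "\<alpha> (0, 1, ?W + (p - ?W), 0)" using n blanks_from by blast
          moreover have "?W + (p - ?W) = p" using False by simp
          ultimately show ?thesis by (simp only:)
        qed (use blank that in blast)
        then show ?thesis using 2 cell True by simp
      next
        case False
        then have p: "p - ?W < n" "?W + (p - ?W) = p" by auto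
        with least[OF p(1)] choice[of p] that(2) have "\<alpha> (0, 1, p, 1) \<or> \<alpha> (0, 1, p, 2)" by auto
        moreover have "c ! (p - ?W) = \<alpha> (0, 1, ?W + (p - ?W), 2)" using p(1) by (simp add: c_def)
        then have "c ! (p - ?W) = \<alpha> (0, 1, p, 2)" unfolding p(2) .
        ultimately show ?thesis using 2 cell False by (auto simp: bit_symbol_def)
      qed
    next
      case 3
      then have "cell M (conf M x c 0) i (int p - int ?W) = 0"
        using cell_initial[OF M(2) that(1), of x c p ?W] by (simp add: input_symbol_eq)
      then show ?thesis using other[OF 3 that] by simp
    qed
  qed
  \<comment> \<open>A cell comes from a position at most two further left, so each step gives up two
    positions at the left end of the window. The head position \<open>T + 1 + t\<close> stays in the
    remaining part as long as t \<le> T.\<close>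
  have run: "\<alpha> (t, i, p, cell M (conf M x c t) i (int p - int (?W + t)))"
    if "t \<le> T" "i \<le> tapes M" "2 * t \<le> p" "p < 2 * T + 3" for t i p
    using that
  proof (induction t arbitrary: i p)
    case 0
    then show ?case using start by simp
  next
    case (Suc t)
    let ?cf = "conf M x c t"
    note valid = valid_config_conf[OF M(1), of x c t]
    obtain w e where next_cell: "next_cell M (scanned ?cf) i = (w, e)" by fastforce
    have "e \<le> 2"
    proof -
      have "shift d \<le> 2" for d by (cases d) auto
      then show ?thesis using next_cell by (auto simp: next_cell_def Let_def split: if_splits)
    qed
    define p' where "p' = p - e"
    have p': "p = p' + e" "2 * t \<le> p'" "p' < 2 * T + 3" using Suc.prems \<open>e \<le> 2\<close> by (auto simp: p'_def)
    let ?s = "cell M ?cf i (int p' - int (?W + t))"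
    let ?r = "(zip [0..<tapes M + 1] (scanned ?cf), i, ?s, w, e)"
    have "?r \<in> set (rules M)"
      unfolding rules_iff using scanned_in_alphabet[OF valid] cell_in_alphabet[OF valid] Suc.prems(2)
          next_cell
      by (intro exI[of _ "scanned ?cf"] exI[of _ i] exI[of _ ?s]) simp
    then have "rule_clause T t p' ?r \<in> set (formula M T m x)"
      using Suc.prems(1) p'(3) by (intro rule_clause_in_formula) simp_all
    from \<alpha>[OF this] obtain b v where bv: "(b, v) \<in> set (rule_clause T t p' ?r)" "\<alpha> v = b" by blast
    have "\<alpha> (t, i', ?W + t, scanned ?cf ! i')" if "i' < tapes M + 1" for i'
      using Suc.IH[of i' "?W + t"] Suc.prems(1) that nth_scanned[OF valid, of i'] by simp
    then have "(b, v) \<notin> set (map (\<lambda>(i', s'). (False, t, i', ?W + t, s'))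
        (zip [0..<tapes M + 1] (scanned ?cf)))"
      using bv(2) scanned_in_alphabet(1)[OF valid] by (auto simp: set_zip simp del: upt_Suc)
    moreover have "\<alpha> (t, i, p', ?s)" using Suc.IH[of i p'] Suc.prems p' by simp
    ultimately have "\<alpha> (Suc t, i, p' + e, if p' = ?W + t then w else ?s)"
      using bv by (auto simp: rule_clause_def)
    moreover have "cell M (conf M x c (Suc t)) i (int p - int (?W + Suc t)) =
        (if p' = ?W + t then w else ?s)"
      using cell_step[OF M(1) valid Suc.prems(2) next_cell, of "int p' - int (?W + t)"] p'(1)
      by (simp add: conf_def algebra_simps)
    ultimately show ?case using p'(1) by simp
  qed
  let ?cf = "conf M x c T"
  note in_alphabet = cell_in_alphabet[OF valid_config_conf[OF M(1), of x c T], of 0]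
  have "\<alpha> (T, 0, ?W + T, cell M ?cf 0 0)" "\<alpha> (T, 0, ?W + T + 1, cell M ?cf 0 1)"
    using run[of T 0 "?W + T"] run[of T 0 "?W + T + 1"] by auto
  then have "cell M ?cf 0 0 = 2 \<and> cell M ?cf 0 1 = 0"
    using \<alpha>[of "[(False, T, 0, ?W + T, cell M ?cf 0 0)]"]
        \<alpha>[of "[(False, T, 0, ?W + T + 1, cell M ?cf 0 1)]"]
      in_alphabet[of 0] in_alphabet[of 1]
    unfolding formula_def set_append Un_iff final_clauses_iff by auto
  moreover have "length c \<le> m" using \<open>n \<le> m\<close> by (simp add: c_def)
  ultimately show ?thesis by blast
qed

text \<open>The assignment is the actual content of the cells. A transition clause with actual
  premises has a true conclusion by \<open>cell_step\<close>, and any other one has a false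
  premise.\<close>

lemma satisfiable_formula_complete:
  assumes M: "turing_machine M" "2 \<le> tapes M" and c: "length c \<le> m"
    "cell M (conf M x c T) 0 0 = 2" "cell M (conf M x c T) 0 1 = 0"
  shows "satisfiable (formula M T m x)"
proof -
  let ?W = "T + 1"
  define \<alpha> where "\<alpha> = (\<lambda>(t, i, p, s). s = cell M (conf M x c t) i (int p - int (?W + t)))"
  have "\<exists>(b, v)\<in>set C. \<alpha> v = b" if "C \<in> set (formula M T m x)" for C
  proof -
    from that consider "C \<in> set (init_clauses M T m x)"
      | t p r where "C = rule_clause T t p r" "r \<in> set (rules M)"
      | "C \<in> set (final_clauses M T)"
      by (auto simp: formula_def step_clauses_def)
    then show ?thesis
    proof cases
      case 1
      have init: "\<alpha> (0, i, p, s) \<longleftrightarrow> s = (if p < ?W then 0 else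
          input_symbol (if i = 0 then x else if i = 1 then c else []) (p - ?W))" if "i \<le> tapes M" for i p s
        using cell_initial[OF M(2) that, of x c p ?W] by (simp add: \<alpha>_def)
      from 1 consider
          p where "C = [(True, 0, 0, p, if p < ?W then 0 else input_symbol x (p - ?W))]"
        | i p where "2 \<le> i" "i \<le> tapes M" "C = [(True, 0, i, p, 0)]"
        | p where "C = [(True, 0, 1, p, 0)]" "p < ?W \<or> ?W + m \<le> p"
        | p where "C = [(True, 0, 1, p, 0), (True, 0, 1, p, 1), (True, 0, 1, p, 2)]"
        | j where "C = [(False, 0, 1, T + 1 + j, 0), (True, 0, 1, T + 2 + j, 0)]"
        unfolding init_clauses_def by (auto split: if_splits)
      then show ?thesis
      proof cases
        case (1 p)
        then show ?thesis using init[of 0 p] by simp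
      next
        case (2 i p)
        then show ?thesis using init[of i p 0] by (simp add: input_symbol_eq)
      next
        case (3 p)
        then show ?thesis using init[of 1 p 0] M(2) c(1) by (auto simp: input_symbol_eq)
      next
        case (4 p)
        then show ?thesis using init[of 1 p] M(2) by (auto simp: input_symbol_eq bit_symbol_def)
      next
        case (5 j)
        have "\<alpha> (0, 1, T + 1 + j, 0) \<longrightarrow> \<alpha> (0, 1, T + 2 + j, 0)"
          using init[of 1 "T + 1 + j" 0] init[of 1 "T + 2 + j" 0] M(2)
          by (auto simp: input_symbol_eq bit_symbol_def split: if_splits)
        then show ?thesis using 5 by auto
      qed
    next
      case 2
      then obtain ss i s where r: "r = (zip [0..<tapes M + 1] ss, i, s, next_cell M ss i)"
        "length ss = tapes M + 1" "i \<le> tapes M" unfolding rules_iff by blast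
      let ?cf = "conf M x c t"
      note valid = valid_config_conf[OF M(1), of x c t]
      obtain w e where next_cell: "next_cell M ss i = (w, e)" by fastforce
      show ?thesis
      proof (cases "ss = scanned ?cf \<and> s = cell M ?cf i (int p - int (?W + t))")
        case True
        then have "\<alpha> (Suc t, i, p + e, if p = ?W + t then w else s)"
          using cell_step[OF M(1) valid r(3), of w e "int p - int (?W + t)"] next_cell
          by (simp add: \<alpha>_def conf_def algebra_simps)
        then show ?thesis using 2 r next_cell by (auto simp: rule_clause_def)
      next
        case False
        then consider "s \<noteq> cell M ?cf i (int p - int (?W + t))" | "ss \<noteq> scanned ?cf" by blast
        then show ?thesis
        proof cases
          case 1
          then have "\<not> \<alpha> (t, i, p, s)" by (simp add: \<alpha>_def)
          then show ?thesis using 2 r next_cell by (auto simp: rule_clause_def)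
        next
          case ss: 2
          then obtain i' where i': "i' < tapes M + 1" "ss ! i' \<noteq> scanned ?cf ! i'"
            using r(2) scanned_in_alphabet(1)[OF valid] by (metis nth_equalityI)
          then have "\<not> \<alpha> (t, i', ?W + t, ss ! i')"
            using nth_scanned[OF valid, of i'] by (simp add: \<alpha>_def)
          moreover have "(i', ss ! i') \<in> set (zip [0..<tapes M + 1] ss)"
            using i'(1) r(2) by (force simp: set_zip simp del: upt_Suc)
          from imageI[OF this, of "\<lambda>(i', s'). (False, t, i', ?W + t, s')"]
          have "(False, t, i', ?W + t, ss ! i') \<in> set C"
            unfolding 2(1) r(1) rule_clause_def by (simp add: next_cell del: upt_Suc)
          ultimately show ?thesis by (intro bexI[of _ "(False, t, i', ?W + t, ss ! i')"]) simp_all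
        qed
      qed
    next
      case 3
      then obtain s where "C = [(False, T, 0, ?W + T, s)] \<and> s \<noteq> 2 \<or> C = [(False, T, 0, ?W + T + 1, s)] \<and>
          s \<noteq> 0"
        unfolding final_clauses_iff by blast
      moreover have "int (?W + T) - int (?W + T) = 0" "int (?W + T + 1) - int (?W + T) = 1" by simp_all
      then have "\<alpha> (T, 0, ?W + T, s) \<longleftrightarrow> s = 2" "\<alpha> (T, 0, ?W + T + 1, s) \<longleftrightarrow> s = 0"
        unfolding \<alpha>_def by (simp_all only: prod.case c(2,3))
      ultimately show ?thesis by (elim disjE conjE) simp_all
    qed
  qed
  then show ?thesis unfolding satisfiable_def by blast
qed


lemma formula_nonempty: "C \<in> set (formula M T m x) \<Longrightarrow> C \<noteq> []"
  by (auto simp: formula_def init_clauses_def step_clauses_def final_clauses_iff rule_clause_def)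

lemma ptime_formula:
  assumes "poly_time T" "poly_time m" "poly_time x"
  shows "poly_time (\<lambda>z. formula M (T z) (m z) (x z))"
proof -
  have "poly_time (\<lambda>z :: nat \<times> nat \<times> bool list. formula M (fst z) (fst (snd z)) (snd (snd z)))"
    unfolding formula_def init_clauses_def input_symbol_def step_clauses_def rule_clause_def
        final_clauses_def
    by (intro ptime)
  from poly_time_comp[OF _ this, of "\<lambda>z. (T z, m z, x z)"] show ?thesis by (simp add: ptime assms)
qed

text \<open>The time bound is taken at the largest certificate length, so one \<open>T\<close>
  covers all certificates. That clauses are nonempty is recorded because it makes the graph built
  from them connected.\<close>

theorem cook_levin:
  assumes "L \<in> NP"
  obtains f :: "bool list \<Rightarrow> (bool \<times> var) list list" where
    "poly_time f" "\<And>x C. C \<in> set (f x) \<Longrightarrow> C \<noteq> []" "\<And>x. x \<in> L \<longleftrightarrow> satisfiable (f x)"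
proof -
  from assms obtain verify and p :: "nat poly" where "polytime 2 verify" and
    L: "\<And>x. x \<in> L \<longleftrightarrow> (\<exists>c. length c \<le> poly p (length x) \<and> verify [x, c] = [True])"
    unfolding NP_def by blast
  then obtain M and q :: "nat poly" where M: "turing_machine M" "2 \<le> tapes M" and
    q: "\<And>ws. length ws = 2 \<Longrightarrow> computes_within M (poly q (sum_list (map length ws))) ws (verify ws)"
    unfolding polytime_def by blast
  let ?m = "\<lambda>x. poly p (length x)"
  let ?T = "\<lambda>x. poly q (length x + ?m x)"
  let ?f = "\<lambda>x. formula M (?T x) (?m x) x"
  have accept: "verify [x, c] = [True] \<longleftrightarrow>
      cell M (conf M x c (?T x)) 0 0 = 2 \<and> cell M (conf M x c (?T x)) 0 1 = 0" if "length c \<le> ?m x" for x c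
  proof (rule conf_accepting[OF M(1)])
    show "computes_within M (poly q (length x + length c)) [x, c] (verify [x, c])"
        using q[of "[x, c]"] by simp
    show "poly q (length x + length c) \<le> ?T x" using that by (intro poly_mono) simp
  qed
  show thesis
  proof
    show "poly_time ?f" by (intro ptime_formula ptime)
    show "x \<in> L \<longleftrightarrow> satisfiable (?f x)" for x
      using L[of x] accept[of _ x] satisfiable_formula_sound[OF M, of "?T x" "?m x" x]
        satisfiable_formula_complete[OF M, of _ "?m x" x "?T x"] by blast
  qed (use formula_nonempty in blast)
qed

section \<open>The encoding of instances\<close>

primrec num :: "bool list \<Rightarrow> nat" where
  "num [] = 0"
| "num (b # bs) = of_bool b + 2 * num bs"

lemma num_binary [simp]: "num (binary n) = n"
proof (induction n rule: binary.induct)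
  case (1 n)
  then show ?case by (subst binary.simps) auto
qed

definition prefix_code :: "('a \<Rightarrow> bool list) \<Rightarrow> bool" where
  "prefix_code e \<longleftrightarrow> (\<forall>x y r s. e x @ r = e y @ s \<longrightarrow> x = y \<and> r = s)"

lemma encode_list_simps [simp]:
  "encode_list e [] = [False]" "encode_list e (x # xs) = True # e x @ encode_list e xs"
  by (simp_all add: encode_list_def)

lemma encode_list_map: "encode_list e (map g xs) = encode_list (\<lambda>x. e (g x)) xs"
  by (induction xs) auto

lemma prefix_code_encode_list:
  assumes "prefix_code e"
  shows "prefix_code (encode_list e)"
  unfolding prefix_code_def
proof (intro allI impI)
  fix xs ys r s
  assume "encode_list e xs @ r = encode_list e ys @ s"
  then show "xs = ys \<and> r = s"
  proof (induction xs arbitrary: ys)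
    case Nil
    then show ?case by (cases ys) auto
  next
    case (Cons x xs)
    then obtain y ys' where ys: "ys = y # ys'" by (cases ys) auto
    with Cons.prems have "e x @ encode_list e xs @ r = e y @ encode_list e ys' @ s" by simp
    with assms have "x = y" "encode_list e xs @ r = encode_list e ys' @ s"
        unfolding prefix_code_def by blast+
    with Cons.IH ys show ?case by simp
  qed
qed

lemma prefix_code_bit: "prefix_code (\<lambda>b. [b])"
  by (simp add: prefix_code_def)

lemma prefix_code_nat: "prefix_code encode_nat"
  unfolding prefix_code_def
proof (intro allI impI)
  fix m n r s assume "encode_nat m @ r = encode_nat n @ s"
  then have "binary m = binary n" "r = s"
    using prefix_code_encode_list[OF prefix_code_bit] unfolding prefix_code_def encode_nat_def by blast+
  then show "m = n \<and> r = s" using num_binary[of m] by simp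
qed

lemma prefix_code_enat: "prefix_code encode_enat"
  unfolding prefix_code_def
proof (intro allI impI)
  have nat: "encode_nat m @ r = encode_nat n @ s \<Longrightarrow> m = n \<and> r = s" for m n r s
    using prefix_code_nat unfolding prefix_code_def by blast
  fix x y r s assume "encode_enat x @ r = encode_enat y @ s"
  then show "x = y \<and> r = s" by (cases x; cases y) (auto simp: encode_enat_def dest: nat)
qed

lemma encode_matrix_eq: "encode_matrix e n A =
    encode_list (encode_list e) (map (\<lambda>u. map (A u) [0..<n]) [0..<n])"
  by (simp add: encode_matrix_def encode_list_map)

lemma encode_matrix_inject:
  assumes "prefix_code e" "encode_matrix e n A @ r = encode_matrix e m B @ s"
  shows "n = m" "\<And>u v. u < n \<Longrightarrow> v < n \<Longrightarrow> A u v = B u v" "r = s"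
proof -
  have eq: "map (\<lambda>u. map (A u) [0..<n]) [0..<n] = map (\<lambda>u. map (B u) [0..<m]) [0..<m]" "r = s"
    using assms prefix_code_encode_list[OF prefix_code_encode_list[OF assms(1)]]
    unfolding prefix_code_def encode_matrix_eq by blast+
  from arg_cong[OF eq(1), of length] show "n = m" by simp
  with eq(1) show "A u v = B u v" if "u < n" "v < n" for u v
    using that by (simp add: map_eq_conv)
  show "r = s" by (fact eq)
qed

lemma simple_graph_edge: "simple_graph V E \<Longrightarrow> e \<in> E \<longleftrightarrow> (\<exists>u\<in>V. \<exists>v\<in>V. u \<noteq> v \<and> e = {u, v} \<and> {u, v} \<in> E)"
  unfolding simple_graph_def by blast

text \<open>Values of \<open>bound\<close> outside the vertex range are not encoded, so valid
  instances with equal codes may differ, but not in what solvability depends on. Hence membership of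
  a code in \<open>TGR\<close> can be judged by any valid instance with that code.\<close>

lemma encode_instance_inject:
  assumes "valid_instance I" "valid_instance J" "encode_instance I = encode_instance J"
  shows "period I = period J" "tgr_solvable I \<longleftrightarrow> tgr_solvable J"
proof -
  note eq = assms(3)[unfolded encode_instance_def]
  note adj = encode_matrix_inject[OF prefix_code_bit eq]
  note dist = encode_matrix_inject[OF prefix_code_enat adj(3)]
  have "encode_nat (period I) @ [] = encode_nat (period J) @ []" using dist(3) by simp
  then show period: "period I = period J" using prefix_code_nat unfolding prefix_code_def by blast
  have "e \<in> edges I \<longleftrightarrow> e \<in> edges J" for e
    using simple_graph_edge[of "{..<num_vertices I}" "edges I" e]
        simple_graph_edge[of "{..<num_vertices J}" "edges J" e]
      assms(1,2) adj(1,2) unfolding valid_instance_def by auto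
  then have "edges I = edges J" by blast
  then show "tgr_solvable I \<longleftrightarrow> tgr_solvable J"
    using period adj(1) dist(2) unfolding tgr_solvable_def by simp
qed

section \<open>Temporal paths\<close>

text \<open>Durations are natural numbers, so if all of them exceed \<open>d\<close>, then the
  infimum is at least \<open>Suc d\<close>.\<close>

lemma fastest_duration_le_iff:
  "fastest_duration E \<Delta> lab u v \<le> enat d \<longleftrightarrow> (\<exists>P. temporal_path E \<Delta> lab u v P \<and> duration P \<le> d)"
proof
  assume le: "fastest_duration E \<Delta> lab u v \<le> enat d"
  show "\<exists>P. temporal_path E \<Delta> lab u v P \<and> duration P \<le> d"
  proof (rule ccontr)
    assume "\<not> ?thesis"
    then have "enat (Suc d) \<le> fastest_duration E \<Delta> lab u v"
      unfolding fastest_duration_def by (auto intro!: INF_greatest)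
    from order_trans[OF this le] show False by simp
  qed
next
  assume "\<exists>P. temporal_path E \<Delta> lab u v P \<and> duration P \<le> d"
  then show "fastest_duration E \<Delta> lab u v \<le> enat d"
    unfolding fastest_duration_def by (auto intro: INF_lower2)
qed

lemma length_le_last_time:
  assumes "successively (\<lambda>(u, v, t) (u', v', t'). v = u' \<and> t < t') P" "P \<noteq> []"
  shows "snd (snd (hd P)) + length P \<le> snd (snd (last P)) + 1"
  using assms
proof (induction P rule: induct_list012)
  case (3 s s' P)
  then show ?case by (auto split: prod.splits)
qed auto

lemma length_le_duration: "temporal_path E \<Delta> lab u v P \<Longrightarrow> length P \<le> duration P"
  using length_le_last_time[of P] by (auto simp: temporal_path_def duration_def)

lemma static_path_extend:
  assumes "static_path V E w v xs" "{u, w} \<in> E" "u \<in> V"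
  shows "\<exists>ys. static_path V E u v ys"
proof (cases "u \<in> set xs")
  case True
  then obtain ys zs where "xs = ys @ u # zs" by (meson split_list)
  with assms(1) have "static_path V E u v (u # zs)"
    by (auto simp: static_path_def successively_append_iff)
  then show ?thesis ..
next
  case False
  with assms have "static_path V E u v (u # xs)"
    by (auto simp: static_path_def successively_Cons)
  then show ?thesis ..
qed

lemma static_dist_le: "static_path V E u v xs \<Longrightarrow> static_dist V E u v \<le> enat (length xs - 1)"
  unfolding static_dist_def by (auto intro: INF_lower)

section \<open>From satisfiability to period two\<close>

definition neg :: "bool \<times> 'v \<Rightarrow> bool \<times> 'v" where
  "neg l = (\<not> fst l, snd l)"

text \<open>
  A vertex is tagged: \<open>0\<close> is the hub, \<open>1\<close> a leaf for the truth value true, \<open>2\<close> a literal,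
  \<open>3\<close> a leaf for a literal, and \<open>4\<close> a clause. Repeated vertices are harmless.
\<close>

type_synonym 'v node = "nat \<times> (bool \<times> 'v) list"

text \<open>Leaves exist for both signs of each occurring variable, so every literal vertex can be
  compared with a leaf of the opposite sign. The hub and the truth leaf come first to have the fixed
  numbers 0 and 1.\<close>

definition nodes :: "(bool \<times> 'v) list list \<Rightarrow> 'v node list" where
  "nodes F = (0, []) # (1, []) # map (\<lambda>l. (2, [l])) (concat F) @ map (\<lambda>l. (3, [l])) (concat F) @
     map (\<lambda>l. (3, [neg l])) (concat F) @ map (\<lambda>C. (4, C)) F"

text \<open>Membership of a literal in a clause is spelled out by bounded quantifiers and an
  equality, which the \<open>ptime\<close> rules cover.\<close>

definition below :: "'v node \<Rightarrow> 'v node \<Rightarrow> bool" where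
  "below a b \<longleftrightarrow> fst a = 0 \<and> 1 \<le> fst b \<and> fst b \<le> 3 \<or>
     fst a = 2 \<and> fst b = 4 \<and> (\<exists>l\<in>set (snd a). \<exists>l'\<in>set (snd b). l = l')"

definition adjacent :: "'v node \<Rightarrow> 'v node \<Rightarrow> bool" where
  "adjacent a b \<longleftrightarrow> below a b \<or> below b a"

definition limit :: "'v node \<Rightarrow> 'v node \<Rightarrow> enat" where
  "limit a b = (if fst a = 1 \<and> fst b = 4 then 3
     else if fst a = 3 \<and> (fst b = 2 \<or> fst b = 3) \<and> snd b = map neg (snd a) then 2 else \<infinity>)"

lemma limit_cases:
  obtains "fst a = 1" "fst b = 4" "limit a b = 3"
    | "fst a = 3" "fst b = 2 \<or> fst b = 3" "snd b = map neg (snd a)" "limit a b = 2"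
    | "limit a b = \<infinity>"
  using that unfolding limit_def by argo

definition sat_instance :: "(bool \<times> 'v) list list \<Rightarrow> tgr_instance" where
  "sat_instance F = \<lparr>num_vertices = length (nodes F),
     edges = {{u, v} |u v. u < length (nodes F) \<and> v < length (nodes F) \<and>
         adjacent (nodes F ! u) (nodes F ! v)},
     bound = (\<lambda>u v. limit (nodes F ! u) (nodes F ! v)), period = 2\<rparr>"

lemma adjacent_sym: "adjacent a b \<Longrightarrow> adjacent b a"
  by (auto simp: adjacent_def)

lemma sat_instance_simps [simp]:
  "num_vertices (sat_instance F) = length (nodes F)" "period (sat_instance F) = 2"
  "bound (sat_instance F) u v = limit (nodes F ! u) (nodes F ! v)"
  by (simp_all add: sat_instance_def)

lemma edge_iff:
  "{u, v} \<in> edges (sat_instance F) \<longleftrightarrow>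
     u < length (nodes F) \<and> v < length (nodes F) \<and> adjacent (nodes F ! u) (nodes F ! v)"
  unfolding sat_instance_def by (auto simp: doubleton_eq_iff dest: adjacent_sym)

text \<open>Vertex numbers and the edge set disappear from the code; what remains are list
  operations on \<open>nodes F\<close> that the \<open>ptime\<close> rules can handle.\<close>

lemma encode_sat_instance:
  "encode_instance (sat_instance F) =
     encode_list (\<lambda>a. encode_list (\<lambda>b. [adjacent a b]) (nodes F)) (nodes F) @
     encode_list (\<lambda>a. encode_list (\<lambda>b. encode_enat (limit a b)) (nodes F)) (nodes F) @
     encode_nat 2"
proof -
  have matrix: "encode_matrix e (length vs) A = encode_list (\<lambda>a. encode_list (\<lambda>b. e (f a b)) vs) vs"
    if "\<And>u v. u < length vs \<Longrightarrow> v < length vs \<Longrightarrow> A u v = f (vs ! u) (vs ! v)"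
    for e :: "'b \<Rightarrow> bool list" and A f and vs :: "'a node list"
  proof -
    have "map (A u) [0..<length vs] = map (f (vs ! u)) vs" if "u < length vs" for u
      using \<open>\<And>u v. u < length vs \<Longrightarrow> v < length vs \<Longrightarrow> A u v = f (vs ! u) (vs ! v)\<close> that
      by (intro nth_equalityI) auto
    then have "map (\<lambda>u. map (A u) [0..<length vs]) [0..<length vs] = map (\<lambda>a. map (f a) vs) vs"
      by (intro nth_equalityI) auto
    then show ?thesis by (simp add: encode_matrix_eq encode_list_map)
  qed
  show ?thesis
    unfolding encode_instance_def by (simp add: edge_iff matrix[of _ _ adjacent] matrix[of _ _ limit])
qed

lemma ptime_encode_list [ptime]:
  assumes "poly_time (\<lambda>z. e (fst z) (snd z))" "poly_time xs"
  shows "poly_time (\<lambda>x. encode_list (e x) (xs x))"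
  unfolding encode_list_def by (intro ptime assms)

lemma ptime_sat_instance: "poly_time (\<lambda>F :: (bool \<times> 'v::encodable) list list. encode_instance
    (sat_instance F))"
proof -
  have limit: "encode_enat (limit a b) = (if fst a = 1 \<and> fst b = 4 then encode_enat 3
      else if fst a = 3 \<and> (fst b = 2 \<or> fst b = 3) \<and> snd b = map neg (snd a) then encode_enat 2
      else encode_enat \<infinity>)" for a b :: "'v node"
    by (simp only: limit_def if_distrib[of encode_enat])
  show ?thesis
    unfolding encode_sat_instance nodes_def adjacent_def below_def limit neg_def by (intro ptime)
qed

lemma nodes_0_1 [simp]: "nodes F ! 0 = (0, [])" "nodes F ! 1 = (1, [])" "nodes F ! Suc 0 = (1, [])"
  "0 < length (nodes F)" "nodes F \<noteq> []" "Suc 0 < length (nodes F)"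
  by (simp_all add: nodes_def)

lemma nodes_tag: "fst (nodes F ! i) \<noteq> 0 \<Longrightarrow> i \<noteq> 0" "fst (nodes F ! i) \<noteq> 1 \<Longrightarrow> i \<noteq> 1"
  by (cases "i = 0"; cases "i = 1"; simp)+

lemma nodes_cases:
  assumes "i < length (nodes F)"
  obtains "i = 0" | "i = 1" | l where "l \<in> set (concat F)" "nodes F ! i = (2, [l])"
    | l where "l \<in> set (concat F) \<or> neg l \<in> set (concat F)" "nodes F ! i = (3, [l])"
    | C where "C \<in> set F" "nodes F ! i = (4, C)"
proof -
  consider "i = 0" | "i = 1" | j where "i = Suc (Suc j)" using not0_implies_Suc by (metis One_nat_def)
  then show thesis
  proof cases
    case (3 j)
    with assms have "nodes F ! i \<in> set (map (\<lambda>l. (2, [l])) (concat F) @ map (\<lambda>l. (3, [l])) (concat F) @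
        map (\<lambda>l. (3, [neg l])) (concat F) @ map (\<lambda>C. (4, C)) F)"
      unfolding nodes_def by (metis Suc_less_eq length_Cons nth_Cons_Suc nth_mem)
    moreover have "neg (neg l) = l" for l :: "bool \<times> 'a" by (simp add: neg_def)
    then have "neg l' \<in> set (concat F) \<or> neg (neg l') \<in> set (concat F)" if "l' \<in> set (concat F)" for l'
      using that by simp
    ultimately show thesis using that(3-5) unfolding set_append set_map by blast
  qed (use that in blast)+
qed

lemma node_index:
  "l \<in> set (concat F) \<Longrightarrow> \<exists>i<length (nodes F). nodes F ! i = (2, [l])"
  "l \<in> set (concat F) \<or> neg l \<in> set (concat F) \<Longrightarrow> \<exists>i<length (nodes F). nodes F ! i = (3, [l])"
  "C \<in> set F \<Longrightarrow> \<exists>i<length (nodes F). nodes F ! i = (4, C)"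
proof -
  have neg: "neg (neg l) = l" for l :: "bool \<times> 'a" by (simp add: neg_def)
  have index: "\<exists>i<length (nodes F). nodes F ! i = a" if "a \<in> set (nodes F)" for a
    using that by (metis in_set_conv_nth)
  show "\<exists>i<length (nodes F). nodes F ! i = (2, [l])" if "l \<in> set (concat F)"
    using that by (intro index) (auto simp: nodes_def)
  show "\<exists>i<length (nodes F). nodes F ! i = (3, [l])" if "l \<in> set (concat F) \<or> neg l \<in> set (concat F)"
  proof (rule index)
    have "(3, [l]) = (\<lambda>l. (3, [neg l])) (neg l)" using neg[of l] by simp
    then show "(3, [l]) \<in> set (nodes F)" using that unfolding nodes_def by force
  qed
  show "\<exists>i<length (nodes F). nodes F ! i = (4, C)" if "C \<in> set F"
    using that by (intro index) (auto simp: nodes_def)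
qed

text \<open>Every vertex is within two edges of the hub; a clause is reached through one of its
  literals, which is where nonemptiness enters. The same literal provides the static path of length
  3 for the bound 3.\<close>

lemma valid_sat_instance:
  assumes "\<And>C. C \<in> set F \<Longrightarrow> C \<noteq> []"
  shows "valid_instance (sat_instance F)"
proof -
  let ?n = "length (nodes F)" and ?E = "edges (sat_instance F)"
  let ?path = "static_path {..<?n} ?E"
  have irrefl: "\<not> adjacent a a" for a :: "'a node" by (auto simp: adjacent_def below_def)
  have "simple_graph {..<?n} ?E"
    by (auto simp: simple_graph_def sat_instance_def) (metis irrefl)
  moreover have "connected_graph {..<?n} ?E"
    unfolding connected_graph_def
  proof (intro conjI ballI)
    fix u v assume uv: "u \<in> {..<?n}" "v \<in> {..<?n}"
    have extend: "\<exists>xs. ?path a v xs" if "\<exists>xs. ?path b v xs" "{a, b} \<in> ?E" for a b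
    proof -
      from that(1) obtain xs where "?path b v xs" by blast
      from static_path_extend[OF this that(2)] that(2) show ?thesis by (simp add: edge_iff)
    qed
    have clause: "\<exists>i. {0, i} \<in> ?E \<and> {i, w} \<in> ?E" if w: "w < ?n" "nodes F ! w = (4, C)" "C \<in> set F" for w C
    proof -
      from assms[OF w(3)] obtain l where l: "l \<in> set C" by (cases C) auto
      with w(3) node_index(1)[of l F] obtain i where "i < ?n" "nodes F ! i = (2, [l])" by auto
      with w l show ?thesis by (intro exI[of _ i]) (auto simp: edge_iff adjacent_def below_def)
    qed
    have hub: "w = 0 \<or> {0, w} \<in> ?E \<or> (\<exists>i. {0, i} \<in> ?E \<and> {i, w} \<in> ?E)" if "w < ?n" for w
      using that
    proof (cases rule: nodes_cases)
      case (5 C)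
      then show ?thesis using clause that by blast
    qed (use that in \<open>auto simp: edge_iff adjacent_def below_def\<close>)
    have self: "\<exists>xs. ?path v v xs" using uv by (intro exI[of _ "[v]"]) (simp add: static_path_def)
    from hub[of v] uv(2) consider "v = 0" | "{0, v} \<in> ?E" | i where "{0, i} \<in> ?E" "{i, v} \<in> ?E"
      by auto
    then have from_hub: "\<exists>xs. ?path 0 v xs"
    proof cases
      case 1
      show ?thesis using self unfolding 1 .
    next
      case 2
      show ?thesis by (rule extend[OF self 2])
    next
      case (3 i)
      show ?thesis by (rule extend[OF extend[OF self 3(2)] 3(1)])
    qed
    have up: "\<exists>xs. ?path w v xs" if w: "w < ?n" for w
    proof -
      from hub[OF w] consider "w = 0" | "{w, 0} \<in> ?E" | i where "{i, 0} \<in> ?E" "{w, i} \<in> ?E"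
        by (auto simp: insert_commute)
      then show ?thesis
      proof cases
        case 1
        show ?thesis using from_hub unfolding 1 .
      next
        case 2
        show ?thesis by (rule extend[OF from_hub 2])
      next
        case (3 i)
        show ?thesis by (rule extend[OF extend[OF from_hub 3(1)] 3(2)])
      qed
    qed
    from up uv(1) show "\<exists>xs. ?path u v xs" by blast
  qed (use nodes_0_1(4) in blast)
  moreover have "1 \<le> limit (nodes F ! u) (nodes F ! v) \<and> static_dist {..<?n} ?E u v \<le>
      limit (nodes F ! u) (nodes F ! v)"
    if "u < ?n" "v < ?n" "u \<noteq> v" for u v
  proof -
    show ?thesis
    proof (cases "nodes F ! u" "nodes F ! v" rule: limit_cases)
      case 1
      from that(1) 1(1) have u: "u = 1" by (cases rule: nodes_cases) auto
      from that(2) 1(2) obtain C where C: "C \<in> set F" "nodes F ! v = (4, C)"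
          by (cases rule: nodes_cases) auto
      with assms obtain l where l: "l \<in> set C" by (cases C) auto
      with C node_index(1)[of l F] obtain i where i: "i < ?n" "nodes F ! i = (2, [l])" by auto
      have "?path u v [u, 0, i, v]"
        using u C l i that nodes_tag[of F i] nodes_tag[of F v]
            by (auto simp: static_path_def edge_iff adjacent_def below_def)
      from static_dist_le[OF this] u C show ?thesis
          by (simp add: limit_def numeral_eq_enat one_enat_def eval_nat_numeral)
    next
      case 2
      have "?path u v [u, 0, v]"
        using 2 that nodes_tag(1)[of F u] nodes_tag(1)[of F v]
            by (auto simp: static_path_def edge_iff adjacent_def below_def)
      from static_dist_le[OF this] 2(4) show ?thesis
          by (simp add: numeral_eq_enat one_enat_def eval_nat_numeral)
    qed simp
  qed
  ultimately show ?thesis unfolding valid_instance_def by simp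
qed


section \<open>Correctness of the reduction\<close>

lemma hub_edge: "{0, i} \<in> edges (sat_instance F) \<longleftrightarrow> i < length (nodes F) \<and> 1 \<le> fst (nodes F ! i) \<and>
    fst (nodes F ! i) \<le> 3"
  by (auto simp: edge_iff adjacent_def below_def)

lemma leaf_edge:
  assumes "fst (nodes F ! i) = 1 \<or> fst (nodes F ! i) = 3"
  shows "{i, j} \<in> edges (sat_instance F) \<Longrightarrow> j = 0"
proof -
  assume ij: "{i, j} \<in> edges (sat_instance F)"
  then have "j < length (nodes F)" "fst (nodes F ! j) = 0"
    using assms by (auto simp: edge_iff adjacent_def below_def)
  then show "j = 0" by (cases rule: nodes_cases) auto
qed

text \<open>With period two a label fixes the parity of the times at which its edge is
  active.\<close>

lemma active_Suc: "active 2 lab e t \<Longrightarrow> active 2 lab e' (Suc t) \<Longrightarrow> lab e \<noteq> lab e'"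
  unfolding active_def by (metis Suc_double_not_eq_double add_Suc add_diff_cancel_left' add_left_imp_eq
      even_Suc even_add even_mult_iff even_numeral)

text \<open>A leaf can only be left through the hub, so a path to a vertex other than the hub has at
  least two edges, and three if the target is not adjacent to the hub. As times increase strictly,
  the durations 2 and 3 leave no room for waiting.\<close>

lemma alternating_from_leaf:
  assumes P: "temporal_path (edges (sat_instance F)) 2 lab u v P"
      and u: "fst (nodes F ! u) = 1 \<or> fst (nodes F ! u) = 3"
    and v: "v \<noteq> 0"
  shows "duration P \<le> 2 \<Longrightarrow> lab {u, 0} \<noteq> lab {0, v}"
    and "duration P \<le> 3 \<Longrightarrow> {0, v} \<notin> edges (sat_instance F) \<Longrightarrow>
      \<exists>w. {0, w} \<in> edges (sat_instance F) \<and> {w, v} \<in> edges (sat_instance F) \<and> lab {u, 0} \<noteq> lab {0, w}"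
proof -
  let ?E = "edges (sat_instance F)"
  note P' = P[unfolded temporal_path_def]
  from P' obtain w t Q where Q: "P = (u, w, t) # Q" by (cases P) auto
  with P' have "{u, w} \<in> ?E" by simp
  with leaf_edge[OF u] have w: "w = 0" by blast
  with P' Q v have "Q \<noteq> []" by auto
  then obtain w' t' R where R: "Q = (0, w', t') # R" using P' Q w by (cases Q) auto
  have t: "t < t'" "{0, w'} \<in> ?E" "active 2 lab {u, 0} t" "active 2 lab {0, w'} t'"
    using P' Q R w by auto
  have le: "t' + length R \<le> snd (snd (last P))"
    using length_le_last_time[of Q] P' Q R by (simp add: successively_Cons)
  have dur: "duration P = snd (snd (last P)) + 1 - t" using Q by (simp add: duration_def)
  show "lab {u, 0} \<noteq> lab {0, v}" if "duration P \<le> 2"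
  proof -
    have "t' = Suc t" "R = []" using that le dur t(1) by (cases R; simp)+
    then show ?thesis using P' Q R t active_Suc by auto
  qed
  show "\<exists>w. {0, w} \<in> ?E \<and> {w, v} \<in> ?E \<and> lab {u, 0} \<noteq> lab {0, w}" if "duration P \<le> 3" "{0, v} \<notin> ?E"
  proof -
    have "R \<noteq> []" using that(2) t(2) P' Q R by auto
    then obtain a w'' t'' S where S: "R = (a, w'', t'') # S" by (cases R) auto
    then have "a = w'" "{w', w''} \<in> ?E" "t' < t''" using P' Q R by auto
    moreover have "S = []" "t' = Suc t" using that(1) le dur t(1) S by (cases S; simp)+
    ultimately show ?thesis using P' Q R S t active_Suc by (intro exI[of _ w']) auto
  qed
qed

text \<open>A variable is true if the leaf of its positive literal and the truth leaf have different
  labels at the hub. The bounds 2 transfer this to the literal vertices, the bounds 3 to the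
  clauses.\<close>

lemma solvable_imp_satisfiable:
  assumes "tgr_solvable (sat_instance F)"
  shows "satisfiable F"
proof -
  let ?n = "length (nodes F)" and ?E = "edges (sat_instance F)"
  from assms obtain lab where lab: "\<And>e. e \<in> ?E \<Longrightarrow> lab e < 2" and
    fast: "\<And>u v. u < ?n \<Longrightarrow> v < ?n \<Longrightarrow> u \<noteq> v \<Longrightarrow>
      fastest_duration ?E 2 lab u v \<le> limit (nodes F ! u) (nodes F ! v)"
    unfolding tgr_solvable_def periodic_labeling_def by auto
  define g where "g i = lab {0, i}" for i
  have g: "g i < 2" if "i < ?n" "1 \<le> fst (nodes F ! i)" "fst (nodes F ! i) \<le> 3" for i
    unfolding g_def using lab hub_edge that by blast
  have differ: "g i \<noteq> g j" if "i < ?n" "j < ?n" "nodes F ! i = (3, [l])"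
    "nodes F ! j = (2, [neg l]) \<or> nodes F ! j = (3, [neg l])" for i j l
  proof -
    have "j \<noteq> 0" using that(4) nodes_tag(1)[of F j] by auto
    have "i \<noteq> j" using that(3,4) by (auto simp: neg_def prod_eq_iff)
    have "limit (nodes F ! i) (nodes F ! j) = enat 2" using that by (auto simp: limit_def numeral_eq_enat)
    with fast[OF that(1,2) \<open>i \<noteq> j\<close>] obtain P where "temporal_path ?E 2 lab i j P" "duration P \<le> 2"
      by (auto simp: fastest_duration_le_iff)
    from alternating_from_leaf(1)[OF this(1) _ \<open>j \<noteq> 0\<close> this(2)] that(3) show ?thesis
      by (simp add: g_def insert_commute)
  qed
  define \<alpha> where "\<alpha> v \<longleftrightarrow> (\<exists>i<?n. nodes F ! i = (3, [(True, v)]) \<and> g i \<noteq> g 1)" for v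
  \<comment> \<open>Only two labels exist. A positive literal vertex and its leaf both differ from
    the leaf of the negation, hence agree. A negative literal vertex differs from the leaf of the
    positive literal; if both also differed from the truth leaf, there would be three
    labels.\<close>
  have holds: "\<alpha> (snd l) = fst l" if i: "i < ?n" "nodes F ! i = (2, [l])" "g i \<noteq> g 1" for i l
  proof (cases "fst l")
    case True
    have l: "l \<in> set (concat F)" using i(1) by (cases rule: nodes_cases) (use i(2) in auto)
    obtain j where j: "j < ?n" "nodes F ! j = (3, [neg l])"
      using node_index(2)[of "neg l" F] l by (auto simp: neg_def)
    obtain k where k: "k < ?n" "nodes F ! k = (3, [l])" using node_index(2)[of l F] l by auto
    have "neg (neg l) = l" by (simp add: neg_def)
    with differ[OF j(1) i(1) j(2)] differ[OF j(1) k(1) j(2)] i(2) k(2) have "g j \<noteq> g i" "g j \<noteq> g k"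
        by simp_all
    with g[of i] g[of j] g[of k] i j k have "g k = g i" by simp
    with i(3) k True have "\<alpha> (snd l)" unfolding \<alpha>_def by (intro exI[of _ k]) (simp add: prod_eq_iff)
    with True show ?thesis by simp
  next
    case False
    have "\<not> \<alpha> (snd l)"
    proof
      assume "\<alpha> (snd l)"
      then obtain k where k: "k < ?n" "nodes F ! k = (3, [(True, snd l)])" "g k \<noteq> g 1"
          unfolding \<alpha>_def by blast
      have "neg (True, snd l) = l" using False by (simp add: neg_def prod_eq_iff)
      with differ[OF k(1) i(1) k(2)] i(2) have "g k \<noteq> g i" by simp
      with g[of i] g[of k] g[of 1] i k show False by simp
    qed
    with False show ?thesis by simp
  qed
  have "\<exists>(b, v)\<in>set C. \<alpha> v = b" if C: "C \<in> set F" for C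
  proof -
    obtain v where v: "v < ?n" "nodes F ! v = (4, C)" using node_index(3)[OF C] by blast
    have "limit (nodes F ! 1) (nodes F ! v) = enat 3" using v by (simp add: limit_def numeral_eq_enat)
    moreover have "v \<noteq> 1" "v \<noteq> 0" using v nodes_tag[of F v] by auto
    ultimately obtain P where P: "temporal_path ?E 2 lab 1 v P" "duration P \<le> 3"
      using fast[of 1 v] v(1) by (auto simp: fastest_duration_le_iff)
    have "{0, v} \<notin> ?E" using v by (simp add: hub_edge)
    with alternating_from_leaf(2)[OF P(1) _ \<open>v \<noteq> 0\<close> P(2)] obtain w where
      w: "{0, w} \<in> ?E" "{w, v} \<in> ?E" "lab {1, 0} \<noteq> lab {0, w}" by auto
    then have "w < ?n" "fst (nodes F ! w) = 2"
        using v by (auto simp: hub_edge edge_iff adjacent_def below_def)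
    then obtain l where l: "nodes F ! w = (2, [l])" by (cases rule: nodes_cases) auto
    with w(2) v have "l \<in> set C" by (auto simp: edge_iff adjacent_def below_def)
    moreover have "\<alpha> (snd l) = fst l"
      using holds[OF \<open>w < ?n\<close> l] w(3) by (simp add: g_def insert_commute)
    ultimately show ?thesis by (intro bexI[of _ l]) (simp_all add: case_prod_beta)
  qed
  then show ?thesis unfolding satisfiable_def by blast
qed

text \<open>Hub edges of true literals and of their leaves get label 1; everything else, including
  the truth leaf and the edges to clauses, gets 0. A clause is then reached from the truth leaf at
  times 0, 1 and 2, where time 2 repeats the label 0.\<close>

lemma satisfiable_imp_solvable:
  assumes "satisfiable F"
  shows "tgr_solvable (sat_instance F)"
proof -
  let ?n = "length (nodes F)" and ?E = "edges (sat_instance F)"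
  from assms obtain \<alpha> where \<alpha>: "\<And>C. C \<in> set F \<Longrightarrow> \<exists>l\<in>set C. \<alpha> (snd l) = fst l"
    unfolding satisfiable_def by (force simp: case_prod_beta)
  define one where "one a \<longleftrightarrow> (fst a = 2 \<or> fst a = 3) \<and> \<alpha> (snd (hd (snd a))) = fst (hd (snd a))"
    for a :: "'a node"
  define lab :: "nat set \<Rightarrow> nat" where "lab e = (if \<exists>i. e = {0, i} \<and> one (nodes F ! i) then 1 else 0)" for e
  have not_one: "\<not> one (nodes F ! 0)" by (simp add: one_def)
  then have lab_hub: "lab {0, i} = (if one (nodes F ! i) then 1 else 0)"
      "lab {i, 0} = (if one (nodes F ! i) then 1 else 0)" for i
    by (auto simp: lab_def doubleton_eq_iff)
  have lab_other: "lab {i, j} = 0" if "i \<noteq> 0" "j \<noteq> 0" for i j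
    using that by (auto simp: lab_def doubleton_eq_iff)
  have active: "active 2 lab e t" if "lab e = t \<or> lab e + 2 = t" for e t
    using that unfolding active_def by (auto intro: exI[of _ 0] exI[of _ 1])
  have "fastest_duration ?E 2 lab u v \<le> limit (nodes F ! u) (nodes F ! v)" if "u < ?n" "v < ?n" "u \<noteq> v"
      for u v
  proof -
    show ?thesis
    proof (cases "nodes F ! u" "nodes F ! v" rule: limit_cases)
      case 1
      from that(1) 1(1) have u: "u = 1" by (cases rule: nodes_cases) auto
      from that(2) 1(2) obtain C where C: "C \<in> set F" "nodes F ! v = (4, C)"
          by (cases rule: nodes_cases) auto
      with \<alpha> obtain l where l: "l \<in> set C" "\<alpha> (snd l) = fst l" by blast
      with C node_index(1)[of l F] obtain i where i: "i < ?n" "nodes F ! i = (2, [l])" by auto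
      have "i \<noteq> 0" "i \<noteq> 1" "v \<noteq> 0" "v \<noteq> 1" "i \<noteq> v" using i C nodes_tag[of F i] nodes_tag[of F v] by auto
      then have "temporal_path ?E 2 lab u v [(u, 0, 0), (0, i, 1), (i, v, 2)]"
        using u C l i that by (auto simp: temporal_path_def edge_iff adjacent_def below_def lab_hub
            lab_other one_def intro!: active)
      moreover have "duration [(u, 0, 0), (0, i, 1), (i, v, 2)] \<le> 3" by (simp add: duration_def)
      ultimately show ?thesis using 1(3) fastest_duration_le_iff[of ?E 2 lab u v 3]
          by (auto simp: numeral_eq_enat)
    next
      case 2
      from that(1) 2(1) obtain l where l: "nodes F ! u = (3, [l])" by (cases rule: nodes_cases) auto
      \<comment> \<open>The two labels differ: if \<open>t\<close> is 0, the second edge is crossed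
        at its label 1; if \<open>t\<close> is 1, it is crossed at time 2, one period after its
        label 0.\<close>
      define t where "t = lab {u, 0}"
      have "u \<noteq> 0" "v \<noteq> 0" using l 2(2) nodes_tag(1)[of F] by auto
      have "one (nodes F ! u) \<longleftrightarrow> \<not> one (nodes F ! v)"
        using 2(2,3) l by (auto simp: one_def neg_def)
      then have "lab {u, 0} = t" "lab {0, v} = t + 1 \<or> lab {0, v} + 2 = t + 1"
        by (auto simp: t_def lab_hub)
      with \<open>u \<noteq> 0\<close> \<open>v \<noteq> 0\<close> have "temporal_path ?E 2 lab u v [(u, 0, t), (0, v, t + 1)]"
        using l 2(2) that by (auto simp: temporal_path_def edge_iff adjacent_def below_def intro!: active)
      moreover have "duration [(u, 0, t), (0, v, t + 1)] \<le> 2" by (simp add: duration_def)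
      ultimately show ?thesis using 2(4) fastest_duration_le_iff[of ?E 2 lab u v 2]
          by (auto simp: numeral_eq_enat)
    qed simp
  qed
  moreover have "periodic_labeling ?E 2 lab" by (simp add: periodic_labeling_def lab_def)
  ultimately show ?thesis unfolding tgr_solvable_def by auto
qed

theorem NP_hard_TGR: "NP_hard TGR" "NP_hard (TGR_with_period 2)"
proof -
  have "poly_reducible L TGR \<and> poly_reducible L (TGR_with_period 2)" if "L \<in> NP" for L
  proof -
    from cook_levin[OF that] obtain f :: "bool list \<Rightarrow> (bool \<times> var) list list" where
      f: "poly_time f" "\<And>x C. C \<in> set (f x) \<Longrightarrow> C \<noteq> []" "\<And>x. x \<in> L \<longleftrightarrow> satisfiable (f x)" by blast
    let ?I = "\<lambda>x. sat_instance (f x)"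
    have valid: "valid_instance (?I x)" for x using valid_sat_instance f(2) by blast
    have solvable: "x \<in> L \<longleftrightarrow> tgr_solvable (?I x)" for x
      using f(3) solvable_imp_satisfiable satisfiable_imp_solvable by blast
    have "x \<in> L \<longleftrightarrow> encode_instance (?I x) \<in> TGR" for x
      using valid solvable encode_instance_inject(2) unfolding TGR_def by blast
    moreover have "x \<in> L \<longleftrightarrow> encode_instance (?I x) \<in> TGR_with_period 2" for x
      using valid[of x] solvable[of x] encode_instance_inject(2)[OF valid[of x]]
          sat_instance_simps(2)[of "f x"]
      unfolding TGR_with_period_def by blast
    ultimately show ?thesis using poly_reducibleI[OF poly_time_comp[OF f(1) ptime_sat_instance]] by blast
  qed
  then show "NP_hard TGR" "NP_hard (TGR_with_period 2)" unfolding NP_hard_def by blast+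
qed

section \<open>Binary arithmetic in polynomial time\<close>

lemma num_append: "num (xs @ ys) = num xs + 2 ^ length xs * num ys"
  by (induction xs) (auto simp: algebra_simps)

lemma num_less: "num bs < 2 ^ length bs"
  by (induction bs) (auto simp: of_bool_def)

lemma length_binary: "m < 2 ^ k \<Longrightarrow> length (binary m) \<le> k"
proof (induction m arbitrary: k rule: binary.induct)
  case (1 m)
  show ?case
  proof (cases "m = 0")
    case False
    with 1(2) obtain j where k: "k = Suc j" by (cases k) auto
    with 1 False have "length (binary (m div 2)) \<le> j" by (intro 1(1)) auto
    then show ?thesis using False k by (subst binary.simps) simp
  qed (subst binary.simps, simp)
qed

text \<open>The last bit is the most significant one, so this excludes leading zeros. It singles out
  the bit lists that \<open>binary\<close> produces.\<close>

definition canonical :: "bool list \<Rightarrow> bool" where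
  "canonical bs \<longleftrightarrow> (case rev bs of [] \<Rightarrow> True | b # cs \<Rightarrow> b)"

lemma binary_num:
  assumes "canonical bs"
  shows "binary (num bs) = bs"
  using assms
proof (induction bs)
  case Nil
  then show ?case by (subst binary.simps) simp
next
  case (Cons b bs)
  have "canonical bs" using Cons.prems by (auto simp: canonical_def split: list.splits)
  with Cons.IH have IH: "binary (num bs) = bs" by blast
  have "num (b # bs) \<noteq> 0"
  proof
    assume "num (b # bs) = 0"
    then have "num bs = 0" "\<not> b" by auto
    with IH have "bs = []" by (subst (asm) binary.simps) simp
    with \<open>\<not> b\<close> Cons.prems show False by (simp add: canonical_def)
  qed
  then show ?case using IH by (subst binary.simps) auto
qed

lemma canonical_binary: "canonical (binary n)"
proof (induction n rule: binary.induct)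
  case (1 n)
  show ?case
  proof (cases "n = 0")
    case False
    then have eq: "binary n = odd n # binary (n div 2)" by (subst binary.simps) simp
    show ?thesis
    proof (cases "n div 2 = 0")
      case True
      then have "binary n = [True]" using False eq
          by (subst (asm) binary.simps[of "n div 2"]) (auto simp: div_eq_0_iff less_2_cases_iff)
      then show ?thesis by (simp add: canonical_def)
    next
      case nz: False
      then have "binary (n div 2) \<noteq> []" by (subst binary.simps) simp
      with 1 False show ?thesis unfolding eq by (auto simp: canonical_def split: list.splits)
    qed
  qed (subst binary.simps, simp add: canonical_def)
qed

text \<open>The zeros are added at the significant end, one for each bit of \<open>bs\<close>; a
  fold over the padded list is long enough to use up \<open>bs\<close> too.\<close>

definition pad :: "bool list \<Rightarrow> bool list \<Rightarrow> bool list" where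
  "pad as bs = as @ map (\<lambda>b. False) bs"

lemma num_pad [simp]: "num (pad as bs) = num as"
proof -
  have "num (map (\<lambda>b. False) bs) = 0" by (induction bs) auto
  then show ?thesis by (simp add: pad_def num_append)
qed

lemma length_pad [simp]: "length (pad as bs) = length as + length bs"
  by (simp add: pad_def)

definition head_bit :: "bool list \<Rightarrow> bool" where
  "head_bit bs = (case bs of [] \<Rightarrow> False | b # cs \<Rightarrow> b)"

lemma num_head_bit: "num bs = of_bool (head_bit bs) + 2 * num (tl bs)"
  by (cases bs) (simp_all add: head_bit_def)

text \<open>One stage of a ripple-carry adder, with the carry, the rest of the second summand and
  the finished bits in reverse. The new carry is a majority, and the iterated equality is the parity
  of three bits.\<close>

definition add_step :: "bool \<times> bool list \<times> bool list \<Rightarrow> bool \<Rightarrow> bool \<times> bool list \<times> bool list" where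
  "add_step s a = (if a then fst s \<or> head_bit (fst (snd s)) else fst s \<and> head_bit (fst (snd s)),
     tl (fst (snd s)), ((a = head_bit (fst (snd s))) = fst s) # snd (snd s))"

definition add :: "bool list \<Rightarrow> bool list \<Rightarrow> bool list" where
  "add as bs = (case foldl add_step (False, bs, []) (pad as bs) of (c, r, out) \<Rightarrow> rev (c # out))"

lemma foldl_add_step:
  "length bs \<le> length as \<Longrightarrow> foldl add_step (c, bs, out) as = (c', r, out') \<Longrightarrow>
    num (rev (c' # out')) = num (rev out) + 2 ^ length out * (num as + num bs + of_bool c) \<and>
    length out' = length out + length as"
proof (induction as arbitrary: c bs out)
  case Nil
  then show ?case by (simp add: num_append)
next
  case (Cons a as)
  let ?h = "head_bit bs"
  obtain d where step: "add_step (c, bs, out) a = (d, tl bs, ((a = ?h) = c) # out)"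
    and d: "of_bool ((a = ?h) = c) + 2 * of_bool d = of_bool a + of_bool ?h + (of_bool c :: nat)"
    by (cases a; cases "?h"; cases c; simp add: add_step_def)
  have "length (tl bs) \<le> length as" using Cons.prems(1) by simp
  from Cons.IH[OF this] Cons.prems(2) step have
    "num (rev (c' # out')) = num (rev (((a = ?h) = c) # out)) + 2 ^ Suc (length out) *
        (num as + num (tl bs) + of_bool d)"
    "length out' = Suc (length out) + length as"
    by simp_all
  moreover have "num (rev (((a = ?h) = c) # out)) + 2 ^ Suc (length out) *
      (num as + num (tl bs) + of_bool d) =
      num (rev out) + 2 ^ length out * (of_bool ((a = ?h) = c) + 2 * of_bool d + 2 * num as + 2 * num
          (tl bs))"
    by (simp add: num_append algebra_simps)
  ultimately show ?case unfolding d num_head_bit[of bs] by (simp add: algebra_simps)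
qed

lemma num_add [simp]: "num (add as bs) = num as + num bs"
  and length_add: "length (add as bs) = length as + length bs + 1"
proof -
  obtain c r out where eq: "foldl add_step (False, bs, []) (pad as bs) = (c, r, out)" by (rule prod_cases3)
  from foldl_add_step[OF _ eq] show "num (add as bs) = num as + num bs"
      "length (add as bs) = length as + length bs + 1"
    unfolding add_def eq by simp_all
qed

text \<open>Comparison from the least significant bit: a later difference overrides the verdict so
  far.\<close>

definition less_step :: "bool \<times> bool list \<Rightarrow> bool \<Rightarrow> bool \<times> bool list" where
  "less_step s a = (if a = head_bit (snd s) then fst s else head_bit (snd s), tl (snd s))"

definition num_lt :: "bool list \<Rightarrow> bool list \<Rightarrow> bool" where
  "num_lt as bs = fst (foldl less_step (False, bs) (pad as bs))"

lemma num_lt [simp]: "num_lt as bs \<longleftrightarrow> num as < num bs"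
proof -
  have "fst (foldl less_step (lt, bs) as) \<longleftrightarrow> num as < num bs \<or> num as = num bs \<and> lt"
    if "length bs \<le> length as" for lt and as bs
    using that
  proof (induction as arbitrary: lt bs)
    case (Cons a as)
    then have "length (tl bs) \<le> length as" by simp
    moreover have "less_step (lt, bs) a = (if a = head_bit bs then lt else head_bit bs, tl bs)"
      by (simp add: less_step_def)
    ultimately have "fst (foldl less_step (lt, bs) (a # as)) \<longleftrightarrow>
        num as < num (tl bs) \<or> num as = num (tl bs) \<and> (if a = head_bit bs then lt else head_bit bs)"
      using Cons.IH by simp
    also have "\<dots> \<longleftrightarrow> num (a # as) < num bs \<or> num (a # as) = num bs \<and> lt"
      using num_head_bit[of bs] by (cases a; cases "head_bit bs") (simp_all, linarith+)
    finally show ?case .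
  qed simp
  from this[of bs "pad as bs" False] show ?thesis by (simp add: num_lt_def)
qed

lemma ptime_head_bit [ptime]: "poly_time f \<Longrightarrow> poly_time (\<lambda>x. head_bit (f x))"
  unfolding head_bit_def by (intro ptime)

lemma tsize_tl: "tsize (tl xs) \<le> tsize xs"
  by (cases xs) auto

lemma ptime_pad [ptime]: "poly_time f \<Longrightarrow> poly_time g \<Longrightarrow> poly_time (\<lambda>x. pad (f x) (g x))"
  unfolding pad_def by (intro ptime)

lemma ptime_add [ptime]:
  assumes "poly_time f" "poly_time g"
  shows "poly_time (\<lambda>x. add (f x) (g x))"
proof -
  have "poly_time (\<lambda>x. foldl add_step (False, g x, []) (pad (f x) (g x)))"
  proof (rule poly_time_foldl_additive[where q = "[:10:]"])
    show "poly_time (\<lambda>z. add_step (fst (snd z)) (snd (snd z)))" unfolding add_step_def by (intro ptime)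
    show "tsize (add_step u e) \<le> tsize u + poly [:10:] (tsize c + tsize e)" for c :: 'a and u e
      using tsize_tl[of "fst (snd u)"] by (auto simp: add_step_def)
  qed (intro ptime assms)+
  then show ?thesis unfolding add_def by (intro ptime)
qed

lemma ptime_num_lt [ptime]:
  assumes "poly_time f" "poly_time g"
  shows "poly_time (\<lambda>x. num_lt (f x) (g x))"
proof -
  have "poly_time (\<lambda>x. foldl less_step (False, g x) (pad (f x) (g x)))"
  proof (rule poly_time_foldl_additive[where q = "[:10:]"])
    show "poly_time (\<lambda>z. less_step (fst (snd z)) (snd (snd z)))" unfolding less_step_def by (intro ptime)
    show "tsize (less_step u e) \<le> tsize u + poly [:10:] (tsize c + tsize e)" for c :: 'a and u e
      using tsize_tl[of "snd u"] by (auto simp: less_step_def)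
  qed (intro ptime assms)+
  then show ?thesis unfolding num_lt_def by (intro ptime)
qed

text \<open>Parts of a certificate may be too short, so access has a default value.\<close>

definition entry :: "'a \<Rightarrow> 'a list \<Rightarrow> nat \<Rightarrow> 'a" where
  "entry d xs i = (case drop i xs of [] \<Rightarrow> d | x # ys \<Rightarrow> x)"

lemma entry_eq: "entry d xs i = (if i < length xs then xs ! i else d)"
proof (cases "i < length xs")
  case True
  then have "drop i xs = xs ! i # drop (Suc i) xs" by (simp add: Cons_nth_drop_Suc)
  then show ?thesis using True by (simp add: entry_def)
qed (simp add: entry_def)

lemma ptime_entry [ptime]: "poly_time f \<Longrightarrow> poly_time g \<Longrightarrow> poly_time h \<Longrightarrow>
    poly_time (\<lambda>x. entry (f x) (g x) (h x))"
  unfolding entry_def by (intro ptime)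

section \<open>Earliest schedules\<close>

text \<open>
  A walk has just crossed an edge with label \<open>k\<close> into \<open>w\<close> at time \<open>T + k\<close>, where \<open>T\<close> is a
  multiple of the period.
\<close>

primrec finish :: "(nat \<Rightarrow> nat \<Rightarrow> nat) \<Rightarrow> nat \<Rightarrow> nat \<Rightarrow> nat \<Rightarrow> nat \<Rightarrow> nat list \<Rightarrow> nat" where
  "finish l \<Delta> w k T [] = T + k"
| "finish l \<Delta> w k T (v # vs) = finish l \<Delta> v (l w v) (if k < l w v then T else T + \<Delta>) vs"

primrec schedule :: "(nat \<Rightarrow> nat \<Rightarrow> nat) \<Rightarrow> nat \<Rightarrow> nat \<Rightarrow> nat \<Rightarrow> nat \<Rightarrow> nat list \<Rightarrow> (nat \<times> nat \<times> nat) list" where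
  "schedule l \<Delta> w k T [] = []"
| "schedule l \<Delta> w k T (v # vs) =
    (w, v, (if k < l w v then T else T + \<Delta>) + l w v) # schedule l \<Delta> v (l w v)
        (if k < l w v then T else T + \<Delta>) vs"

abbreviation consecutive :: "(nat \<times> nat \<times> nat) list \<Rightarrow> bool" where
  "consecutive \<equiv> successively (\<lambda>(u, v, t) (u', v', t'). v = u' \<and> t < t')"

text \<open>An edge is still available in the current period iff its label exceeds \<open>k\<close>;
  at equality the walk waits for the next period, since times increase strictly. \<open>Q\<close>
  will be adjacency.\<close>

lemma schedule:
  assumes "\<Delta> dvd T" "k < \<Delta>" "successively (\<lambda>u v. Q u v \<and> l u v < \<Delta>) (w # vs)"
  shows "consecutive ((u, w, T + k) # schedule l \<Delta> w k T vs) \<and>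
    map (\<lambda>(u, v, t). v) (schedule l \<Delta> w k T vs) = vs \<and>
    snd (last ((u, w, T + k) # schedule l \<Delta> w k T vs)) = (last (w # vs), finish l \<Delta> w k T vs) \<and>
    (\<forall>(a, b, t)\<in>set (schedule l \<Delta> w k T vs). Q a b \<and> (\<exists>i. t = l a b + i * \<Delta>))"
  using assms
proof (induction vs arbitrary: u w k T)
  case (Cons v vs)
  let ?T = "if k < l w v then T else T + \<Delta>"
  have "\<Delta> dvd ?T" "l w v < \<Delta>" "Q w v" "successively (\<lambda>u v. Q u v \<and> l u v < \<Delta>) (v # vs)"
    using Cons.prems by auto
  note IH = Cons.IH[OF this(1,2,4), of w]
  have "T + k < ?T + l w v" using Cons.prems(2) by auto
  moreover obtain i where "?T = i * \<Delta>" using \<open>\<Delta> dvd ?T\<close> by (metis dvd_def mult.commute)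
  ultimately have "T + k < ?T + l w v" "\<exists>i. ?T + l w v = l w v + i * \<Delta>" by auto
  with IH \<open>Q w v\<close> show ?case unfolding schedule.simps finish.simps by (simp del: if_split)
qed simp

text \<open>Greedy stays ahead: the competing walk is in period \<open>j\<close>, the earliest
  schedule at least \<open>i\<close> periods before it, and this lead is never lost. The parameter
  \<open>i\<close> allows for competitors that start later than in the first period.\<close>

lemma finish_le:
  assumes "consecutive ((u, w, k + j * \<Delta>) # P)" "T + i * \<Delta> \<le> j * \<Delta>" "k < \<Delta>"
    "\<forall>(a, b, t)\<in>set P. l a b < \<Delta> \<and> (\<exists>i. t = l a b + i * \<Delta>)"
  shows "finish l \<Delta> w k T (map (\<lambda>(u, v, t). v) P) + i * \<Delta> \<le> snd (snd (last ((u, w, k + j * \<Delta>) # P)))"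
  using assms
proof (induction P arbitrary: u w k j T)
  case (Cons s P)
  obtain a v t where s: "s = (a, v, t)" by (rule prod_cases3)
  have "a = w" "k + j * \<Delta> < t" using Cons.prems(1) s by simp_all
  moreover have "l a v < \<Delta>" "\<exists>m. t = l a v + m * \<Delta>" using Cons.prems(4) unfolding s by simp_all
  ultimately obtain m where m: "t = l w v + m * \<Delta>" "a = w" "l w v < \<Delta>" "k + j * \<Delta> < l w v + m * \<Delta>"
    by blast
  have "j \<le> m"
  proof (rule ccontr)
    assume "\<not> j \<le> m"
    then have "Suc m * \<Delta> \<le> j * \<Delta>" by (intro mult_le_mono1) simp
    with m(3,4) show False by simp
  qed
  \<comment> \<open>When the schedule has to wait, the label does not exceed \<open>k\<close>, so
    the competitor has entered a later period as well.\<close>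
  have "(if k < l w v then T else T + \<Delta>) + i * \<Delta> \<le> m * \<Delta>"
  proof (cases "k < l w v")
    case True
    moreover have "j * \<Delta> \<le> m * \<Delta>" using \<open>j \<le> m\<close> by (rule mult_le_mono1)
    ultimately show ?thesis using Cons.prems(2) by (simp only: if_True)
  next
    case False
    with m(4) have "j \<noteq> m" by auto
    with \<open>j \<le> m\<close> have "Suc j * \<Delta> \<le> m * \<Delta>" by (intro mult_le_mono1) simp
    with False Cons.prems(2) show ?thesis by simp
  qed
  moreover have "consecutive ((w, v, l w v + m * \<Delta>) # P)" using Cons.prems(1) unfolding s m(1,2) by simp
  moreover have "\<forall>(a, b, t)\<in>set P. l a b < \<Delta> \<and> (\<exists>i. t = l a b + i * \<Delta>)" using Cons.prems(4) by simp
  ultimately show ?case using Cons.IH[of w v "l w v" m] m(3) unfolding s m(1,2) by simp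
qed simp


section \<open>Membership in NP\<close>

text \<open>
  A certificate consists of the adjacency matrix, the matrix of bounds, the period, the matrix of
  labels (of which only the part above the diagonal is used), and a path for every pair of vertices.
\<close>

type_synonym certificate =
  "bool list list \<times> bool list option list list \<times> bool list \<times> bool list list list \<times> nat list list list"

definition edge :: "bool list list \<Rightarrow> nat \<Rightarrow> nat \<Rightarrow> bool" where
  "edge A u v = entry False (entry [] A u) v"

definition label :: "bool list list list \<Rightarrow> nat \<Rightarrow> nat \<Rightarrow> bool list" where
  "label L u v = (if u < v then entry [] (entry [] L u) v else entry [] (entry [] L v) u)"

text \<open>The binary counterpart of \<open>finish\<close>: the state holds the vertex, the last
  label and the start of the current period.\<close>

definition travel :: "bool list list list \<times> bool list \<Rightarrow> nat \<times> bool list \<times> bool list \<Rightarrow> nat \<Rightarrow>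
    nat \<times> bool list \<times> bool list" where
  "travel c s v = (v, label (fst c) (fst s) v,
     if num_lt (fst (snd s)) (label (fst c) (fst s) v) then snd (snd s) else add (snd (snd s)) (snd c))"

definition arrival :: "nat \<times> bool list \<times> bool list \<Rightarrow> bool list" where
  "arrival s = add (snd (snd s)) (fst (snd s))"

text \<open>The walk starts at the label of its first edge in the period beginning at 0, the value
  of \<open>[]\<close>. Strict inequality accounts for the 1 in \<open>duration\<close>.\<close>

definition in_time :: "bool list list list \<Rightarrow> bool list \<Rightarrow> bool list option \<Rightarrow> nat list \<Rightarrow> bool" where
  "in_time L \<Delta> d ws = (case d of None \<Rightarrow> True | Some b \<Rightarrow> (case ws of [] \<Rightarrow> False | u # vs \<Rightarrow>
     (case vs of [] \<Rightarrow> False | v # us \<Rightarrow>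
       num_lt (arrival (foldl (travel (L, \<Delta>)) (v, label L u v, []) us)) (add b (label L u v)))))"

text \<open>A path is demanded for infinite bounds too; these paths certify that the graph is
  connected.\<close>

definition path_ok :: "bool list list \<Rightarrow> bool list option \<Rightarrow> bool list \<Rightarrow> bool list list list \<Rightarrow> nat \<Rightarrow> nat \<Rightarrow>
    nat list \<Rightarrow> bool" where
  "path_ok A d \<Delta> L u v ws \<longleftrightarrow> ws \<noteq> [] \<and> entry u ws 0 = u \<and> entry u ws (length ws - 1) = v \<and>
     (\<forall>i<length ws. \<forall>j<length ws. i \<noteq> j \<longrightarrow> entry 0 ws i \<noteq> entry 0 ws j) \<and> (\<forall>w\<in>set ws. w < length A) \<and>
     (\<forall>i<length ws. Suc i < length ws \<longrightarrow> edge A (entry 0 ws i) (entry 0 ws (Suc i))) \<and> in_time L \<Delta> d ws"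

text \<open>With canonical numbers the encoded parts are the code of an instance; a nonempty
  canonical list is a positive period.\<close>

definition instance_ok :: "bool list list \<Rightarrow> bool list option list list \<Rightarrow> bool list \<Rightarrow> bool" where
  "instance_ok A D \<Delta> \<longleftrightarrow> A \<noteq> [] \<and> length D = length A \<and> (\<forall>r\<in>set A. length r = length A) \<and>
     (\<forall>r\<in>set D. length r = length A) \<and> (\<forall>u<length A. \<forall>v<length A. edge A u v = edge A v u) \<and>
     (\<forall>u<length A. \<not> edge A u u) \<and> \<Delta> \<noteq> [] \<and> canonical \<Delta> \<and>
     (\<forall>r\<in>set D. \<forall>d\<in>set r. case d of None \<Rightarrow> True | Some b \<Rightarrow> canonical b)"

definition encode_parts :: "bool list list \<Rightarrow> bool list option list list \<Rightarrow> bool list \<Rightarrow> bool list" where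
  "encode_parts A D \<Delta> = encode_list (\<lambda>r. encode_list (\<lambda>b. [b]) r) A @
     encode_list (\<lambda>r. encode_list (\<lambda>d. case d of None \<Rightarrow> [False] | Some b \<Rightarrow>
         True # encode_list (\<lambda>b. [b]) b) r) D @
     encode_list (\<lambda>b. [b]) \<Delta>"

definition check :: "bool list \<Rightarrow> certificate \<Rightarrow> bool" where
  "check x y = (case y of (A, D, \<Delta>, L, P) \<Rightarrow> x = encode_parts A D \<Delta> \<and> instance_ok A D \<Delta> \<and>
     (\<forall>u<length A. \<forall>v<length A. edge A u v \<longrightarrow> num_lt (label L u v) \<Delta>) \<and>
     (\<forall>u<length A. \<forall>v<length A. u \<noteq> v \<longrightarrow>
        path_ok A (entry None (entry [] D u) v) \<Delta> L u v (entry [] (entry [] P u) v)))"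

definition period_of :: "certificate \<Rightarrow> bool list" where
  "period_of y = (case y of (A, D, \<Delta>, L, P) \<Rightarrow> \<Delta>)"

section \<open>Running time of the verifier\<close>

lemma tsize_entry: "tsize (entry d xs i) \<le> tsize d + tsize xs"
  using tsize_member[of "xs ! i" xs] by (simp add: entry_eq trans_le_add2)

lemma tsize_label: "tsize (label L u v) \<le> 2 + tsize L"
  using tsize_entry[of "[]" "entry [] L (min u v)" "max u v"] tsize_entry[of "[]" L "min u v"]
  by (auto simp: label_def min_def max_def split: if_splits)

lemma ptime_edge [ptime]: "poly_time f \<Longrightarrow> poly_time g \<Longrightarrow> poly_time h \<Longrightarrow> poly_time (\<lambda>x. edge (f x) (g x) (h x))"
  unfolding edge_def by (intro ptime)

lemma ptime_label [ptime]: "poly_time f \<Longrightarrow> poly_time g \<Longrightarrow> poly_time h \<Longrightarrow>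
    poly_time (\<lambda>x. label (f x) (g x) (h x))"
  unfolding label_def by (intro ptime)

text \<open>Vertex and label are replaced in each round, so they stay below the data they are taken
  from. Only the time accumulates, and an addition lengthens it by the period and a carry bit.
  Length is used because the size of a bit list also depends on its bits.\<close>

lemma foldl_travel_bounds:
  "tsize (fst (foldl (travel c) s vs)) \<le> tsize (fst s) + tsize vs"
  "tsize (fst (snd (foldl (travel c) s vs))) \<le> tsize (fst (snd s)) + 2 + tsize (fst c)"
  "length (snd (snd (foldl (travel c) s vs))) \<le> length (snd (snd s)) + length vs * (tsize (snd c) + 1)"
proof -
  have "fst (foldl (travel c) s vs) = fst s \<or> fst (foldl (travel c) s vs) \<in> set vs"
    by (induction vs rule: rev_induct) (auto simp: travel_def)
  then show "tsize (fst (foldl (travel c) s vs)) \<le> tsize (fst s) + tsize vs"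
    by (auto simp del: tsize_nat dest!: tsize_member)
  show "tsize (fst (snd (foldl (travel c) s vs))) \<le> tsize (fst (snd s)) + 2 + tsize (fst c)"
  proof (cases vs rule: rev_cases)
    case (snoc us v)
    then show ?thesis
      using tsize_label[of "fst c" "fst (foldl (travel c) s us)" v] by (simp add: travel_def)
  qed simp
  show "length (snd (snd (foldl (travel c) s vs))) \<le> length (snd (snd s)) + length vs * (tsize (snd c) + 1)"
    using length_le_tsize[of "snd c"]
    by (induction vs rule: rev_induct) (auto simp: travel_def length_add split: if_splits)
qed

lemma ptime_foldl_travel:
  "poly_time (\<lambda>x. foldl (travel (fst x)) (fst (snd x)) (snd (snd x)))"
proof (rule poly_time_foldl[where q = "[:20, 20, 20:]"])
  show "poly_time (\<lambda>z. travel (fst (fst z)) (fst (snd z)) (snd (snd z)))"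
    unfolding travel_def by (intro ptime)
  fix x :: "(bool list list list \<times> bool list) \<times> (nat \<times> bool list \<times> bool list) \<times> nat list" and k
  obtain c s vs where x: "x = (c, s, vs)" by (rule prod_cases3)
  let ?N = "tsize x" and ?r = "foldl (travel c) s (take k vs)"
  have "0 < tsize (drop k vs)" by simp
  then have take: "tsize (take k vs) \<le> tsize vs" "length (take k vs) \<le> tsize vs"
    using tsize_append[of "take k vs" "drop k vs"] length_le_tsize[of vs]
        by (simp_all del: length_greater_0_conv)
  have "length (take k vs) * (tsize (snd c) + 1) \<le> ?N * (?N + 1)"
    using take x by (intro mult_mono) auto
  moreover have "length (snd (snd s)) \<le> ?N" using tsize_bools(2)[of "snd (snd s)"] x by simp
  ultimately have "length (snd (snd ?r)) \<le> ?N + ?N * (?N + 1)"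
    using foldl_travel_bounds(3)[of c s "take k vs"] by linarith
  then have "tsize (snd (snd ?r)) \<le> 4 * (?N + ?N * (?N + 1)) + 1"
    using order_trans[OF tsize_bools(1) add_right_mono[OF mult_le_mono2]] by blast
  moreover have "tsize (fst ?r) \<le> 2 * ?N" "tsize (fst (snd ?r)) \<le> 2 * ?N + 2"
    using foldl_travel_bounds(1,2)[of c s "take k vs"] take(1) x by simp_all
  moreover have "tsize ?r = 2 + tsize (fst ?r) + tsize (fst (snd ?r)) + tsize (snd (snd ?r))" by simp
  ultimately have "tsize ?r \<le> 20 + ?N * 20 + ?N * (?N * 20)" by (simp only:) (simp add: algebra_simps)
  then show "tsize (foldl (travel (fst x)) (fst (snd x)) (take k (snd (snd x)))) \<le>
      poly [:20, 20, 20:] (tsize x)"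
    by (simp add: x algebra_simps)
qed (intro ptime)+

lemma ptime_foldl_travel':
  "poly_time a \<Longrightarrow> poly_time b \<Longrightarrow> poly_time c \<Longrightarrow> poly_time d \<Longrightarrow>
    poly_time (\<lambda>x. foldl (travel (a x, b x)) (c x) (d x))"
  using poly_time_comp[OF ptime_Pair[OF ptime_Pair[of a b] ptime_Pair[of c d]] ptime_foldl_travel] by simp

lemma ptime_in_time [ptime]:
  assumes "poly_time f" "poly_time g" "poly_time h" "poly_time k"
  shows "poly_time (\<lambda>x. in_time (f x) (g x) (h x) (k x))"
proof -
  have "poly_time (\<lambda>z. in_time (fst z) (fst (snd z)) (fst (snd (snd z))) (snd (snd (snd z))))"
    unfolding in_time_def arrival_def by (intro ptime ptime_foldl_travel')
  from poly_time_comp[OF _ this, of "\<lambda>x. (f x, g x, h x, k x)"] show ?thesis by (simp add: ptime assms)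
qed

lemma ptime_check: "poly_time (\<lambda>z. check (fst z) (snd z))"
  unfolding check_def encode_parts_def instance_ok_def path_ok_def canonical_def by (intro ptime)

lemma ptime_period_of [ptime]: "poly_time f \<Longrightarrow> poly_time (\<lambda>x. period_of (f x))"
  unfolding period_of_def by (intro ptime)


section \<open>Soundness of the verifier\<close>

definition parts_instance :: "bool list list \<Rightarrow> bool list option list list \<Rightarrow> bool list \<Rightarrow> tgr_instance" where
  "parts_instance A D \<Delta> = \<lparr>num_vertices = length A,
     edges = {{u, v} |u v. u < length A \<and> v < length A \<and> edge A u v},
     bound = (\<lambda>u v. case entry None (entry [] D u) v of None \<Rightarrow> \<infinity> | Some b \<Rightarrow> enat (num b)),
     period = num \<Delta>\<rparr>"

lemma parts_instance_simps [simp]: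
  "num_vertices (parts_instance A D \<Delta>) = length A" "period (parts_instance A D \<Delta>) = num \<Delta>"
  "bound (parts_instance A D \<Delta>) u v = (case entry None (entry [] D u) v of None \<Rightarrow> \<infinity> | Some b \<Rightarrow>
      enat (num b))"
  by (simp_all add: parts_instance_def)

lemma parts_edge_iff:
  assumes "instance_ok A D \<Delta>"
  shows "{u, v} \<in> edges (parts_instance A D \<Delta>) \<longleftrightarrow> u < length A \<and> v < length A \<and> edge A u v"
  using assms unfolding parts_instance_def instance_ok_def by (auto simp: doubleton_eq_iff)

lemma encode_list_cong: "(\<And>x. x \<in> set xs \<Longrightarrow> e x = e' x) \<Longrightarrow> encode_list e xs = encode_list e' xs"
  by (induction xs) auto

lemma encode_parts_instance:
  assumes "instance_ok A D \<Delta>"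
  shows "encode_instance (parts_instance A D \<Delta>) = encode_parts A D \<Delta>"
proof -
  note ok = assms[unfolded instance_ok_def]
  have "map (\<lambda>u. map (\<lambda>v. {u, v} \<in> edges (parts_instance A D \<Delta>)) [0..<length A]) [0..<length A] = A"
    using ok by (intro nth_equalityI) (auto simp: parts_edge_iff[OF assms] edge_def entry_eq)
  moreover have bound: "encode_enat (bound (parts_instance A D \<Delta>) u v) =
      (case D ! u ! v of None \<Rightarrow> [False] | Some b \<Rightarrow> True # encode_list (\<lambda>b. [b]) b)"
    if "u < length A" "v < length A" for u v
  proof (cases "D ! u ! v")
    case None
    then show ?thesis using that ok by (simp add: entry_eq encode_enat_def)
  next
    case (Some b)
    have "D ! u \<in> set D" "D ! u ! v \<in> set (D ! u)" using that ok by auto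
    with ok Some have "canonical b" by fastforce
    then show ?thesis using that ok Some by (simp add: entry_eq encode_enat_def encode_nat_def binary_num)
  qed
  have "encode_matrix encode_enat (length A) (bound (parts_instance A D \<Delta>)) =
     encode_list (\<lambda>r. encode_list (\<lambda>d. case d of None \<Rightarrow> [False] | Some b \<Rightarrow>
         True # encode_list (\<lambda>b. [b]) b) r) D"
  proof -
    let ?e = "\<lambda>d. case d of None \<Rightarrow> [False] | Some b \<Rightarrow> True # encode_list (\<lambda>b. [b]) b"
    have D: "D = map (\<lambda>u. map (\<lambda>v. D ! u ! v) [0..<length A]) [0..<length A]"
      using ok by (intro nth_equalityI) auto
    have "encode_list (\<lambda>r. encode_list ?e r) D =
        encode_list (\<lambda>u. encode_list (\<lambda>v. ?e (D ! u ! v)) [0..<length A]) [0..<length A]"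
      by (subst D) (simp add: encode_list_map)
    also have "\<dots> = encode_matrix encode_enat (length A) (bound (parts_instance A D \<Delta>))"
      unfolding encode_matrix_def by (intro encode_list_cong) (use bound in auto)
    finally show ?thesis ..
  qed
  ultimately show ?thesis
    using ok unfolding encode_instance_def encode_parts_def
    by (simp add: encode_matrix_eq encode_nat_def binary_num)
qed

lemma path_ok_iff:
  "path_ok A d \<Delta> L u v ws \<longleftrightarrow> ws \<noteq> [] \<and> hd ws = u \<and> last ws = v \<and> distinct ws \<and> set ws \<subseteq> {..<length A} \<and>
     successively (edge A) ws \<and> in_time L \<Delta> d ws"
proof (cases "ws = []")
  case False
  then have "entry u ws 0 = hd ws" "entry u ws (length ws - 1) = last ws"
    by (simp_all add: entry_eq hd_conv_nth last_conv_nth)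
  moreover have "(\<forall>i<length ws. \<forall>j<length ws. i \<noteq> j \<longrightarrow> entry 0 ws i \<noteq> entry 0 ws j) \<longleftrightarrow> distinct ws"
    by (simp add: entry_eq distinct_conv_nth)
  moreover have "(\<forall>i<length ws. Suc i < length ws \<longrightarrow> edge A (entry 0 ws i) (entry 0 ws (Suc i))) \<longleftrightarrow>
      successively (edge A) ws"
    by (auto simp: entry_eq successively_conv_nth)
  ultimately show ?thesis by (auto simp: path_ok_def)
qed (simp add: path_ok_def)

lemma num_arrival:
  "num (arrival (foldl (travel (L, \<Delta>)) (w, k, T) vs)) =
      finish (\<lambda>u v. num (label L u v)) (num \<Delta>) w (num k) (num T) vs"
  by (induction vs arbitrary: w k T) (auto simp: travel_def arrival_def)

text \<open>Edges are unordered and labels are read above the diagonal; \<open>Min\<close> and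
  \<open>Max\<close> recover the endpoints.\<close>

definition labeling_of :: "bool list list list \<Rightarrow> nat set \<Rightarrow> nat" where
  "labeling_of L e = num (label L (Min e) (Max e))"

lemma labeling_of: "labeling_of L {u, v} = num (label L u v)"
  by (auto simp: labeling_of_def label_def min_def max_def)

text \<open>A certificate contains no times: the earliest schedule along its vertices, started at
  the label of the first edge, supplies the temporal path.\<close>

lemma path_ok_sound:
  assumes ok: "instance_ok A D \<Delta>" and path: "path_ok A d \<Delta> L u v ws" "u \<noteq> v"
    and labels: "\<And>u v. u < length A \<Longrightarrow> v < length A \<Longrightarrow> edge A u v \<Longrightarrow> num (label L u v) < num \<Delta>"
  shows "static_path {..<length A} (edges (parts_instance A D \<Delta>)) u v ws"
    "\<And>b. d = Some b \<Longrightarrow> \<exists>P. temporal_path (edges (parts_instance A D \<Delta>)) (num \<Delta>) (labeling_of L) u v P \<and>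
        duration P \<le> num b"
proof -
  let ?E = "edges (parts_instance A D \<Delta>)" and ?l = "\<lambda>u v. num (label L u v)"
  note p = path(1)[unfolded path_ok_iff]
  have steps: "successively (\<lambda>a b. {a, b} \<in> ?E \<and> ?l a b < num \<Delta>) ws"
    using p labels parts_edge_iff[OF ok] unfolding successively_conv_nth
    by (meson Suc_lessD lessThan_iff nth_mem subsetD)
  then show "static_path {..<length A} ?E u v ws"
    using p unfolding static_path_def by (auto elim: successively_mono)
  fix b assume d: "d = Some b"
  from p path(2) obtain w vs where ws: "ws = u # w # vs"
    by (cases ws; cases "tl ws") auto
  let ?Q = "schedule ?l (num \<Delta>) w (?l u w) 0 vs"
  let ?P = "(u, w, ?l u w) # ?Q"
  have uw: "{u, w} \<in> ?E" "?l u w < num \<Delta>" using steps ws by simp_all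
  have "successively (\<lambda>a b. {a, b} \<in> ?E \<and> ?l a b < num \<Delta>) (w # vs)" using steps ws by simp
  from schedule[OF _ uw(2) this, of 0 u]
  have Q: "consecutive ?P" "map (\<lambda>(u, v, t). v) ?Q = vs"
    "snd (last ?P) = (last (w # vs), finish ?l (num \<Delta>) w (?l u w) 0 vs)"
    "\<forall>(a, b, t)\<in>set ?Q. {a, b} \<in> ?E \<and> (\<exists>i. t = ?l a b + i * num \<Delta>)" by simp_all
  have "last (w # vs) = v" using p ws by simp
  then have "temporal_path ?E (num \<Delta>) (labeling_of L) u v ?P"
    using Q uw p ws unfolding temporal_path_def active_def labeling_of
    by (auto simp: case_prod_beta intro: exI[of _ 0])
  moreover have "finish ?l (num \<Delta>) w (?l u w) 0 vs < num b + ?l u w"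
    using p d ws by (simp add: in_time_def num_arrival)
  then have "duration ?P \<le> num b" using Q(3) by (simp add: duration_def)
  ultimately show "\<exists>P. temporal_path ?E (num \<Delta>) (labeling_of L) u v P \<and> duration P \<le> num b" by blast
qed

lemma temporal_imp_static:
  assumes "simple_graph V E" "temporal_path E \<Delta> lab u v P"
  shows "static_path V E u v (u # map (\<lambda>(a, b, t). b) P)"
proof -
  note P = assms(2)[unfolded temporal_path_def]
  have edge: "a \<in> V \<and> b \<in> V" if "{a, b} \<in> E" for a b
    using assms(1) that unfolding simple_graph_def by (auto simp: doubleton_eq_iff dest!: subsetD)
  have "successively (\<lambda>x y. {x, y} \<in> E) (u # map (\<lambda>(a, b, t). b) P)"
    if "fst (hd P) = u \<or> P = []" "successively (\<lambda>(u, v, t) (u', v', t'). v = u' \<and> t < t') P"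
      "\<forall>(a, b, t)\<in>set P. {a, b} \<in> E" for u and P :: "('a \<times> 'a \<times> nat) list"
    using that
  proof (induction P arbitrary: u)
    case (Cons s P)
    then show ?case by (cases s; cases P) (auto simp: successively_Cons)
  qed simp
  moreover have "last (u # map (\<lambda>(a, b, t). b) P) = v" using P by (simp add: last_map case_prod_beta)
  moreover have "set (u # map (\<lambda>(a, b, t). b) P) \<subseteq> V"
    using P edge by (cases P) (fastforce simp: case_prod_beta)+
  ultimately show ?thesis using P unfolding static_path_def by (auto simp: case_prod_beta)
qed

lemma check_sound:
  assumes "check x y"
  shows "\<exists>I. encode_instance I = x \<and> valid_instance I \<and> tgr_solvable I \<and> period I = num (period_of y)"
proof -
  obtain A D \<Delta> L P where y: "y = (A, D, \<Delta>, L, P)" by (rule prod_cases5)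
  let ?I = "parts_instance A D \<Delta>" and ?n = "length A"
  from assms have x: "x = encode_parts A D \<Delta>" and ok: "instance_ok A D \<Delta>" and
    labels: "\<And>u v. u < ?n \<Longrightarrow> v < ?n \<Longrightarrow> edge A u v \<Longrightarrow> num (label L u v) < num \<Delta>" and
    paths: "\<And>u v. u < ?n \<Longrightarrow> v < ?n \<Longrightarrow> u \<noteq> v \<Longrightarrow>
      path_ok A (entry None (entry [] D u) v) \<Delta> L u v (entry [] (entry [] P u) v)"
    unfolding check_def y by simp_all
  note ok' = ok[unfolded instance_ok_def]
  note sound = path_ok_sound[OF ok paths _ labels]
  have "num \<Delta> \<noteq> 0" using ok' binary_num[of \<Delta>] by (metis binary.simps)
  then have period: "1 \<le> num \<Delta>" by simp
  have simple: "simple_graph {..<?n} (edges ?I)"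
    unfolding simple_graph_def
  proof (intro conjI subsetI)
    fix e assume "e \<in> edges ?I"
    then obtain u v where "e = {u, v}" "u < ?n" "v < ?n" "edge A u v" unfolding parts_instance_def by auto
    moreover from this ok' have "u \<noteq> v" by blast
    ultimately show "e \<in> {{u, v} |u v. u \<in> {..<?n} \<and> v \<in> {..<?n} \<and> u \<noteq> v}" by blast
  qed simp
  have path: "\<exists>xs. static_path {..<?n} (edges ?I) u v xs" if "u < ?n" "v < ?n" for u v
  proof (cases "u = v")
    case True
    then have "static_path {..<?n} (edges ?I) u v [u]" using that by (simp add: static_path_def)
    then show ?thesis ..
  qed (use sound(1) that in blast)
  then have "connected_graph {..<?n} (edges ?I)"
    using ok' by (auto simp: connected_graph_def)
  moreover have fast: "fastest_duration (edges ?I) (num \<Delta>) (labeling_of L) u v \<le> bound ?I u v"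
    if "u < ?n" "v < ?n" "u \<noteq> v" for u v
  proof (cases "entry None (entry [] D u) v")
    case (Some b)
    then show ?thesis using sound(2)[OF that(1,2,3,3)] by (simp add: fastest_duration_le_iff)
  qed simp
  moreover have "1 \<le> bound ?I u v \<and> static_dist {..<?n} (edges ?I) u v \<le> bound ?I u v"
    if uv: "u < ?n" "v < ?n" "u \<noteq> v" for u v
  proof (cases "bound ?I u v")
    case (enat d)
    with fast[OF uv] obtain P where P: "temporal_path (edges ?I) (num \<Delta>) (labeling_of L) u v P"
        "duration P \<le> d"
      by (auto simp: fastest_duration_le_iff)
    have "P \<noteq> []" using P(1) by (simp add: temporal_path_def)
    then have "1 \<le> length P" by (cases P) simp_all
    moreover have "length P \<le> d" using length_le_duration[OF P(1)] P(2) by (rule order_trans)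
    moreover have "static_dist {..<?n} (edges ?I) u v \<le> enat (length P)"
      using static_dist_le[OF temporal_imp_static[OF simple P(1)]] by simp
    ultimately show ?thesis
      unfolding enat by (auto simp: one_enat_def intro: order_trans)
  qed simp
  ultimately have "valid_instance ?I" unfolding valid_instance_def using simple period by auto
  moreover have "labeling_of L e < num \<Delta>" if "e \<in> edges ?I" for e
    using that labels by (auto simp: parts_instance_def labeling_of)
  then have "tgr_solvable ?I" unfolding tgr_solvable_def periodic_labeling_def using fast by auto
  ultimately show ?thesis
    using encode_parts_instance[OF ok] by (intro exI[of _ ?I]) (simp add: x y period_of_def)
qed


text \<open>The given path may start \<open>i\<close> periods late. By \<open>finish_le\<close> the
  schedule that starts in the first period ends at least \<open>i\<close> periods sooner, so its
  duration is no longer.\<close>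

lemma in_time_complete:
  assumes "temporal_path E (num \<Delta>) lab u v P" "duration P \<le> num b"
    "\<And>a b. {a, b} \<in> E \<Longrightarrow> num (label L a b) = lab {a, b} \<and> lab {a, b} < num \<Delta>"
  shows "in_time L \<Delta> (Some b) (u # map (\<lambda>(a, b, t). b) P)"
proof -
  let ?l = "\<lambda>u v. num (label L u v)"
  note P' = assms(1)[unfolded temporal_path_def active_def]
  from P' obtain w t Q where P: "P = (u, w, t) # Q" by (cases P) auto
  from P' P assms(3) obtain i where i: "t = ?l u w + i * num \<Delta>" "?l u w < num \<Delta>" by auto
  have "\<forall>(a, b, t)\<in>set Q. ?l a b < num \<Delta> \<and> (\<exists>i. t = ?l a b + i * num \<Delta>)"
    using P' P assms(3) by fastforce
  with P' P i have "finish ?l (num \<Delta>) w (?l u w) 0 (map (\<lambda>(a, b, t). b) Q) + i * num \<Delta> \<le> snd (snd (last P))"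
    using finish_le[of u w "?l u w" i "num \<Delta>" Q 0 i ?l] by simp
  moreover have "snd (snd (last P)) + 1 - t \<le> num b" using assms(2) P by (simp add: duration_def)
  ultimately have "finish ?l (num \<Delta>) w (?l u w) 0 (map (\<lambda>(a, b, t). b) Q) < num b + ?l u w"
    using i(1) by linarith
  then show ?thesis using P by (simp add: in_time_def num_arrival)
qed

section \<open>Short certificates for solvable instances\<close>

definition matrix :: "nat \<Rightarrow> (nat \<Rightarrow> nat \<Rightarrow> 'a) \<Rightarrow> 'a list list" where
  "matrix n f = map (\<lambda>u. map (f u) [0..<n]) [0..<n]"

lemma entry_matrix [simp]: "u < n \<Longrightarrow> v < n \<Longrightarrow> entry d (entry [] (matrix n f) u) v = f u v"
  by (simp add: entry_eq matrix_def)

lemma length_matrix [simp]: "length (matrix n f) = n" "r \<in> set (matrix n f) \<Longrightarrow> length r = n"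
  by (auto simp: matrix_def)

lemma tsize_list_le: "(\<And>x. x \<in> set xs \<Longrightarrow> tsize x \<le> b) \<Longrightarrow> tsize xs \<le> 1 + length xs * (1 + b)"
  by (induction xs) (simp, fastforce)

lemma tsize_matrix_le:
  assumes "\<And>u v. u < n \<Longrightarrow> v < n \<Longrightarrow> tsize (f u v) \<le> b" "n \<le> m"
  shows "tsize (matrix n f) \<le> 1 + m * (2 + m * (1 + b))"
proof -
  have row: "tsize (map (f u) [0..<n]) \<le> 1 + n * (1 + b)" if "u < n" for u
  proof -
    have "tsize (map (f u) [0..<n]) \<le> 1 + length (map (f u) [0..<n]) * (1 + b)"
      by (rule tsize_list_le) (use assms(1)[OF that] in auto)
    then show ?thesis by simp
  qed
  have "tsize (matrix n f) \<le> 1 + n * (1 + (1 + n * (1 + b)))"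
  proof -
    have "tsize (matrix n f) \<le> 1 + length (matrix n f) * (1 + (1 + n * (1 + b)))"
      by (rule tsize_list_le) (use row in \<open>auto simp: matrix_def\<close>)
    then show ?thesis by simp
  qed
  also have "\<dots> \<le> 1 + m * (1 + (1 + m * (1 + b)))"
    using assms(2) by (intro add_mono mult_mono order.refl) auto
  finally show ?thesis by simp
qed

lemma length_encode_list:
  "length xs \<le> length (encode_list e xs)" "x \<in> set xs \<Longrightarrow> length (e x) \<le> length (encode_list e xs)"
  by (induction xs) auto

lemma length_encode_matrix:
  assumes "u < n" "v < n"
  shows "length (e (A u v)) \<le> length (encode_matrix e n A)"
proof -
  have "length (e (A u v)) \<le> length (encode_list (\<lambda>v. e (A u v)) [0..<n])"
    using length_encode_list(2)[of v "[0..<n]" "\<lambda>v. e (A u v)"] assms(2) by simp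
  also have "\<dots> \<le> length (encode_matrix e n A)"
    unfolding encode_matrix_def
    using length_encode_list(2)[of u "[0..<n]" "\<lambda>u. encode_list (\<lambda>v. e (A u v)) [0..<n]"] assms(1) by simp
  finally show ?thesis .
qed

text \<open>At input length \<open>N\<close>, the polynomial \<open>[:5, 6, 2:]\<close> bounds an
  entry of any of the four matrices: a bit, a number of at most \<open>N\<close> bits, or a path of
  at most \<open>N\<close> vertices. The matrices have at most \<open>N\<close> rows and columns,
  and \<open>[:5, 4:]\<close> covers the period and the pair nodes.\<close>

definition certificate_bound :: "nat poly" where
  "certificate_bound = [:5, 4:] + 4 * (1 + [:0, 1:] * (2 + [:0, 1:] * (1 + [:5, 6, 2:])))"

lemma check_complete:
  assumes valid: "valid_instance I" and solvable: "tgr_solvable I"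
  shows "\<exists>y. check (encode_instance I) y \<and> period_of y = binary (period I) \<and>
    tsize y \<le> poly certificate_bound (length (encode_instance I))"
proof -
  let ?n = "num_vertices I" and ?E = "edges I" and ?\<Delta> = "binary (period I)" and ?N =
      "length (encode_instance I)"
  from solvable obtain lab where lab: "\<And>e. e \<in> ?E \<Longrightarrow> lab e < period I" and
    fast: "\<And>u v. u < ?n \<Longrightarrow> v < ?n \<Longrightarrow> u \<noteq> v \<Longrightarrow> fastest_duration ?E (period I) lab u v \<le> bound I u v"
    unfolding tgr_solvable_def periodic_labeling_def by blast
  have simple: "simple_graph {..<?n} ?E" and connected: "connected_graph {..<?n} ?E" and "1 \<le> period I"
    using valid by (auto simp: valid_instance_def)
  have E: "{u, v} \<in> ?E \<Longrightarrow> u < ?n \<and> v < ?n \<and> u \<noteq> v" for u v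
    using simple unfolding simple_graph_def by (auto simp: doubleton_eq_iff dest!: subsetD)
  define A where "A = matrix ?n (\<lambda>u v. {u, v} \<in> ?E)"
  define D where "D = matrix ?n (\<lambda>u v. case bound I u v of enat m \<Rightarrow> Some (binary m) | \<infinity> \<Rightarrow> None)"
  define L where "L = matrix ?n (\<lambda>u v. if {u, v} \<in> ?E then binary (lab {u, v}) else [])"
  have edge: "edge A u v \<longleftrightarrow> {u, v} \<in> ?E" if "u < ?n" "v < ?n" for u v
    using that by (simp add: edge_def A_def)
  have label: "num (label L u v) = lab {u, v} \<and> lab {u, v} < period I" if "{u, v} \<in> ?E" for u v
    using E[OF that] that lab by (auto simp: label_def L_def insert_commute)
  have "\<exists>ws. path_ok A (entry None (entry [] D u) v) ?\<Delta> L u v ws" if uv: "u < ?n" "v < ?n" "u \<noteq> v" for u v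
  proof -
    have path: "path_ok A d ?\<Delta> L u v ws" if "static_path {..<?n} ?E u v ws" "in_time L ?\<Delta> d ws" for d ws
    proof -
      have "successively (edge A) ws"
        using that(1) E edge unfolding static_path_def by (auto elim!: successively_mono)
      then show ?thesis using that unfolding path_ok_iff static_path_def by (simp add: A_def)
    qed
    show ?thesis
    proof (cases "bound I u v")
      case (enat m)
      with fast[OF uv] obtain P where P: "temporal_path ?E (period I) lab u v P" "duration P \<le> m"
        by (auto simp: fastest_duration_le_iff)
      have "in_time L ?\<Delta> (Some (binary m)) (u # map (\<lambda>(a, b, t). b) P)"
        by (rule in_time_complete[where E = ?E and lab = lab and v = v]) (use P label in simp_all)
      with path[OF temporal_imp_static[OF simple P(1)]] show ?thesis using uv enat by (auto simp: D_def)
    next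
      case infinity
      with uv have "in_time L ?\<Delta> (entry None (entry [] D u) v) ws" for ws by (simp add: D_def in_time_def)
      with connected path uv show ?thesis unfolding connected_graph_def by blast
    qed
  qed
  then obtain path where path: "\<And>u v. u < ?n \<Longrightarrow> v < ?n \<Longrightarrow> u \<noteq> v \<Longrightarrow>
      path_ok A (entry None (entry [] D u) v) ?\<Delta> L u v (path u v)" by metis
  \<comment> \<open>The choice of \<open>path\<close> says nothing about the diagonal, so its size
    there is unknown; the empty list keeps the certificate short.\<close>
  define P where "P = matrix ?n (\<lambda>u v. if u = v then [] else path u v)"
  have code: "encode_instance I = encode_parts A D ?\<Delta>"
  proof -
    have "encode_enat x = (case (case x of enat m \<Rightarrow> Some (binary m) | \<infinity> \<Rightarrow> None) of None \<Rightarrow> [False]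
        | Some b \<Rightarrow> True # encode_list (\<lambda>b. [b]) b)" for x
      by (simp add: encode_enat_def encode_nat_def split: enat.split)
    then show ?thesis
      by (simp add: encode_instance_def encode_parts_def encode_matrix_def A_def D_def matrix_def
          encode_list_map encode_nat_def)
  qed
  have "instance_ok A D ?\<Delta>"
    unfolding instance_ok_def
  proof (intro conjI ballI allI impI)
    have "?n \<noteq> 0" using connected by (auto simp: connected_graph_def)
    then show "A \<noteq> []" by (metis A_def length_matrix(1) length_0_conv)
    show "?\<Delta> \<noteq> []" using \<open>1 \<le> period I\<close> by (subst binary.simps) simp
    show "edge A u v = edge A v u" if "u < length A" "v < length A" for u v
      using that edge by (simp add: A_def insert_commute)
    show "\<not> edge A u u" if "u < length A" for u
      using that edge E[of u u] by (auto simp: A_def)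
    show "case d of None \<Rightarrow> True | Some b \<Rightarrow> canonical b" if "r \<in> set D" "d \<in> set r" for r d
      using that by (auto simp: D_def matrix_def canonical_binary split: enat.splits)
  qed (auto simp: A_def D_def canonical_binary)
  then have "check (encode_instance I) (A, D, ?\<Delta>, L, P)"
    using code label edge path by (simp add: check_def A_def P_def)
  moreover have "tsize (A, D, ?\<Delta>, L, P) \<le> poly certificate_bound ?N"
  proof -
    let ?B = "5 + 6 * ?N + 2 * ?N * ?N"
    let ?C = "1 + ?N * (2 + ?N * (1 + ?B))"
    have "?n \<le> ?N"
      using length_encode_list(1)[of "[0..<?n]"] unfolding encode_instance_def encode_matrix_def
      by (simp add: trans_le_add1)
    have "length ?\<Delta> \<le> length (encode_nat (period I))"
      unfolding encode_nat_def by (rule length_encode_list(1))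
    then have "length ?\<Delta> \<le> ?N" by (simp add: encode_instance_def)
    then have period: "tsize ?\<Delta> \<le> 4 * ?N + 1" using tsize_bools(1)[of ?\<Delta>] by linarith
    have "tsize (case bound I u v of enat m \<Rightarrow> Some (binary m) | \<infinity> \<Rightarrow> None) \<le> ?B"
      if "u < ?n" "v < ?n" for u v
    proof (cases "bound I u v")
      case (enat m)
      have "length (binary m) \<le> length (encode_nat m)"
          unfolding encode_nat_def by (rule length_encode_list(1))
      also have "\<dots> \<le> length (encode_enat (bound I u v))" by (simp add: enat encode_enat_def)
      also have "\<dots> \<le> length (encode_matrix encode_enat ?n (bound I))"
          using that by (rule length_encode_matrix)
      also have "\<dots> \<le> ?N" by (simp add: encode_instance_def)
      finally show ?thesis using tsize_bools(1)[of "binary m"] by (simp add: enat)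
    qed simp
    from tsize_matrix_le[OF this \<open>?n \<le> ?N\<close>]
    have D: "tsize D \<le> ?C" unfolding D_def .
    have A: "tsize A \<le> ?C"
      unfolding A_def by (rule tsize_matrix_le[OF _ \<open>?n \<le> ?N\<close>]) simp
    have L: "tsize L \<le> ?C"
      unfolding L_def
    proof (rule tsize_matrix_le[OF _ \<open>?n \<le> ?N\<close>])
      fix u v
      have "length (binary (lab {u, v})) \<le> ?N" if "{u, v} \<in> ?E"
      proof -
        \<comment> \<open>Labels are smaller than the period and so have at most as many
          bits.\<close>
        have "lab {u, v} < 2 ^ length ?\<Delta>" using lab[OF that] num_less[of ?\<Delta>] by simp
        from length_binary[OF this] \<open>length ?\<Delta> \<le> ?N\<close> show ?thesis by simp
      qed
      then show "tsize (if {u, v} \<in> ?E then binary (lab {u, v}) else []) \<le> ?B"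
        using tsize_bools(1)[of "binary (lab {u, v})"] by auto
    qed
    have P: "tsize P \<le> ?C"
      unfolding P_def
    proof (rule tsize_matrix_le[OF _ \<open>?n \<le> ?N\<close>])
      fix u v assume uv: "u < ?n" "v < ?n"
      have "tsize (path u v) \<le> ?B" if "u \<noteq> v"
      proof -
        from path[OF uv that] have ws: "distinct (path u v)" "set (path u v) \<subseteq> {..<?n}"
          by (simp_all add: path_ok_iff A_def)
        then have "length (path u v) \<le> ?N"
          using card_mono[OF _ ws(2)] distinct_card[OF ws(1)] \<open>?n \<le> ?N\<close> by simp
        moreover have "tsize (path u v) \<le> 1 + length (path u v) * (1 + (2 * ?N + 1))"
          using ws(2) \<open>?n \<le> ?N\<close> by (intro tsize_list_le) auto
        ultimately have "tsize (path u v) \<le> 1 + ?N * (1 + (2 * ?N + 1))"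
          by (meson add_left_mono mult_le_mono1 order_trans)
        then show ?thesis by (simp add: algebra_simps)
      qed
      then show "tsize (if u = v then [] else path u v) \<le> ?B" by simp
    qed
    have "poly certificate_bound ?N = 5 + 4 * ?N + 4 * ?C"
        by (simp add: certificate_bound_def algebra_simps)
    moreover have "tsize (A, D, ?\<Delta>, L, P) = 4 + tsize A + tsize D + tsize ?\<Delta> + tsize L + tsize P" by simp
    moreover have "4 + a + d + b + l + q \<le> 5 + 4 * n + 4 * c"
      if "a \<le> c" "d \<le> c" "b \<le> 4 * n + 1" "l \<le> c" "q \<le> c" for a b c d l n q :: nat
      using that by linarith
    from this[OF A D period L P] calculation show ?thesis by (simp only:)
  qed
  ultimately show ?thesis by (intro exI[of _ "(A, D, ?\<Delta>, L, P)"]) (simp only: period_of_def prod.case)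
qed

theorem NP_TGR: "TGR \<in> NP" "TGR_with_period 2 \<in> NP"
proof -
  obtain u :: "tree \<Rightarrow> certificate" where u: "decoder u"
    using decoder_prod[OF decoder_list[OF decoder_list[OF decoder_bool]]
        decoder_prod[OF decoder_list[OF decoder_list[OF decoder_option[OF decoder_list[OF decoder_bool]]]]
          decoder_prod[OF decoder_list[OF decoder_bool]
            decoder_prod[OF decoder_list[OF decoder_list[OF decoder_list[OF decoder_bool]]]
              decoder_list[OF decoder_list[OF decoder_list[OF decoder_nat]]]]]]] by blast
  show "TGR \<in> NP"
  proof (rule NP_I[OF u ptime_check])
    show "x \<in> TGR" if "check x y" for x y
      using check_sound[OF that] unfolding TGR_def by blast
    show "\<exists>y. check x y \<and> tsize y \<le> poly certificate_bound (length x)"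
      if "x \<in> TGR" for x
      using that check_complete unfolding TGR_def by blast
  qed
  have binary_2: "binary 2 = [False, True]"
    by (subst binary.simps, simp, subst binary.simps, simp, subst binary.simps, simp)
  \<comment> \<open>The parts of the certificate encode to the input, so its period is the one of
    the instance and can be compared with the binary form of 2.\<close>
  let ?R = "\<lambda>x y. check x y \<and> period_of y = [False, True]"
  show "TGR_with_period 2 \<in> NP"
  proof (rule NP_I[OF u, of ?R])
    show "poly_time (\<lambda>z. ?R (fst z) (snd z))" by (intro ptime ptime_check)
    show "x \<in> TGR_with_period 2" if "?R x y" for x y
      using check_sound[of x y] that unfolding TGR_with_period_def by fastforce
    show "\<exists>y. ?R x y \<and> tsize y \<le> poly certificate_bound (length x)"
      if "x \<in> TGR_with_period 2" for x
      using that check_complete binary_2 unfolding TGR_with_period_def by force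
  qed
qed

theorem corollary12:
  shows "NP_complete TGR \<and> NP_complete (TGR_with_period 2)"
  unfolding NP_complete_def using NP_TGR NP_hard_TGR by blast

end
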